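(* There are infinitely many cyclic cubic number fields $K$ such that in each of them there exist infinitely many non-constant arithmetic progressions of four squares over $K$.
   Context: A non-constant arithmetic progression of four squares over a field $K$ is a quadruple $a^2,b^2,c^2,d^2$ with $a,b,c,d\in K$ such that $b^2-a^2=c^2-b^2=d^2-c^2\neq 0$; progressions are counted up to scaling, i.e. as points $[a:b:c:d]\in\mathbb{P}^3(K)$. A cyclic cubic number field is a Galois extension of $\mathbb{Q}$ of degree $3$. *)

theory Defs
  imports Complex_Main
begin

text \<open>Number fields are modelled as subfields of the complex numbers.  A Galois
  number field has a unique image in the complex numbers, so distinct subfields
  that are Galois over the rationals are pairwise non-isomorphic fields.\<close>

definition subfield_of_complex :: "complex set \<Rightarrow> bool" where
  "subfield_of_complex K \<longleftrightarrow>
     0 \<in> K \<and> 1 \<in> K \<and>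
     (\<forall>x\<in>K. \<forall>y\<in>K. x + y \<in> K \<and> x - y \<in> K \<and> x * y \<in> K) \<and>
     (\<forall>x\<in>K. inverse x \<in> K)"

definition degree_three_over_Q :: "complex set \<Rightarrow> bool" where
  "degree_three_over_Q K \<longleftrightarrow>
     (\<exists>b1\<in>K. \<exists>b2\<in>K. \<exists>b3\<in>K. \<forall>x\<in>K. \<exists>!q :: rat \<times> rat \<times> rat.
        x = of_rat (fst q) * b1 + of_rat (fst (snd q)) * b2 + of_rat (snd (snd q)) * b3)"

definition normal_over_Q :: "complex set \<Rightarrow> bool" where
  "normal_over_Q K \<longleftrightarrow>
     (\<forall>\<sigma> :: complex \<Rightarrow> complex.
        (\<sigma> 1 = 1 \<and> (\<forall>x\<in>K. \<forall>y\<in>K. \<sigma> (x + y) = \<sigma> x + \<sigma> y \<and> \<sigma> (x * y) = \<sigma> x * \<sigma> y))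
        \<longrightarrow> \<sigma> ` K \<subseteq> K)"

definition cyclic_cubic_field :: "complex set \<Rightarrow> bool" where
  "cyclic_cubic_field K \<longleftrightarrow>
     subfield_of_complex K \<and> degree_three_over_Q K \<and> normal_over_Q K"

definition ap4sq :: "complex set \<Rightarrow> complex \<times> complex \<times> complex \<times> complex \<Rightarrow> bool" where
  "ap4sq K v \<longleftrightarrow> (case v of (a, b, c, d) \<Rightarrow>
     a \<in> K \<and> b \<in> K \<and> c \<in> K \<and> d \<in> K \<and>
     b^2 - a^2 = c^2 - b^2 \<and> c^2 - b^2 = d^2 - c^2 \<and> b^2 - a^2 \<noteq> 0)"

definition proj_point :: "complex set \<Rightarrow> complex \<times> complex \<times> complex \<times> complex
     \<Rightarrow> (complex \<times> complex \<times> complex \<times> complex) set" where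
  "proj_point K v = (case v of (a, b, c, d) \<Rightarrow>
     {(l * a, l * b, l * c, l * d) | l. l \<in> K \<and> l \<noteq> 0})"

definition ap4sq_points :: "complex set \<Rightarrow> (complex \<times> complex \<times> complex \<times> complex) set set" where
  "ap4sq_points K = proj_point K ` {v. ap4sq K v}"

end

theory Submission
  imports Defs "HOL-Computational_Algebra.Computational_Algebra" "HOL-Number_Theory.Cong"
begin

text \<open>
  Progressions of four squares over \<open>K\<close> are points of \<open>E: y\<^sup>2 = x (x - 1) (x + 3)\<close> of the form \<open>(3, 6) + 2 P\<close>.
  The line \<open>y = x + n\<close> meets \<open>E\<close> in the roots of the cubic \<open>x\<^sup>3 + x\<^sup>2 - (3 + 2 n) x - n\<^sup>2\<close>, and for
  \<open>n = -1 + 8 / X\<close> the discriminant of this cubic is a square as soon as \<open>X\<close> is the abscissa of a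
  rational point \<open>(A / B\<^sup>2, C / B\<^sup>3)\<close> of \<open>D: Y\<^sup>2 = X\<^sup>3 - 10 X\<^sup>2 + 88 X - 108\<close>, a curve of positive rank.
  When the point of \<open>D\<close> is 2-adically close to the origin, the double of the point of \<open>E\<close> over the cubic
  field is close to the origin at a prime above 2, so that repeated doubling yields infinitely many points.

  The cubic field is totally ramified at every prime that divides \<open>A\<close> with multiplicity not divisible by 3.
  If there were no such prime, then \<open>A\<close> and hence (by unique factorization in \<open>\<int>[\<omega>]\<close>) the third power
  of the Lagrange resolvent would be a cube in \<open>\<rat>(\<omega>)\<close>, so that the cubic would have a rational root; but Fermat's descent shows that
  the finitely many rational points of \<open>E\<close> give no such \<open>n\<close>.  On the other hand, primes dividing \<open>B\<close> are
  unramified.  Given finitely many fields, a difference of two congruent points of \<open>D\<close> provides a point for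
  which \<open>B\<close> is divisible by one ramified prime of each of them, hence a new field.
\<close>

section \<open>Integer and rational squares\<close>

text \<open>The discriminant of the cubic,
  \<open>(n + 1) * (- 27 * n^3 + 95 * n^2 + 111 * n + 117)\<close>, has the rational root -1. The
  substitution \<open>n + 1 = 8 / X\<close> sends this root to infinity and turns
  \<open>disc = w^2\<close> into the equation of \<open>D\<close>, with
  \<open>w = 32 * Y / X^2\<close>. At \<open>n = - 1\<close> the cubic itself is
  \<open>(x - 1) * (x + 1)^2\<close>. Since \<open>n + 1 = 8 * B^2 / A\<close>, a prime dividing
  \<open>B\<close> sees a perturbation of this product. For an odd prime the product is not a cube,
  which excludes total ramification. At a suitable prime above 2 the root is close to 1, so the
  point of \<open>E\<close> is close to the 2-torsion point (1, 0), and its double is close to the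
  origin. Local statements are phrased without completions or prime ideals: total ramification
  through norms from an Eisenstein order, closeness at 2 through the proper ideal
  \<open>(2, z)\<close>. The seed 8 (2, 6) is the first doubling of (2, 6) whose denominator is
  divisible by 6: 2 (2, 6) has \<open>B = 1\<close> and 4 (2, 6) has \<open>B = 302\<close>.\<close>

lemma coprimeI_prime_int:
  fixes a b :: int
  assumes "a \<noteq> 0 \<or> b \<noteq> 0" and "\<And>q. prime q \<Longrightarrow> q dvd a \<Longrightarrow> q dvd b \<Longrightarrow> False"
  shows "coprime a b"
proof (rule ccontr)
  assume "\<not> coprime a b"
  then have "\<not> is_unit (gcd a b)" by (simp add: coprime_iff_gcd_eq_1)
  moreover have "gcd a b \<noteq> 0" using assms(1) by auto
  ultimately obtain q where "prime q" "q dvd gcd a b" by (metis prime_divisor_exists)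
  then show False using assms(2) by auto
qed

lemma coprime_mult_square_int:
  fixes a b c :: int
  assumes "a * b = c^2" and "coprime a b" and "a \<ge> 0" "b \<ge> 0"
  obtains m n where "a = m^2" "b = n^2"
proof -
  have e: "nat a * nat b = (nat \<bar>c\<bar>)^2"
    using assms by (metis nat_mult_distrib nat_power_eq abs_ge_zero power2_abs)
  moreover have c: "coprime (nat a) (nat b)" using assms by (simp add: coprime_int_iff[symmetric])
  ultimately have "is_nth_power 2 (nat a)" "is_nth_power 2 (nat b)"
    using is_nth_power_mult_coprime_nat_iff[of "nat a" "nat b" 2] by (metis is_nth_powerI)+
  then obtain m n where "nat a = m^2" "nat b = n^2" by (auto elim!: is_nth_powerE)
  then have "a = (int m)^2" "b = (int n)^2" using assms by (metis nat_0_le of_nat_power)+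
  then show ?thesis using that by blast
qed

lemma rat_square_int:
  fixes r :: rat
  assumes "r^2 = of_int k"
  obtains m where "r = of_int m"
proof -
  obtain a b where ab: "quotient_of r = (a, b)" by (cases "quotient_of r")
  have b: "b > 0" and cop: "coprime a b" using quotient_of_denom_pos[OF ab] quotient_of_coprime[OF ab] by auto
  have r: "r = of_int a / of_int b" by (rule quotient_of_div[OF ab])
  have "(of_int (a^2) :: rat) = of_int (k * b^2)"
    using assms b unfolding r by (simp add: power_divide field_simps)
  then have "a^2 = k * b^2" by (simp only: of_int_eq_iff)
  then have "b dvd a * a" by (simp add: power2_eq_square)
  then have "b dvd a" using cop by (metis coprime_commute coprime_dvd_mult_right_iff)
  then have "is_unit b" using coprime_common_divisor[OF cop, of b] by simp
  then have "b = 1" using b by (simp add: zdvd1_eq)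
  then have "r = of_int a" by (simp add: r)
  then show ?thesis by (rule that)
qed

section \<open>Cubic fields\<close>

definition cubic_span :: "complex \<Rightarrow> complex set" where
  "cubic_span x = {of_rat a + of_rat b * x + of_rat c * x^2 | a b c. True}"

lemma cubic_spanI: "of_rat a + of_rat b * x + of_rat c * x^2 \<in> cubic_span x"
  unfolding cubic_span_def by blast

lemma cubic_spanE:
  assumes "u \<in> cubic_span x"
  obtains a b c where "u = of_rat a + of_rat b * x + of_rat c * x^2"
  using assms unfolding cubic_span_def by blast

text \<open>Irreducibility is kept apart: the ring operations on the span need only the cubic
  relation. \<open>ramifiedI\<close> uses them for an Eisenstein generator whose irreducibility is
  never established.\<close>

locale cubic_root =
  fixes b c d :: rat and x :: complex
  assumes root: "x^3 + of_rat b * x^2 + of_rat c * x + of_rat d = 0"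
begin

lemma cube: "x^3 = - (of_rat b * x^2 + of_rat c * x + of_rat d)"
proof -
  have "x^3 + (of_rat b * x^2 + of_rat c * x + of_rat d) = 0" using root by (simp add: add.assoc)
  then show ?thesis by (rule eq_neg_iff_add_eq_0[THEN iffD2])
qed

lemma span_rat: "of_rat r \<in> cubic_span x"
  using cubic_spanI[of r 0 x 0] by simp

lemma span_gen: "x \<in> cubic_span x"
  using cubic_spanI[of 0 1 x 0] by simp

lemma span_add: "u \<in> cubic_span x \<Longrightarrow> v \<in> cubic_span x \<Longrightarrow> u + v \<in> cubic_span x"
proof (elim cubic_spanE)
  fix p q r p' q' r'
  assume "u = of_rat p + of_rat q * x + of_rat r * x^2" "v = of_rat p' + of_rat q' * x + of_rat r' * x^2"
  then have "u + v = of_rat (p + p') + of_rat (q + q') * x + of_rat (r + r') * x^2"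
    by (simp add: of_rat_add algebra_simps)
  then show ?thesis using cubic_spanI by simp
qed

lemma span_scale: "u \<in> cubic_span x \<Longrightarrow> of_rat t * u \<in> cubic_span x"
proof (elim cubic_spanE)
  fix p q r
  assume "u = of_rat p + of_rat q * x + of_rat r * x^2"
  then have "of_rat t * u = of_rat (t * p) + of_rat (t * q) * x + of_rat (t * r) * x^2"
    by (simp add: of_rat_mult algebra_simps)
  then show ?thesis using cubic_spanI by simp
qed

lemma span_gen_mult: "u \<in> cubic_span x \<Longrightarrow> x * u \<in> cubic_span x"
proof (elim cubic_spanE)
  fix p q r
  assume u: "u = of_rat p + of_rat q * x + of_rat r * x^2"
  have "x * u = of_rat p * x + of_rat q * x^2 + of_rat r * x^3"
    unfolding u by (simp add: algebra_simps power2_eq_square power3_eq_cube)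
  also have "\<dots> = of_rat (- r * d) + of_rat (p - r * c) * x + of_rat (q - r * b) * x^2"
    unfolding cube by (simp add: of_rat_diff of_rat_mult of_rat_minus algebra_simps)
  finally show ?thesis using cubic_spanI by simp
qed

lemma span_mult: "u \<in> cubic_span x \<Longrightarrow> v \<in> cubic_span x \<Longrightarrow> u * v \<in> cubic_span x"
proof (elim cubic_spanE[of u])
  fix p q r
  assume v: "v \<in> cubic_span x" and u: "u = of_rat p + of_rat q * x + of_rat r * x^2"
  have "u * v = of_rat p * v + of_rat q * (x * v) + of_rat r * (x * (x * v))"
    unfolding u by (simp add: algebra_simps power2_eq_square)
  then show ?thesis using v by (simp add: span_add span_scale span_gen_mult)
qed

lemma span_uminus: "u \<in> cubic_span x \<Longrightarrow> - u \<in> cubic_span x"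
  using span_scale[of u "-1"] by (simp add: of_rat_minus)

lemma span_diff: "u \<in> cubic_span x \<Longrightarrow> v \<in> cubic_span x \<Longrightarrow> u - v \<in> cubic_span x"
  using span_add[of u "- v"] span_uminus by simp

lemma span_power: "u \<in> cubic_span x \<Longrightarrow> u ^ k \<in> cubic_span x"
  by (induction k) (use span_rat[of 1] in \<open>auto intro: span_mult\<close>)

end

locale cubic = cubic_root +
  assumes no_root: "\<And>r :: rat. r^3 + b * r^2 + c * r + d \<noteq> 0"
begin

lemma not_rat: "x \<noteq> of_rat r"
proof
  assume x: "x = of_rat r"
  have "of_rat (r^3 + b * r^2 + c * r + d) = (0 :: complex)"
    using root unfolding x by (simp add: of_rat_add of_rat_mult of_rat_power)
  then show False using no_root[of r] by simp
qed

lemma linear_zero: "of_rat p + of_rat q * x = 0 \<Longrightarrow> p = 0 \<and> q = 0"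
proof -
  assume h: "of_rat p + of_rat q * x = 0"
  have "q = 0"
  proof (rule ccontr)
    assume q: "q \<noteq> 0"
    have "of_rat q * x = - of_rat p" using h by (metis add_eq_0_iff)
    then have "x = - of_rat p / of_rat q" using q by (metis nonzero_mult_div_cancel_left of_rat_eq_0_iff)
    then have "x = of_rat (- p / q)" by (simp add: of_rat_divide of_rat_minus)
    then show False using not_rat by blast
  qed
  with h show ?thesis by simp
qed

text \<open>Division of the cubic by a monic quadratic, with linear remainder
  \<open>l0 + l1 * x\<close>. A zero remainder would leave the linear factor with rational root
  \<open>p - b\<close>. This serves both linear independence and inversion.\<close>

lemma quadratic_cofactor:
  fixes p s :: rat
  defines "l1 \<equiv> c - s - p * (b - p)" and "l0 \<equiv> d - s * (b - p)"
  shows "(of_rat s + of_rat p * x + x^2) * (x + of_rat (b - p)) = - (of_rat l0 + of_rat l1 * x)"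
    and "l0 \<noteq> 0 \<or> l1 \<noteq> 0"
proof -
  show "(of_rat s + of_rat p * x + x^2) * (x + of_rat (b - p)) = - (of_rat l0 + of_rat l1 * x)"
    using root unfolding l0_def l1_def
    by (simp add: of_rat_diff of_rat_mult) algebra
  show "l0 \<noteq> 0 \<or> l1 \<noteq> 0"
  proof (rule ccontr)
    assume "\<not> ?thesis"
    then have c: "c = s + p * (b - p)" and d: "d = s * (b - p)" by (simp_all add: l0_def l1_def)
    have "(p - b)^3 + b * (p - b)^2 + c * (p - b) + d = 0"
      unfolding c d by (simp add: power2_eq_square power3_eq_cube algebra_simps)
    then show False using no_root by blast
  qed
qed

lemma indep:
  assumes "of_rat p + of_rat q * x + of_rat r * x^2 = 0"
  shows "p = 0 \<and> q = 0 \<and> r = 0"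
proof -
  have "r = 0"
  proof (rule ccontr)
    assume r: "r \<noteq> 0"
    have "of_rat r * (of_rat (p/r) + of_rat (q/r) * x + x^2) = 0"
      using assms r by (simp add: of_rat_divide field_simps)
    then have z: "of_rat (p/r) + of_rat (q/r) * x + x^2 = 0" using r by simp
    define l1 where "l1 = c - p/r - q/r * (b - q/r)"
    define l0 where "l0 = d - p/r * (b - q/r)"
    have "- (of_rat l0 + of_rat l1 * x) = 0"
      using quadratic_cofactor(1)[of "p/r" "q/r"] z unfolding l1_def l0_def by (metis mult_zero_left)
    then have "of_rat l0 + of_rat l1 * x = 0" by (simp only: neg_equal_0_iff_equal)
    then show False
      using linear_zero quadratic_cofactor(2)[of "p/r" "q/r"] unfolding l1_def l0_def by blast
  qed
  with assms show ?thesis using linear_zero by simp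
qed

lemma indep_eq:
  assumes "of_rat p + of_rat q * x + of_rat r * x^2 = of_rat p' + of_rat q' * x + of_rat r' * x^2"
  shows "p = p' \<and> q = q' \<and> r = r'"
proof -
  have "of_rat (p - p') + of_rat (q - q') * x + of_rat (r - r') * x^2 = 0"
    using assms by (simp add: of_rat_diff algebra_simps)
  from indep[OF this] show ?thesis by simp
qed

lemma span_inverse_linear:
  assumes "p \<noteq> 0 \<or> q \<noteq> 0"
  shows "inverse (of_rat p + of_rat q * x) \<in> cubic_span x"
proof (cases "q = 0")
  case True
  then show ?thesis using span_rat[of "inverse p"] by (simp add: of_rat_inverse)
next
  case False
  define r where "r = - p / q"
  define k where "k = r^3 + b * r^2 + c * r + d"
  have k: "k \<noteq> 0" using no_root unfolding k_def .
  \<comment> \<open>\<open>w\<close> is the quotient of \<open>f(x) - f(r)\<close> by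
    \<open>x - r\<close>, where \<open>f\<close> is the cubic; hence the product with
    \<open>x - r\<close> is \<open>- f(r) = - k\<close>.\<close>
  define w where "w = of_rat (c + b * r + r^2) + of_rat (b + r) * x + of_rat 1 * x^2"
  have lin: "of_rat p + of_rat q * x = of_rat q * (x - of_rat r)"
    unfolding r_def using False by (simp add: of_rat_divide of_rat_minus distrib_left)
  have "(x - of_rat r) * w = - of_rat k"
    unfolding w_def k_def using root
    by (simp add: of_rat_add of_rat_mult of_rat_power) algebra
  moreover have "(of_rat p + of_rat q * x) * (of_rat (- 1 / (q * k)) * w) =
      - ((x - of_rat r) * w) * of_rat (1 / k)"
    unfolding lin using k False by (simp add: of_rat_divide of_rat_mult of_rat_minus)
  ultimately have "(of_rat p + of_rat q * x) * (of_rat (- 1 / (q * k)) * w) = 1"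
    using k by (simp add: of_rat_divide)
  then have "inverse (of_rat p + of_rat q * x) = of_rat (- 1 / (q * k)) * w"
    by (rule inverse_unique)
  then show ?thesis using span_scale cubic_spanI unfolding w_def by metis
qed

text \<open>Multiplication by the cofactor from \<open>quadratic_cofactor\<close> turns a quadratic
  element into a nonzero linear one, which is already known to be invertible in the span.\<close>

lemma span_inverse:
  assumes "u \<in> cubic_span x"
  shows "inverse u \<in> cubic_span x"
proof -
  obtain p q r where u: "u = of_rat p + of_rat q * x + of_rat r * x^2"
    using assms by (rule cubic_spanE)
  show ?thesis
  proof (cases "r = 0")
    case True
    show ?thesis
    proof (cases "p = 0 \<and> q = 0")
      case True
      then show ?thesis using u \<open>r = 0\<close> span_rat[of 0] by simp
    next
      case False
      then show ?thesis using u True span_inverse_linear[of p q] by auto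
    qed
  next
    case r: False
    define s t where "s = p / r" and "t = q / r"
    define l1 where "l1 = c - s - t * (b - t)"
    define l0 where "l0 = d - s * (b - t)"
    have u': "u = of_rat r * (of_rat s + of_rat t * x + x^2)"
      unfolding u s_def t_def using r by (simp add: of_rat_divide field_simps)
    define l where "l = of_rat l0 + of_rat l1 * x"
    have l0: "l \<noteq> 0" using linear_zero quadratic_cofactor(2)[of s t] unfolding l_def l0_def l1_def by blast
    have li: "inverse l \<in> cubic_span x"
      using span_inverse_linear quadratic_cofactor(2)[of s t] unfolding l_def l0_def l1_def by blast
    have "(of_rat s + of_rat t * x + x^2) * (x + of_rat (b - t)) = - l"
      using quadratic_cofactor(1)[of s t] unfolding l_def l0_def l1_def .
    moreover have "u * (of_rat (- 1 / r) * ((x + of_rat (b - t)) * inverse l)) =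
        - ((of_rat s + of_rat t * x + x^2) * (x + of_rat (b - t))) * inverse l"
      unfolding u' using r by (simp add: of_rat_divide of_rat_minus)
    ultimately have "u * (of_rat (- 1 / r) * ((x + of_rat (b - t)) * inverse l)) = 1"
      using l0 by simp
    then have "inverse u = of_rat (- 1 / r) * ((x + of_rat (b - t)) * inverse l)"
      by (rule inverse_unique)
    moreover have "x + of_rat (b - t) \<in> cubic_span x" using span_add span_gen span_rat by blast
    ultimately show ?thesis using li span_scale span_mult by simp
  qed
qed

lemma span_divide: "u \<in> cubic_span x \<Longrightarrow> v \<in> cubic_span x \<Longrightarrow> u / v \<in> cubic_span x"
  unfolding divide_inverse by (simp add: span_mult span_inverse)

lemma subfield: "subfield_of_complex (cubic_span x)"
  unfolding subfield_of_complex_def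
  using span_rat[of 0] span_rat[of 1] by (simp add: span_add span_diff span_mult span_inverse)

lemma degree_three: "degree_three_over_Q (cubic_span x)"
  unfolding degree_three_over_Q_def
proof (intro bexI ballI)
  fix u assume "u \<in> cubic_span x"
  then obtain p q r where u: "u = of_rat p + of_rat q * x + of_rat r * x^2" by (rule cubic_spanE)
  show "\<exists>!q :: rat \<times> rat \<times> rat. u = of_rat (fst q) * 1 + of_rat (fst (snd q)) * x + of_rat (snd (snd q)) * x^2"
  proof (rule ex1I[of _ "(p, q, r)"])
    show "u = of_rat (fst (p,q,r)) * 1 + of_rat (fst (snd (p,q,r))) * x + of_rat (snd (snd (p,q,r))) * x^2"
      using u by simp
    fix t :: "rat \<times> rat \<times> rat"
    assume "u = of_rat (fst t) * 1 + of_rat (fst (snd t)) * x + of_rat (snd (snd t)) * x^2"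
    then have "of_rat (fst t) + of_rat (fst (snd t)) * x + of_rat (snd (snd t)) * x^2 =
        of_rat p + of_rat q * x + of_rat r * x^2" unfolding u by (simp only: mult_1_right)
    from indep_eq[OF this] show "t = (p, q, r)" by (cases t) simp
  qed
qed (use span_rat[of 1] span_gen span_power in auto)

definition disc :: rat where
  "disc = b^2 * c^2 - 4 * c^3 - 4 * b^3 * d - 27 * d^2 + 18 * b * c * d"

text \<open>Dividing the cubic by \<open>X - x\<close> leaves a quadratic of discriminant \<open>(w / f'(x))\<^sup>2\<close>.\<close>
lemma root_in_span:
  assumes w: "disc = w^2"
    and y: "y^3 + of_rat b * y^2 + of_rat c * y + of_rat d = 0"
  shows "y \<in> cubic_span x"
proof (cases "y = x")
  case True
  then show ?thesis using span_gen by simp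
next
  case False
  define B C D W where "B = (of_rat b :: complex)" and "C = (of_rat c :: complex)"
    and "D = (of_rat d :: complex)" and "W = (of_rat w :: complex)"
  define e where "e = 3 * x^2 + 2 * B * x + C"
  define k where "k = 2 * y + x + B"
  have rx: "x^3 + B * x^2 + C * x + D = 0" and ry: "y^3 + B * y^2 + C * y + D = 0"
    using root y unfolding B_def C_def D_def by auto
  have W: "B^2 * C^2 - 4 * C^3 - 4 * B^3 * D - 27 * D^2 + 18 * B * C * D = W^2"
    using arg_cong[OF w, of "of_rat :: rat \<Rightarrow> complex"] unfolding disc_def B_def C_def D_def W_def
    by (simp add: of_rat_diff of_rat_add of_rat_mult of_rat_power)
  have "(y - x) * (y^2 + x * y + x^2 + B * (y + x) + C) = 0" using rx ry by algebra
  then have q: "y^2 + x * y + x^2 + B * (y + x) + C = 0" using False by simp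
  have "(k * e)^2 = W^2" using rx q W unfolding k_def e_def by algebra
  then have "k * e = W \<or> k * e = - W" by (simp add: power2_eq_iff)
  then have ke: "k * e \<in> cubic_span x" using span_rat span_uminus unfolding W_def by metis
  have e: "e \<in> cubic_span x" unfolding e_def B_def C_def
    using cubic_spanI[of c "2 * b" x 3] by (simp add: of_rat_mult algebra_simps)
  have e0: "e \<noteq> 0" unfolding e_def B_def C_def
    using indep[of c "2 * b" 3] by (auto simp: of_rat_mult algebra_simps)
  have "k \<in> cubic_span x" using span_divide[OF ke e] e0 by simp
  then have "of_rat (1/2) * (k - x - of_rat b) \<in> cubic_span x"
    by (intro span_scale span_diff span_gen span_rat)
  then show ?thesis unfolding k_def B_def by (simp add: of_rat_divide)
qed

text \<open>A homomorphism on the span fixes the rationals, hence sends \<open>x\<close> to a root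
  of the same cubic, and \<open>root_in_span\<close> puts every such root back into the
  span.\<close>

lemma normal:
  assumes w: "disc = w^2"
  shows "normal_over_Q (cubic_span x)"
  unfolding normal_over_Q_def
proof (intro allI impI, elim conjE)
  fix \<sigma> :: "complex \<Rightarrow> complex"
  assume one: "\<sigma> 1 = 1"
    and hom: "\<forall>u\<in>cubic_span x. \<forall>v\<in>cubic_span x. \<sigma> (u + v) = \<sigma> u + \<sigma> v \<and> \<sigma> (u * v) = \<sigma> u * \<sigma> v"
  have add: "\<sigma> (u + v) = \<sigma> u + \<sigma> v" if "u \<in> cubic_span x" "v \<in> cubic_span x" for u v using hom that by blast
  have mult: "\<sigma> (u * v) = \<sigma> u * \<sigma> v" if "u \<in> cubic_span x" "v \<in> cubic_span x" for u v using hom that by blast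
  have zero: "\<sigma> 0 = 0" using add[of 0 0] span_rat[of 0] by simp
  have nat: "\<sigma> (of_nat k) = of_nat k" for k
  proof (induction k)
    case (Suc k)
    have "of_nat k \<in> cubic_span x" using span_rat[of "of_nat k"] by simp
    then show ?case using add[of 1 "of_nat k"] span_rat[of 1] one Suc by simp
  qed (simp add: zero)
  have int: "\<sigma> (of_int k) = of_int k" for k
  proof (cases "k \<ge> 0")
    case True
    then show ?thesis using nat[of "nat k"] by simp
  next
    case False
    have "of_int k \<in> cubic_span x" "of_int (- k) \<in> cubic_span x"
      using span_rat[of "of_int k"] span_rat[of "of_int (- k)"] by (metis of_rat_of_int_eq)+
    then have "\<sigma> (of_int k) + \<sigma> (of_int (- k)) = 0" using add[of "of_int k" "of_int (- k)"] zero by simp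
    moreover have "\<sigma> (of_int (- k)) = of_int (- k)" using nat[of "nat (- k)"] False by simp
    ultimately show ?thesis by simp
  qed
  have rat: "\<sigma> (of_rat r) = of_rat r" for r
  proof -
    obtain m k where r: "r = of_int m / of_int k" and k: "k \<noteq> 0"
      by (cases r) (auto simp: Fract_of_int_quotient)
    have "of_int k * of_rat r = (of_int m :: complex)" using k unfolding r by (simp add: of_rat_divide)
    moreover have "\<sigma> (of_int k * of_rat r) = \<sigma> (of_int k) * \<sigma> (of_rat r)"
      using mult[of "of_int k" "of_rat r"] span_rat[of "of_int k"] span_rat[of r] by simp
    ultimately have "of_int k * \<sigma> (of_rat r) = of_int k * of_rat r" using int by metis
    then show ?thesis using k by simp
  qed
  define y where "y = \<sigma> x"
  have img: "\<sigma> (of_rat p + of_rat q * x + of_rat r * x^2) = of_rat p + of_rat q * y + of_rat r * y^2" for p q r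
  proof -
    have s: "of_rat q * x \<in> cubic_span x" "of_rat r * x^2 \<in> cubic_span x" "x^2 \<in> cubic_span x"
      by (intro span_scale span_power span_gen)+
    have "\<sigma> (x^2) = y^2" unfolding power2_eq_square y_def by (rule mult[OF span_gen span_gen])
    then show ?thesis
      using add[OF span_add[OF span_rat s(1)] s(2)] add[OF span_rat s(1)]
        mult[OF span_rat span_gen] mult[OF span_rat s(3)]
      unfolding y_def by (simp only: rat)
  qed
  have "\<sigma> (x^3) = y^3" 
    unfolding power3_eq_cube y_def by (simp only: mult span_mult span_gen)
  moreover have "\<sigma> (x^3) = of_rat (- d) + of_rat (- c) * y + of_rat (- b) * y^2"
    using img[of "- d" "- c" "- b"] unfolding cube by (simp add: of_rat_minus algebra_simps)
  ultimately have "y^3 = of_rat (- d) + of_rat (- c) * y + of_rat (- b) * y^2" by simp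
  then have "y^3 + of_rat b * y^2 + of_rat c * y + of_rat d = 0"
    by (simp add: of_rat_minus)
  then have y: "y \<in> cubic_span x" using root_in_span[OF w] by blast
  show "\<sigma> ` cubic_span x \<subseteq> cubic_span x"
  proof
    fix v assume "v \<in> \<sigma> ` cubic_span x"
    then obtain p q r where "v = of_rat p + of_rat q * y + of_rat r * y^2"
      using img by (auto elim!: cubic_spanE)
    then show "v \<in> cubic_span x" using y by (simp add: span_add span_scale span_power span_rat)
  qed
qed

lemma cyclic: "disc = w^2 \<Longrightarrow> cyclic_cubic_field (cubic_span x)"
  unfolding cyclic_cubic_field_def using subfield degree_three normal by blast

end

section \<open>Total ramification\<close>

text \<open>The norm of \<open>A + B z + C z\<^sup>2\<close>, where \<open>e1, e2, e3\<close> are the elementary symmetric functions of the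
  conjugates of \<open>z\<close>.\<close>
definition norm_form :: "'a \<Rightarrow> 'a \<Rightarrow> 'a \<Rightarrow> 'a \<Rightarrow> 'a \<Rightarrow> 'a \<Rightarrow> 'a :: comm_ring_1" where
  "norm_form e1 e2 e3 A B C =
     A^3 + A^2 * (B * e1 + C * (e1^2 - 2 * e2))
     + A * (B^2 * e2 + B * C * (e1 * e2 - 3 * e3) + C^2 * (e2^2 - 2 * e1 * e3))
     + (B^3 * e3 + B^2 * C * e1 * e3 + B * C^2 * e2 * e3 + C^3 * e3^2)"

lemma norm_form_eq_0:
  fixes z :: complex
  assumes z: "z^3 = e1 * z^2 - e2 * z + e3" and "A + B * z + C * z^2 = 0"
  shows "norm_form e1 e2 e3 A B C = 0"
proof -
  \<comment> \<open>Sum and product of the two other conjugates of \<open>z\<close>; the second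
    factor below is the product of the corresponding conjugates of
    \<open>A + B * z + C * z^2\<close>.\<close>
  define s q where "s = e1 - z" and "q = e2 - e1 * z + z^2"
  have "norm_form e1 e2 e3 A B C =
      (A + B * z + C * z^2) * (A^2 + A * B * s + A * C * (s^2 - 2 * q) + B^2 * q + B * C * q * s + C^2 * q^2)"
  proof -
    have e3: "e3 = z^3 - e1 * z^2 + e2 * z" using z by simp
    show ?thesis unfolding norm_form_def s_def q_def e3 by algebra
  qed
  then show ?thesis using assms(2) by simp
qed

text \<open>The dominant terms \<open>A^3\<close>, \<open>B^3 * e3\<close>,
  \<open>C^3 * e3^2\<close> have \<open>p\<close>-adic valuations 0, 1, 2 modulo 3, so they cannot
  cancel each other. Reading the norm modulo \<open>p\<close>, \<open>p^2\<close> and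
  \<open>p^3\<close> peels off one divisibility at a time.\<close>

lemma eisenstein_norm_form_dvd:
  fixes p e1 e2 e3 A B C :: int
  assumes p: "prime p" and "p dvd e1" "p dvd e2" "p dvd e3" "\<not> p^2 dvd e3"
    and n: "p^3 dvd norm_form e1 e2 e3 A B C"
  shows "p dvd A \<and> p dvd B \<and> p dvd C"
proof -
  obtain f1 f2 f3 where e: "e1 = p * f1" "e2 = p * f2" "e3 = p * f3"
    using assms by (auto elim!: dvdE)
  have p0: "p \<noteq> 0" using p by auto
  have f3: "\<not> p dvd f3" using assms(5) p0 unfolding e by (simp add: power2_eq_square)
  have "norm_form e1 e2 e3 A B C = A^3 + p * (A^2 * (B * f1 + C * (p * f1^2 - 2 * f2))
      + A * (B^2 * f2 + B * C * (p * f1 * f2 - 3 * f3) + C^2 * p * (f2^2 - 2 * f1 * f3))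
      + (B^3 * f3 + B^2 * C * p * f1 * f3 + B * C^2 * p * f2 * f3 + C^3 * p * f3^2))"
    unfolding norm_form_def e by algebra
  moreover have "p dvd norm_form e1 e2 e3 A B C"
    using n by (meson dvd_power dvd_trans zero_less_numeral)
  ultimately have "p dvd A^3" by (metis dvd_add_times_triv_right_iff mult.commute)
  then have A: "p dvd A" using p by (metis prime_dvd_power)
  then obtain a where a: "A = p * a" ..
  have "norm_form e1 e2 e3 A B C = p * (B^3 * f3) + p^2 * (p * a^3
      + p * a^2 * (B * f1 + C * (p * f1^2 - 2 * f2))
      + a * (B^2 * f2 + B * C * (p * f1 * f2 - 3 * f3) + C^2 * p * (f2^2 - 2 * f1 * f3))
      + (B^2 * C * f1 * f3 + B * C^2 * f2 * f3 + C^3 * f3^2))"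
    unfolding norm_form_def e a by algebra
  moreover have "p^2 dvd norm_form e1 e2 e3 A B C"
    using n by (rule dvd_trans[rotated]) (simp add: le_imp_power_dvd)
  ultimately have "p^2 dvd p * (B^3 * f3)" by (metis dvd_add_times_triv_right_iff mult.commute)
  then have "p dvd B^3 * f3" using p0 by (simp add: power2_eq_square)
  then have B: "p dvd B" using p f3 by (metis prime_dvd_mult_iff prime_dvd_power)
  then obtain b where b: "B = p * b" ..
  have "norm_form e1 e2 e3 A B C = p^2 * (C^3 * f3^2) + p^3 * (a^3 + p * a^2 * b * f1
      + a^2 * C * (p * f1^2 - 2 * f2) + p * a * b^2 * f2 + a * b * C * (p * f1 * f2 - 3 * f3)
      + a * C^2 * (f2^2 - 2 * f1 * f3) + p * b^3 * f3 + p * b^2 * C * f1 * f3 + b * C^2 * f2 * f3)"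
    unfolding norm_form_def e a b by algebra
  with n have "p^3 dvd p^2 * (C^3 * f3^2)" by (metis dvd_add_times_triv_right_iff mult.commute)
  then have "p^2 * p dvd p^2 * (C^3 * f3^2)" by (simp add: power2_eq_square power3_eq_cube mult.assoc)
  then have "p dvd C^3 * f3^2" using p0 by simp
  then have "p dvd C" using p f3 by (metis prime_dvd_mult_iff prime_dvd_power)
  with A B show ?thesis by blast
qed

text \<open>\<open>K\<close> lies in a cubic field generated by a root of an Eisenstein polynomial at \<open>p\<close>.\<close>
definition ramified :: "int \<Rightarrow> complex set \<Rightarrow> bool" where
  "ramified p K \<longleftrightarrow> (\<exists>z :: complex. \<exists>c0 c1 c2 :: int.
     p dvd c0 \<and> p dvd c1 \<and> p dvd c2 \<and> \<not> p^2 dvd c0 \<and>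
     z^3 + of_int c2 * z^2 + of_int c1 * z + of_int c0 = 0 \<and> K \<subseteq> cubic_span z)"

lemma common_denominator:
  fixes a b c :: rat
  obtains m a' b' c' :: int where "m > 0"
    "of_int m * a = of_int a'" "of_int m * b = of_int b'" "of_int m * c = of_int c'"
proof -
  obtain a1 a2 b1 b2 c1 c2 :: int where
    a: "a = of_int a1 / of_int a2" "a2 > 0" and b: "b = of_int b1 / of_int b2" "b2 > 0"
    and c: "c = of_int c1 / of_int c2" "c2 > 0"
    by (cases a, cases b, cases c) (auto simp: Fract_of_int_quotient)
  show ?thesis
    by (rule that[of "a2 * b2 * c2" "a1 * b2 * c2" "b1 * a2 * c2" "c1 * a2 * b2"])
       (use a b c in auto)
qed

text \<open>At a totally ramified prime the residue field is the prime field, so every integral element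
  is congruent to its conjugates.\<close>
lemma ramified_char_poly:
  fixes p h0 h1 h2 :: int
  assumes p: "prime p" and ram: "ramified p K" and \<theta>: "\<theta> \<in> K"
    and h: "\<theta>^3 + of_int h2 * \<theta>^2 + of_int h1 * \<theta> + of_int h0 = 0"
    and no_root: "\<And>r :: rat. r^3 + of_int h2 * r^2 + of_int h1 * r + of_int h0 \<noteq> 0"
  obtains a where "\<And>s. p dvd s^3 + h2 * s^2 + h1 * s + h0 - (s - a)^3"
proof -
  obtain z c0 c1 c2 where c: "p dvd c0" "p dvd c1" "p dvd c2" "\<not> p^2 dvd c0"
    and z: "z^3 + of_int c2 * z^2 + of_int c1 * z + of_int c0 = 0" and K: "K \<subseteq> cubic_span z"
    using ram unfolding ramified_def by blast
  interpret cubic "of_int h2" "of_int h1" "of_int h0" \<theta>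
    by unfold_locales (use h no_root in auto)
  \<comment> \<open>The denominators of \<open>\<theta>\<close> with respect to the order generated
    by \<open>z\<close>. For the least one, \<open>p\<close> cannot divide it together with all
    three numerators.\<close>
  define P where "P m \<longleftrightarrow> m > 0 \<and> (\<exists>a b c :: int. of_int (int m) * \<theta> = of_int a + of_int b * z + of_int c * z^2)" for m
  have "\<exists>m. P m"
  proof -
    obtain q r s where \<theta>_eq: "\<theta> = of_rat q + of_rat r * z + of_rat s * z^2"
      using \<theta> K by (meson cubic_spanE subsetD)
    obtain m a b c :: int where m: "m > 0"
      "of_int m * q = of_int a" "of_int m * r = of_int b" "of_int m * s = of_int c"
      by (rule common_denominator)
    have "of_int m * \<theta> = of_rat (of_int m * q) + of_rat (of_int m * r) * z + of_rat (of_int m * s) * z^2"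
      unfolding \<theta>_eq by (simp add: of_rat_mult algebra_simps)
    then have "of_int m * \<theta> = of_int a + of_int b * z + of_int c * z^2" unfolding m by simp
    then have "P (nat m)" unfolding P_def using m(1) by auto
    then show ?thesis ..
  qed
  define M where "M = (LEAST m. P m)"
  have "P M" unfolding M_def using \<open>\<exists>m. P m\<close> by (rule LeastI_ex)
  define m where "m = int M"
  have m0: "m > 0" using \<open>P M\<close> unfolding P_def m_def by simp
  obtain a b c where abc: "of_int m * \<theta> = of_int a + of_int b * z + of_int c * z^2"
    using \<open>P M\<close> unfolding P_def m_def by blast
  have least: False if dvds: "p dvd m" "p dvd a" "p dvd b" "p dvd c"
  proof -
    obtain m' a' b' c' where d: "m = p * m'" "a = p * a'" "b = p * b'" "c = p * c'"
      using dvds by (auto elim!: dvdE)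
    have p1: "p > 1" using p prime_gt_1_int by blast
    have m': "m' > 0" using m0 d(1) p1 by (simp add: zero_less_mult_iff)
    have "of_int p * (of_int m' * \<theta>) = of_int p * (of_int a' + of_int b' * z + of_int c' * z^2)"
      using abc unfolding d by (simp add: algebra_simps)
    then have "of_int m' * \<theta> = of_int a' + of_int b' * z + of_int c' * z^2" using p1 by simp
    then have "P (nat m')" unfolding P_def using m' by auto
    then have "M \<le> nat m'" unfolding M_def by (rule Least_le)
    moreover have "m' < m" using d(1) p1 m' by simp
    ultimately show False using m' unfolding m_def by linarith
  qed
  \<comment> \<open>\<open>L\<close>, \<open>Q\<close>, \<open>R\<close> are the coefficients of the
    norm of \<open>A - b * z - c * z^2\<close> as a polynomial in \<open>A\<close>, that is, of the
    characteristic polynomial of \<open>b * z + c * z^2 = m * \<theta> - a\<close>.\<close>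
  define L where "L = - b * (- c2) - c * ((- c2)^2 - 2 * c1)"
  define Q where "Q = b^2 * c1 + b * c * ((- c2) * c1 - 3 * (- c0)) + c^2 * (c1^2 - 2 * (- c2) * (- c0))"
  define R where "R = - (b^3 * (- c0)) - b^2 * c * (- c2) * (- c0) - b * c^2 * c1 * (- c0) - c^3 * (- c0)^2"
  have nf: "norm_form (- c2) c1 (- c0) A (- b) (- c) = A^3 + A^2 * L + A * Q + R" for A
    unfolding norm_form_def L_def Q_def R_def by algebra
  have nfc: "norm_form (of_int (- c2)) (of_int c1) (of_int (- c0)) A (of_int (- b)) (of_int (- c)) =
      A^3 + A^2 * of_int L + A * of_int Q + of_int R" for A :: complex
    unfolding norm_form_def L_def Q_def R_def of_int_add of_int_diff of_int_mult of_int_power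
      of_int_minus of_int_numeral by algebra
  define T where "T = of_int m * \<theta> - of_int a"
  have "T^3 + T^2 * of_int L + T * of_int Q + of_int R = 0"
  proof (subst nfc[symmetric], rule norm_form_eq_0[of z])
    show "z^3 = of_int (- c2) * z^2 - of_int c1 * z + of_int (- c0)" using z by (simp, algebra)
    show "T + of_int (- b) * z + of_int (- c) * z^2 = 0" unfolding T_def using abc by simp
  qed
  \<comment> \<open>The characteristic polynomial at \<open>T\<close>, minus \<open>m^3\<close>
    times the minimal polynomial of \<open>\<theta>\<close>, has degree at most 2 in
    \<open>\<theta>\<close>. By independence its coefficients vanish, which yields
    \<open>key\<close>: the norm of \<open>m * (s - \<theta>)\<close> is \<open>m^3\<close> times
    the minimal polynomial at \<open>s\<close>.\<close>
  moreover have "of_rat (of_int (- (a^3) + a^2 * L - a * Q + R - m^3 * h0))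
      + of_rat (of_int (3 * m * a^2 - 2 * m * a * L + m * Q - m^3 * h1)) * \<theta>
      + of_rat (of_int (- 3 * m^2 * a + m^2 * L - m^3 * h2)) * \<theta>^2
      = (T^3 + T^2 * of_int L + T * of_int Q + of_int R)
        - of_int m ^ 3 * (\<theta>^3 + of_int h2 * \<theta>^2 + of_int h1 * \<theta> + of_int h0)"
    unfolding T_def of_rat_of_int_eq
    unfolding of_int_add of_int_diff of_int_mult of_int_power
      of_int_minus of_int_numeral by algebra
  ultimately have "of_rat (of_int (- (a^3) + a^2 * L - a * Q + R - m^3 * h0))
      + of_rat (of_int (3 * m * a^2 - 2 * m * a * L + m * Q - m^3 * h1)) * \<theta>
      + of_rat (of_int (- 3 * m^2 * a + m^2 * L - m^3 * h2)) * \<theta>^2 = 0"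
    using h by (simp only: mult_zero_right diff_zero)
  from indep[OF this] have coeffs: "- (a^3) + a^2 * L - a * Q + R = m^3 * h0"
    "3 * m * a^2 - 2 * m * a * L + m * Q = m^3 * h1" "- 3 * m^2 * a + m^2 * L = m^3 * h2"
    unfolding of_int_eq_0_iff by linarith+
  have key: "norm_form (- c2) c1 (- c0) (m * s - a) (- b) (- c) = m^3 * (s^3 + h2 * s^2 + h1 * s + h0)" for s
  proof -
    have "(m * s - a)^3 + (m * s - a)^2 * L + (m * s - a) * Q + R =
        m^3 * s^3 + (- 3 * m^2 * a + m^2 * L) * s^2 + (3 * m * a^2 - 2 * m * a * L + m * Q) * s
          + (- (a^3) + a^2 * L - a * Q + R)" by algebra
    then show ?thesis unfolding nf coeffs by (simp add: algebra_simps)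
  qed
  \<comment> \<open>If \<open>p\<close> divided \<open>m\<close>, the norm at \<open>s = 0\<close>
    would be divisible by \<open>p^3\<close>, so \<open>p\<close> would also divide
    \<open>a\<close>, \<open>b\<close>, \<open>c\<close>, against minimality.\<close>
  have pm: "\<not> p dvd m"
  proof
    assume pm: "p dvd m"
    have "p^3 dvd norm_form (- c2) c1 (- c0) (m * 0 - a) (- b) (- c)"
      unfolding key by (intro dvd_mult2 dvd_power_same pm)
    from eisenstein_norm_form_dvd[OF p _ _ _ _ this] c have "p dvd a \<and> p dvd b \<and> p dvd c" by simp
    with least pm show False by blast
  qed
  \<comment> \<open>Modulo \<open>p\<close> only the cube \<open>(m * s - a)^3\<close> of the norm
    form survives. Dividing by \<open>m^3\<close>, through the inverse \<open>k\<close> of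
    \<open>m\<close>, gives the claim with the residue \<open>k * a\<close>.\<close>
  then have "coprime m p" using p by (metis coprime_commute prime_imp_coprime)
  then obtain k where k: "[m * k = 1] (mod p)" by (metis cong_solve_coprime_int)
  have "p dvd s^3 + h2 * s^2 + h1 * s + h0 - (s - k * a)^3" for s
  proof -
    define v where "v = s^3 + h2 * s^2 + h1 * s + h0"
    have "p dvd norm_form (- c2) c1 (- c0) (m * s - a) (- b) (- c) - (m * s - a)^3"
      unfolding norm_form_def using c(1-3)
      by (simp add: power2_eq_square)
    then have "[m^3 * v = (m * s - a)^3] (mod p)" unfolding key v_def by (simp add: cong_iff_dvd_diff)
    then have "[k^3 * (m^3 * v) = k^3 * (m * s - a)^3] (mod p)" by (rule cong_scalar_left)
    moreover have "[k^3 * (m^3 * v) = v] (mod p)"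
      using cong_scalar_right[OF cong_pow[OF k, of 3], of v] by (simp add: power_mult_distrib mult_ac)
    moreover have "[k^3 * (m * s - a)^3 = (s - k * a)^3] (mod p)"
    proof -
      have "[m * k * s - k * a = 1 * s - k * a] (mod p)"
        by (intro cong_diff cong_mult k cong_refl)
      from cong_pow[OF this, of 3] show ?thesis
        by (simp add: power_mult_distrib[symmetric] algebra_simps)
    qed
    ultimately have "[v = (s - k * a)^3] (mod p)" by (meson cong_sym cong_trans)
    then show ?thesis unfolding v_def by (simp add: cong_iff_dvd_diff)
  qed
  then show ?thesis by (rule that)
qed

lemma (in cubic_root) cubic_span_mono:
  assumes "u \<in> cubic_span x"
  shows "cubic_span u \<subseteq> cubic_span x"
proof
  fix v assume "v \<in> cubic_span u"
  then obtain p q r where "v = of_rat p + of_rat q * u + of_rat r * u^2" by (rule cubic_spanE)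
  then show "v \<in> cubic_span x" using assms by (simp add: span_add span_scale span_power span_rat)
qed

lemma ramifiedI:
  fixes z x :: complex and c0 c1 c2 :: int
  assumes "p dvd c0" "p dvd c1" "p dvd c2" "\<not> p^2 dvd c0"
    and z: "z^3 + of_int c2 * z^2 + of_int c1 * z + of_int c0 = 0" and x: "x \<in> cubic_span z"
  shows "ramified p (cubic_span x)"
proof -
  interpret cubic_root "of_int c2" "of_int c1" "of_int c0" z by unfold_locales (use z in simp)
  show ?thesis unfolding ramified_def using assms cubic_span_mono[OF x] by blast
qed

text \<open>With \<open>n = N / A\<close> the roots of the cubic below have \<open>p\<close>-adic valuation
  \<open>- 2 * multiplicity p A / 3\<close>.\<close>
lemma ramified_of_multiplicity:
  fixes x :: complex and A N p :: int
  assumes p: "prime p" and N: "\<not> p dvd N" and A: "A \<noteq> 0" and v: "\<not> 3 dvd multiplicity p A"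
    and x: "of_int A ^ 2 * x^3 + of_int A ^ 2 * x^2
      - (3 * of_int A ^ 2 + 2 * of_int A * of_int N) * x - of_int N ^ 2 = 0"
  shows "ramified p (cubic_span x)"
proof -
  define e where "e = multiplicity p A"
  define k where "k = e div 3"
  define q where "q = p ^ k"
  have p0: "p \<noteq> 0" "p > 0" using p prime_gt_0_int by auto
  have q0: "q \<noteq> 0" using p0 unfolding q_def by simp
  obtain A1 where A1: "A = p ^ e * A1" "\<not> p dvd A1"
    unfolding e_def using multiplicity_decompose'[of A p] A not_prime_unit[of p] p by metis
  have not_dvd: "\<not> p^2 dvd p * t" if "\<not> p dvd t" for t
    using that p0 by (simp add: power2_eq_square)
  have e: "e = 3 * k + 1 \<or> e = 3 * k + 2" using v unfolding e_def k_def by presburger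
  then show ?thesis
  proof
    assume "e = 3 * k + 1"
    then have A_eq: "A = q^3 * p * A1" unfolding A1(1) q_def by (simp add: power_add power_mult mult.commute)
    \<comment> \<open>Above \<open>p\<close>, \<open>x\<close> has valuation
      \<open>- 2 * k - 2 / 3\<close>, so the scaling by \<open>q^2 * p\<close> brings it to 1/3, as
      an Eisenstein root needs. The factor \<open>A1^2\<close> clears the rest of the leading
      coefficient.\<close>
    define P where "P = q^2 * p * A1^2"
    have P: "P \<noteq> 0" using p0 q0 A1(2) unfolding P_def by auto
    show ?thesis
    proof (rule ramifiedI[where z = "of_int P * x" and ?c2.0 = P
          and ?c1.0 = "- ((3 * A + 2 * N) * A1^3 * q * p)" and ?c0.0 = "p * (- (N^2 * A1^4))"])
      show "\<not> p^2 dvd p * (- (N^2 * A1^4))"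
        by (rule not_dvd) (use p N A1(2) in \<open>auto simp: prime_dvd_mult_iff dest: prime_dvd_power\<close>)
      show "p dvd P" "p dvd - ((3 * A + 2 * N) * A1^3 * q * p)" unfolding P_def by simp_all
      have "(of_int P * x)^3 + of_int P * (of_int P * x)^2
          + of_int (- ((3 * A + 2 * N) * A1^3 * q * p)) * (of_int P * x) + of_int (p * (- (N^2 * A1^4)))
        = of_int p * of_int A1 ^ 4 * (of_int A ^ 2 * x^3 + of_int A ^ 2 * x^2
      - (3 * of_int A ^ 2 + 2 * of_int A * of_int N) * x - of_int N ^ 2)"
        unfolding P_def A_eq of_int_add of_int_diff of_int_mult of_int_power of_int_minus of_int_numeral
        by algebra
      then show "(of_int P * x)^3 + of_int P * (of_int P * x)^2
          + of_int (- ((3 * A + 2 * N) * A1^3 * q * p)) * (of_int P * x) + of_int (p * (- (N^2 * A1^4))) = 0"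
        unfolding x by simp
      show "x \<in> cubic_span (of_int P * x)"
        using cubic_spanI[of 0 "1 / of_int P" "of_int P * x" 0] P by (simp add: of_rat_divide)
    qed simp
  next
    assume "e = 3 * k + 2"
    then have A_eq: "A = q^3 * p^2 * A1" unfolding A1(1) q_def by (simp add: power_add power_mult mult.commute power2_eq_square)
    have N0: "N \<noteq> 0" using N by auto
    have x0: "x \<noteq> 0" using x N0 by auto
    define P where "P = (of_int (q^2 * p) :: complex)"
    have P: "P \<noteq> 0" using p0 q0 unfolding P_def by simp
    \<comment> \<open>Here \<open>x\<close> has valuation \<open>- 2 * k - 4 / 3\<close>, so
      \<open>P * x\<close> has valuation -1/3 and its reciprocal is taken. The numerator
      \<open>N^2\<close> keeps the reversed polynomial monic and integral.\<close>
    define z where "z = of_int N ^ 2 / (P * x)"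
    have z0: "z \<noteq> 0" using x0 P N0 unfolding z_def by simp
    have xz: "P * x * z = of_int N ^ 2" using x0 P unfolding z_def by simp
    define c0 where "c0 = p * (- (N^4 * A1^2))"
    define c1 where "c1 = - (q^2 * p^2 * A1^2 * N^2)"
    define c2 where "c2 = q * p * (3 * A + 2 * N) * A1"
    have c0: "of_int c0 \<noteq> (0 :: complex)" using p0 N0 A1(2) unfolding c0_def by auto
    have "(P * x)^3 * (z^3 + of_int c2 * z^2 + of_int c1 * z + of_int c0) =
        (P * x * z)^3 + of_int c2 * (P * x * z)^2 * (P * x) + of_int c1 * (P * x * z) * (P * x)^2
          + of_int c0 * (P * x)^3" by algebra
    also have "\<dots> = - (of_int N ^ 4 * (of_int A ^ 2 * x^3 + of_int A ^ 2 * x^2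
      - (3 * of_int A ^ 2 + 2 * of_int A * of_int N) * x - of_int N ^ 2))"
      unfolding xz unfolding c0_def c1_def c2_def P_def A_eq
        of_int_add of_int_diff of_int_mult of_int_power of_int_minus of_int_numeral by algebra
    finally have z: "z^3 + of_int c2 * z^2 + of_int c1 * z + of_int c0 = 0"
      unfolding x using P x0 by simp
    show ?thesis
    proof (rule ramifiedI[where z = z and ?c0.0 = c0 and ?c1.0 = c1 and ?c2.0 = c2])
      show "\<not> p^2 dvd c0" unfolding c0_def
        by (rule not_dvd) (use p N A1(2) in \<open>auto simp: prime_dvd_mult_iff dest: prime_dvd_power\<close>)
      show "p dvd c0" "p dvd c1" "p dvd c2" unfolding c0_def c1_def c2_def by (simp_all add: power2_eq_square)
      show "z^3 + of_int c2 * z^2 + of_int c1 * z + of_int c0 = 0" by (fact z)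
      define t where "t = - (of_int N ^ 2) / (of_int (q^2 * p) * of_int c0 :: rat)"
      have t: "of_rat t = - (of_int N ^ 2) / (P * of_int c0)"
        unfolding t_def P_def by (simp add: of_rat_divide of_rat_minus of_rat_mult of_rat_power)
      \<comment> \<open>\<open>w\<close> equals \<open>- c0 / z\<close>, so it expresses the inverse
        of \<open>z\<close>, and with it \<open>x\<close>, as a polynomial in
        \<open>z\<close>.\<close>
      define w where "w = z^2 + of_int c2 * z + of_int c1"
      have zw: "z * w = - of_int c0" unfolding w_def using z by algebra
      have "P * of_int c0 * z * (of_rat t * w) = - (of_int N ^ 2) * (z * w)"
        unfolding t using P c0 by simp
      also have "\<dots> = P * of_int c0 * z * x" unfolding zw using xz by algebra
      finally have "P * of_int c0 * z * x = P * of_int c0 * z * (of_rat t * w)" ..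
      then have "x = of_rat t * w" using P c0 z0 by simp
      then show "x \<in> cubic_span z"
        unfolding w_def using cubic_spanI[of "t * of_int c1" "t * of_int c2" z t] by (simp add: of_rat_mult algebra_simps)
    qed
  qed
qed

section \<open>Infinitely many points over a cubic field\<close>

text \<open>The integers localized at 2.\<close>

definition odd_rat :: "rat set" where
  "odd_rat = {r. \<exists>a b :: int. odd b \<and> r = of_int a / of_int b}"

lemma odd_ratI: "odd b \<Longrightarrow> of_int a / of_int b \<in> odd_rat"
  unfolding odd_rat_def by blast

lemma odd_rat_int: "of_int a \<in> odd_rat"
  using odd_ratI[of 1 a] by simp

lemma odd_rat_add: "r \<in> odd_rat \<Longrightarrow> s \<in> odd_rat \<Longrightarrow> r + s \<in> odd_rat"
proof -
  assume "r \<in> odd_rat" "s \<in> odd_rat"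
  then obtain a b c d :: int where "odd b" "odd d" and rs: "r = of_int a / of_int b" "s = of_int c / of_int d"
    unfolding odd_rat_def by blast
  then have "odd (b * d)" and "r + s = of_int (a * d + c * b) / of_int (b * d)"
    by (auto simp: divide_simps algebra_simps)
  then show ?thesis using odd_ratI by metis
qed

lemma odd_rat_mult: "r \<in> odd_rat \<Longrightarrow> s \<in> odd_rat \<Longrightarrow> r * s \<in> odd_rat"
proof -
  assume "r \<in> odd_rat" "s \<in> odd_rat"
  then obtain a b c d :: int where "odd b" "odd d" "r = of_int a / of_int b" "s = of_int c / of_int d"
    unfolding odd_rat_def by blast
  then have "odd (b * d)" and "r * s = of_int (a * c) / of_int (b * d)" by auto
  then show ?thesis using odd_ratI by metis
qed

lemma half_notin_odd_rat: "r \<in> odd_rat \<Longrightarrow> 2 * r \<noteq> 1"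
proof
  assume r: "r \<in> odd_rat" and e: "2 * r = 1"
  obtain a b :: int where "odd b" "r = of_int a / of_int b" using r unfolding odd_rat_def by blast
  then have "of_int (2 * a) = (of_int b :: rat)" using e by (auto simp: field_simps)
  then have "2 * a = b" by (simp only: of_int_eq_iff)
  then show False using \<open>odd b\<close> by auto
qed

text \<open>The hypotheses make \<open>(2, z)\<close> a proper ideal; the elements of \<open>1 + (2, z)\<close> stand in for the units of a
  localization at a prime above 2.\<close>
locale two_adic = cubic b c d z for b c d z +
  assumes integral: "b \<in> odd_rat" "c \<in> odd_rat" "d / 2 \<in> odd_rat"
begin

definition Rng :: "complex set" where
  "Rng = {of_rat p + of_rat q * z + of_rat r * z^2 | p q r. p \<in> odd_rat \<and> q \<in> odd_rat \<and> r \<in> odd_rat}"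

definition Idl :: "complex set" where "Idl = {2 * u + z * v | u v. u \<in> Rng \<and> v \<in> Rng}"

definition Unt :: "complex set" where "Unt = {1 + u | u. u \<in> Idl}"

lemma RngI: "p \<in> odd_rat \<Longrightarrow> q \<in> odd_rat \<Longrightarrow> r \<in> odd_rat \<Longrightarrow> of_rat p + of_rat q * z + of_rat r * z^2 \<in> Rng"
  unfolding Rng_def by blast

lemma RngE:
  assumes "u \<in> Rng"
  obtains p q r where "p \<in> odd_rat" "q \<in> odd_rat" "r \<in> odd_rat" "u = of_rat p + of_rat q * z + of_rat r * z^2"
  using assms unfolding Rng_def by blast

lemma Rng_rat: "p \<in> odd_rat \<Longrightarrow> of_rat p \<in> Rng"
  using RngI[of p 0 0] odd_rat_int[of 0] by simp

lemma Rng_int: "of_int k \<in> Rng"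
  using Rng_rat[OF odd_rat_int[of k]] by simp

lemma Rng_z: "z \<in> Rng"
  using RngI[of 0 1 0] odd_rat_int[of 0] odd_rat_int[of 1] by simp

lemma Rng_add: "u \<in> Rng \<Longrightarrow> v \<in> Rng \<Longrightarrow> u + v \<in> Rng"
proof (elim RngE)
  fix p q r p' q' r'
  assume R: "p \<in> odd_rat" "q \<in> odd_rat" "r \<in> odd_rat" "p' \<in> odd_rat" "q' \<in> odd_rat" "r' \<in> odd_rat"
    and "u = of_rat p + of_rat q * z + of_rat r * z^2" "v = of_rat p' + of_rat q' * z + of_rat r' * z^2"
  then have "u + v = of_rat (p + p') + of_rat (q + q') * z + of_rat (r + r') * z^2"
    by (simp add: of_rat_add algebra_simps)
  then show ?thesis using RngI odd_rat_add R by simp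
qed

lemma Rng_scale: "t \<in> odd_rat \<Longrightarrow> u \<in> Rng \<Longrightarrow> of_rat t * u \<in> Rng"
proof (elim RngE)
  fix p q r
  assume R: "t \<in> odd_rat" "p \<in> odd_rat" "q \<in> odd_rat" "r \<in> odd_rat"
    and "u = of_rat p + of_rat q * z + of_rat r * z^2"
  then have "of_rat t * u = of_rat (t * p) + of_rat (t * q) * z + of_rat (t * r) * z^2"
    by (simp add: of_rat_mult algebra_simps)
  then show ?thesis using RngI odd_rat_mult R by simp
qed

lemma odd_rat_d: "d \<in> odd_rat"
  using odd_rat_mult[OF odd_rat_int[of 2] integral(3)] by simp

lemma odd_rat_uminus: "t \<in> odd_rat \<Longrightarrow> - t \<in> odd_rat"
  using odd_rat_mult[OF odd_rat_int[of "-1"]] by fastforce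

lemma Rng_cube: "z^3 \<in> Rng"
proof -
  have "z^3 = of_rat (- d) + of_rat (- c) * z + of_rat (- b) * z^2"
    unfolding cube by (simp add: of_rat_minus)
  then show ?thesis using RngI odd_rat_uminus integral odd_rat_d by simp
qed

lemma Rng_z_mult: "u \<in> Rng \<Longrightarrow> z * u \<in> Rng"
proof (elim RngE)
  fix p q r
  assume R: "p \<in> odd_rat" "q \<in> odd_rat" "r \<in> odd_rat" and u: "u = of_rat p + of_rat q * z + of_rat r * z^2"
  have "z * u = (of_rat 0 + of_rat p * z + of_rat q * z^2) + of_rat r * z^3"
    unfolding u by (simp add: algebra_simps power2_eq_square power3_eq_cube)
  moreover have "0 \<in> odd_rat" using odd_rat_int[of 0] by simp
  ultimately show ?thesis using Rng_add RngI Rng_scale[OF _ Rng_cube] R by metis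
qed

lemma Rng_mult: "u \<in> Rng \<Longrightarrow> v \<in> Rng \<Longrightarrow> u * v \<in> Rng"
proof (elim RngE[of u])
  fix p q r
  assume v: "v \<in> Rng" and R: "p \<in> odd_rat" "q \<in> odd_rat" "r \<in> odd_rat"
    and u: "u = of_rat p + of_rat q * z + of_rat r * z^2"
  have "u * v = of_rat p * v + of_rat q * (z * v) + of_rat r * (z * (z * v))"
    unfolding u by (simp add: algebra_simps power2_eq_square)
  then show ?thesis using Rng_add Rng_scale Rng_z_mult R v by simp
qed

lemma Idl_add: "u \<in> Idl \<Longrightarrow> v \<in> Idl \<Longrightarrow> u + v \<in> Idl"
proof -
  assume "u \<in> Idl" "v \<in> Idl"
  then obtain a b a' b' where "u = 2 * a + z * b" "v = 2 * a' + z * b'" "a \<in> Rng" "b \<in> Rng" "a' \<in> Rng" "b' \<in> Rng"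
    unfolding Idl_def by blast
  then have "u + v = 2 * (a + a') + z * (b + b')" "a + a' \<in> Rng" "b + b' \<in> Rng"
    by (auto simp: algebra_simps Rng_add)
  then show ?thesis unfolding Idl_def by blast
qed

lemma Idl_mult: "u \<in> Rng \<Longrightarrow> v \<in> Idl \<Longrightarrow> u * v \<in> Idl"
proof -
  assume u: "u \<in> Rng" and "v \<in> Idl"
  then obtain a b where "v = 2 * a + z * b" "a \<in> Rng" "b \<in> Rng" unfolding Idl_def by blast
  then have "u * v = 2 * (u * a) + z * (u * b)" "u * a \<in> Rng" "u * b \<in> Rng"
    using u by (auto simp: algebra_simps Rng_mult)
  then show ?thesis unfolding Idl_def by blast
qed

lemma Idl_z: "z \<in> Idl"
  unfolding Idl_def using Rng_int[of 0] Rng_int[of 1] by force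

lemma Idl_2: "2 \<in> Idl"
  unfolding Idl_def using Rng_int[of 0] Rng_int[of 1] by force

lemma Idl_subset: "u \<in> Idl \<Longrightarrow> u \<in> Rng"
  unfolding Idl_def using Rng_add Rng_mult[OF Rng_int[of 2]] Rng_z_mult by auto

text \<open>Compare constant coefficients: \<open>2 * u\<close> contributes \<open>2 * p\<close> and
  \<open>z * v\<close> contributes \<open>- r' * d\<close>. Both are twice an element of
  \<open>odd_rat\<close>, because \<open>d / 2\<close> lies there.\<close>

lemma one_notin_I: "1 \<notin> Idl"
proof
  assume "1 \<in> Idl"
  then obtain u v where uv: "1 = 2 * u + z * v" "u \<in> Rng" "v \<in> Rng" unfolding Idl_def by blast
  obtain p q r where u: "p \<in> odd_rat" "u = of_rat p + of_rat q * z + of_rat r * z^2" using uv(2) by (rule RngE)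
  obtain p' q' r' where v: "r' \<in> odd_rat" "v = of_rat p' + of_rat q' * z + of_rat r' * z^2" using uv(3) by (rule RngE)
  have "of_rat 1 + of_rat 0 * z + of_rat 0 * z^2 = 2 * u + (of_rat p' * z + of_rat q' * z^2 + of_rat r' * z^3)"
    using uv(1) unfolding v by (simp add: algebra_simps power2_eq_square power3_eq_cube)
  also have "\<dots> = of_rat (2 * p - r' * d) + of_rat (2 * q + p' - r' * c) * z + of_rat (2 * r + q' - r' * b) * z^2"
    unfolding u cube by (simp add: of_rat_add of_rat_diff of_rat_mult algebra_simps)
  finally have "1 = 2 * p - r' * d" using indep_eq by blast
  then have "2 * (p + - (r' * (d / 2))) = 1" by simp
  moreover have "p + - (r' * (d / 2)) \<in> odd_rat"
    using odd_rat_add odd_rat_mult odd_rat_uminus integral(3) u(1) v(1) by blast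
  ultimately show False using half_notin_odd_rat by blast
qed

lemma Unt_I: "u \<in> Idl \<Longrightarrow> 1 + u \<in> Unt"
  unfolding Unt_def by blast

lemma Unt_add: "u \<in> Unt \<Longrightarrow> v \<in> Idl \<Longrightarrow> u + v \<in> Unt"
  unfolding Unt_def using Idl_add by (auto simp: add.assoc)

lemma Unt_subset: "u \<in> Unt \<Longrightarrow> u \<in> Rng"
  unfolding Unt_def using Rng_add[OF Rng_int[of 1]] Idl_subset by auto

lemma Unt_mult: "u \<in> Unt \<Longrightarrow> v \<in> Unt \<Longrightarrow> u * v \<in> Unt"
proof -
  assume u: "u \<in> Unt" and "v \<in> Unt"
  then obtain w where w: "w \<in> Idl" "v = 1 + w" unfolding Unt_def by blast
  have "u * v = u + u * w" unfolding w by (simp add: algebra_simps)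
  then show ?thesis using Unt_add[OF u] Idl_mult[OF Unt_subset[OF u] w(1)] by simp
qed

lemma Unt_power: "u \<in> Unt \<Longrightarrow> u ^ k \<in> Unt"
proof (induction k)
  case 0
  then show ?case using Unt_I[of 0] Idl_mult[OF Rng_int[of 0] Idl_2] by simp
qed (simp add: Unt_mult)

lemma Unt_disjoint: "u \<in> Unt \<Longrightarrow> u \<notin> Idl"
proof
  assume "u \<in> Unt" "u \<in> Idl"
  then obtain w where w: "w \<in> Idl" "u = 1 + w" unfolding Unt_def by blast
  have "u + of_int (-1) * w \<in> Idl" using \<open>u \<in> Idl\<close> w(1) by (intro Idl_add Idl_mult Rng_int)
  then show False using one_notin_I w(2) by simp
qed

lemma Unt_nonzero: "u \<in> Unt \<Longrightarrow> u \<noteq> 0"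
  using Unt_disjoint[of 0] Idl_mult[OF Rng_int[of 0] Idl_2] by auto

end

text \<open>The point \<open>(x, 2 * z)\<close> of \<open>E\<close>, with
  \<open>2 * z = x + n\<close>, is doubled repeatedly. Near the origin a doubling divides the
  abscissa by about 4, so the denominators at the ideal \<open>(2, z)\<close> grow and the points
  stay distinct.\<close>

lemma infinite_ap4sq_points:
  fixes n k :: rat and x :: complex
  assumes x: "cubic 1 (- (3 + 2 * n)) (- (n^2)) x" and n: "n = - 1 + 32 * k" and k: "k \<in> odd_rat"
  shows "infinite (ap4sq_points (cubic_span x))"
proof
  interpret X: cubic 1 "- (3 + 2 * n)" "- (n^2)" x by (fact x)
  define K where "K = cubic_span x"
  define h :: complex where "h = of_rat (32 * k)"
  define z where "z = (x + of_rat n) / 2"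
  have xz: "x = 2 * z + 1 - h" 
  proof -
    have nh: "of_rat n = h - 1" unfolding h_def n by (simp add: of_rat_diff)
    have "2 * z = x + (h - 1)" unfolding z_def nh by simp
    then show ?thesis by simp
  qed
  have zK: "z \<in> K"
  proof -
    have "of_rat (1/2) * (x + of_rat n) \<in> K" unfolding K_def
      by (intro X.span_scale X.span_add X.span_gen X.span_rat)
    then show ?thesis unfolding z_def by (simp add: of_rat_divide)
  qed
  have fx: "x * (x - 1) * (x + 3) = (2 * z)^2"
  proof -
    have "x^3 + x^2 - (3 + 2 * of_rat n) * x - of_rat n ^ 2 = 0"
      using X.root unfolding of_rat_minus of_rat_add of_rat_mult of_rat_power of_rat_numeral_eq of_rat_1
      by algebra
    moreover have "2 * z = x + of_rat n" unfolding z_def by simp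
    ultimately show ?thesis by algebra
  qed
  \<comment> \<open>Coefficients of the cubic satisfied by \<open>z\<close>, found by substituting
    \<open>x = 2 * z - n\<close> and dividing by 8. The factor 16 in \<open>d\<close> is what makes
    \<open>d / 2\<close> integral at 2.\<close>
  define b c d where "b = 2 - 48 * k" and "c = 1 - 80 * k + 768 * k^2"
    and "d = - (16 * k * (1 - 32 * k) * (1 - 8 * k))"
  have shift: "8 * (r^3 + b * r^2 + c * r + d) =
      (2 * r - n)^3 + 1 * (2 * r - n)^2 + (- (3 + 2 * n)) * (2 * r - n) + (- (n^2))" for r
    unfolding b_def c_def d_def n by algebra
  interpret Z: two_adic b c d z
  proof
    have "8 * (z^3 + of_rat b * z^2 + of_rat c * z + of_rat d) =
      x * (x - 1) * (x + 3) - (2 * z)^2"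
      unfolding b_def c_def d_def xz h_def of_rat_add of_rat_diff of_rat_minus of_rat_mult of_rat_power
        of_rat_numeral_eq of_rat_1 by algebra
    then have "8 * (z^3 + of_rat b * z^2 + of_rat c * z + of_rat d) = 0" unfolding fx by (simp only: diff_self)
    then show "z^3 + of_rat b * z^2 + of_rat c * z + of_rat d = 0" by (metis mult_eq_0_iff zero_neq_numeral)
    show "r^3 + b * r^2 + c * r + d \<noteq> 0" for r
    proof
      assume "r^3 + b * r^2 + c * r + d = 0"
      then show False using shift[of r] X.no_root[of "2 * r - n"] by simp
    qed
    have int: "of_int m * t \<in> odd_rat" if "t \<in> odd_rat" for m t
      by (rule odd_rat_mult[OF odd_rat_int that])
    have neg: "- t \<in> odd_rat" if "t \<in> odd_rat" for t using int[OF that, of "-1"] by simp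
    have sq: "k^2 \<in> odd_rat" unfolding power2_eq_square by (rule odd_rat_mult[OF k k])
    have "of_int 2 + of_int (-48) * k \<in> odd_rat" by (intro odd_rat_add odd_rat_int int k)
    then show "b \<in> odd_rat" unfolding b_def by simp
    have "of_int 1 + of_int (-80) * k + of_int 768 * k^2 \<in> odd_rat" by (intro odd_rat_add odd_rat_int int k sq)
    then show "c \<in> odd_rat" unfolding c_def by simp
    have "of_int (-8) * (k * (of_int 1 + of_int (-32) * k) * (of_int 1 + of_int (-8) * k)) \<in> odd_rat"
      by (intro odd_rat_add odd_rat_mult odd_rat_int int k)
    moreover have "d / 2 = of_int (-8) * (k * (of_int 1 + of_int (-32) * k) * (of_int 1 + of_int (-8) * k))"
      unfolding d_def by simp
    ultimately show "d / 2 \<in> odd_rat" by (simp only:)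
  qed
  have hR: "of_rat k \<in> Z.Rng" using k by (rule Z.Rng_rat)
  \<comment> \<open>\<open>\<alpha>^2\<close> stands for the abscissa after \<open>j + 1\<close>
    doublings. The last equation says that its denominator is \<open>4^j * z^2\<close> up to factors
    from \<open>Unt\<close>.\<close>
  define P where "P j \<alpha> \<beta> \<delta> p q \<longleftrightarrow> \<alpha> \<in> K \<and> \<beta> \<in> K \<and> \<delta> \<in> K \<and> \<alpha>^2 - 1 = \<beta>^2 \<and> \<alpha>^2 + 3 = \<delta>^2 \<and>
      p \<in> Z.Unt \<and> q \<in> Z.Unt \<and> \<alpha>^2 * (4^j * z^2 * p) = q" for j :: nat and \<alpha> \<beta> \<delta> p q
  have z2I: "z^2 \<in> Z.Idl" unfolding power2_eq_square by (intro Z.Idl_mult Z.Rng_z Z.Idl_z)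
  have z0: "z \<noteq> 0" using Z.not_rat[of 0] by simp
  have TI: "4^j * z^2 \<in> Z.Idl" for j :: nat
    using Z.Idl_mult[OF Z.Rng_int[of "4^j"] z2I] by simp
  have neqs: "\<alpha> \<noteq> 0" "\<alpha>^2 \<noteq> 1" "\<alpha>^2 \<noteq> 3" "\<alpha>^2 \<noteq> - 3" if P: "P j \<alpha> \<beta> \<delta> p q" for j \<alpha> \<beta> \<delta> p q
  proof -
    have pq: "p \<in> Z.Unt" "q \<in> Z.Unt" "\<alpha>^2 * (4^j * z^2 * p) = q" using P unfolding P_def by auto
    show "\<alpha> \<noteq> 0" using pq Z.Unt_nonzero[of q] by auto
    have ne: "\<alpha>^2 \<noteq> of_int m" for m
    proof
      assume e: "\<alpha>^2 = of_int m"
      have "(of_int m * p) * (4^j * z^2) \<in> Z.Idl"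
        by (intro Z.Idl_mult Z.Rng_mult Z.Rng_int Z.Unt_subset pq TI)
      then have "q \<in> Z.Idl" using pq(3) unfolding e by (simp add: mult_ac)
      then show False using Z.Unt_disjoint pq(2) by blast
    qed
    show "\<alpha>^2 \<noteq> 1" "\<alpha>^2 \<noteq> 3" "\<alpha>^2 \<noteq> - 3" using ne[of 1] ne[of 3] ne[of "-3"] by simp_all
  qed
  \<comment> \<open>The duplication formula on \<open>E\<close>. As the whole 2-torsion is rational,
    the abscissa of a double and its shifts by -1 and 3 are squares in \<open>K\<close>.\<close>
  have double: "\<exists>\<alpha> \<beta> \<delta>. \<alpha> \<in> K \<and> \<beta> \<in> K \<and> \<delta> \<in> K \<and> \<alpha>^2 - 1 = \<beta>^2 \<and> \<alpha>^2 + 3 = \<delta>^2 \<and>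
      \<alpha>^2 * (4 * (t * (t - 1) * (t + 3))) = (t^2 + 3)^2"
    if t: "t \<in> K" and y: "y \<in> K" "y \<noteq> 0" "t * (t - 1) * (t + 3) = y^2" for t y
  proof -
    have int: "of_int m \<in> K" for m using X.span_rat[of "of_int m"] unfolding K_def by simp
    have K: "(t^2 + of_int l * t + of_int m) / (of_int 2 * y) \<in> K" for l m
      using t y int int[of 2] unfolding K_def by (intro X.span_divide X.span_add X.span_mult X.span_power) auto
    define \<alpha> \<beta> \<delta> where "\<alpha> = (t^2 + 3) / (2 * y)" and "\<beta> = (t^2 - 2 * t - 3) / (2 * y)"
      and "\<delta> = (t^2 + 6 * t - 3) / (2 * y)"
    define w where "w = 4 * (t * (t - 1) * (t + 3))"
    have w: "(2 * y)^2 = w" using y(3) unfolding w_def by (simp add: power_mult_distrib)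
    then have w0: "w \<noteq> 0" using y(2) by auto
    have "(t^2 + 3)^2 - w = (t^2 - 2 * t - 3)^2" "(t^2 + 3)^2 + 3 * w = (t^2 + 6 * t - 3)^2"
      unfolding w_def by algebra+
    then have "\<alpha>^2 - 1 = \<beta>^2" "\<alpha>^2 + 3 = \<delta>^2" "\<alpha>^2 * w = (t^2 + 3)^2"
      using w0 unfolding \<alpha>_def \<beta>_def \<delta>_def power_divide w by (simp_all add: divide_simps)
    moreover have "\<alpha> \<in> K" "\<beta> \<in> K" "\<delta> \<in> K"
      using K[of 0 3] K[of "-2" "-3"] K[of 6 "-3"] unfolding \<alpha>_def \<beta>_def \<delta>_def by simp_all
    ultimately show ?thesis unfolding w_def by blast
  qed
  have "\<exists>\<alpha> \<beta> \<delta> p q. P j \<alpha> \<beta> \<delta> p q" for j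
  proof (induction j)
    case 0
    obtain \<alpha> \<beta> \<delta> where K: "\<alpha> \<in> K" "\<beta> \<in> K" "\<delta> \<in> K" "\<alpha>^2 - 1 = \<beta>^2" "\<alpha>^2 + 3 = \<delta>^2"
      and eq: "\<alpha>^2 * (4 * (x * (x - 1) * (x + 3))) = (x^2 + 3)^2"
    proof -
      have "x \<in> K" "2 * z \<in> K" "2 * z \<noteq> 0"
        using zK z0 X.span_gen X.span_scale[of z 2] unfolding K_def by simp_all
      then show ?thesis using double[of x "2 * z"] fx that by blast
    qed
    \<comment> \<open>\<open>W\<close> is \<open>(x^2 + 3) / 4\<close> written as 1 plus an element
      of the ideal. Since the ordinate is \<open>2 * z\<close>, the first doubling gives
      \<open>\<alpha>^2 * z^2 = W^2\<close>.\<close>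
    define W where "W = 1 + ((1 - 32 * of_rat k) * z + z * z + (of_int 128 * of_rat k * of_rat k - of_int 8 * of_rat k) * 2)"
    have "W \<in> Z.Unt"
    proof -
      have R: "of_int 1 + of_int (- 32) * of_rat k \<in> Z.Rng"
        "of_int 128 * of_rat k * of_rat k + of_int (-8) * of_rat k \<in> Z.Rng"
        by (intro Z.Rng_add Z.Rng_mult Z.Rng_int hR)+
      have "(of_int 1 + of_int (- 32) * of_rat k) * z + z * z
          + (of_int 128 * of_rat k * of_rat k + of_int (-8) * of_rat k) * 2 \<in> Z.Idl"
        by (intro Z.Idl_add Z.Idl_mult R Z.Idl_z Z.Idl_2 Z.Rng_z)
      then show ?thesis using Z.Unt_I unfolding W_def by simp
    qed
    moreover have "x^2 + 3 = 4 * W"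
      unfolding xz h_def W_def of_rat_mult of_rat_numeral_eq of_int_numeral by algebra
    then have "16 * (\<alpha>^2 * z^2) = 16 * W^2" using eq unfolding fx by (simp add: power_mult_distrib)
    then have "\<alpha>^2 * (4^0 * z^2 * W^0) = W^2" by simp
    ultimately have "P 0 \<alpha> \<beta> \<delta> (W^0) (W^2)" using K Z.Unt_power unfolding P_def by blast
    then show ?case by blast
  next
    case (Suc j)
    then obtain \<alpha> \<beta> \<delta> p q where P: "P j \<alpha> \<beta> \<delta> p q" by blast
    then have K: "\<alpha> \<in> K" "\<beta> \<in> K" "\<delta> \<in> K" and eqs: "\<alpha>^2 - 1 = \<beta>^2" "\<alpha>^2 + 3 = \<delta>^2"
      and pq: "p \<in> Z.Unt" "q \<in> Z.Unt" "\<alpha>^2 * (4^j * z^2 * p) = q" unfolding P_def by auto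
    define t T where "t = \<alpha>^2" and "T = 4^j * z^2"
    have tK: "t \<in> K" "\<alpha> * \<beta> * \<delta> \<in> K" using K unfolding t_def K_def by (simp_all add: X.span_power X.span_mult)
    have y2: "t * (t - 1) * (t + 3) = (\<alpha> * \<beta> * \<delta>)^2" unfolding t_def eqs by (simp add: power_mult_distrib)
    have nz: "t \<noteq> 0" "t - 1 \<noteq> 0" "t + 3 \<noteq> 0"
      using neqs[OF P] unfolding t_def by (auto simp: eq_neg_iff_add_eq_0)
    then have "t * (t - 1) * (t + 3) \<noteq> 0" by simp
    moreover from this have "\<alpha> * \<beta> * \<delta> \<noteq> 0" using y2 by (metis zero_power2)
    ultimately obtain \<alpha>' \<beta>' \<delta>' where K': "\<alpha>' \<in> K" "\<beta>' \<in> K" "\<delta>' \<in> K" "\<alpha>'^2 - 1 = \<beta>'^2" "\<alpha>'^2 + 3 = \<delta>'^2"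
      and eq: "\<alpha>'^2 * (4 * (t * (t - 1) * (t + 3))) = (t^2 + 3)^2"
      using double[OF tK _ y2] by blast
    have q: "q = t * T * p" using pq(3) unfolding t_def T_def by (simp add: mult_ac)
    \<comment> \<open>With \<open>t = q / (T * p)\<close>, both sides of the duplication formula are
      multiplied by \<open>(T * p)^4\<close>. The denominator becomes \<open>4 * T * p'\<close>, so
      it gains the factor 4 apart from elements of \<open>Unt\<close>.\<close>
    define p' q' where "p' = p * q * (q + (- T * p)) * (q + 3 * T * p)" and "q' = (q^2 + 3 * T^2 * p^2)^2"
    have T: "T \<in> Z.Idl" unfolding T_def by (rule TI)
    have pR: "p \<in> Z.Rng" by (rule Z.Unt_subset[OF pq(1)])
    have "(of_int m * p) * T \<in> Z.Idl" for m by (intro Z.Idl_mult Z.Rng_mult Z.Rng_int pR T)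
    from this[of "-1"] this[of 3] have "- T * p \<in> Z.Idl" "3 * T * p \<in> Z.Idl" by (simp_all add: mult_ac)
    then have p': "p' \<in> Z.Unt" unfolding p'_def by (intro Z.Unt_mult Z.Unt_add pq) auto
    have "(of_int 3 * p * p * T) * T \<in> Z.Idl" by (intro Z.Idl_mult Z.Rng_mult Z.Rng_int pR T Z.Idl_subset[OF T])
    then have "3 * T^2 * p^2 \<in> Z.Idl" by (simp add: mult_ac power2_eq_square)
    then have q': "q' \<in> Z.Unt" unfolding q'_def by (intro Z.Unt_power Z.Unt_add pq)
    have "\<alpha>'^2 * (4 * T * p') = \<alpha>'^2 * (4 * (t * (t - 1) * (t + 3))) * (T^2 * p^2)^2"
      unfolding p'_def q by algebra
    also have "\<dots> = q'" unfolding eq q'_def q by algebra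
    finally have "\<alpha>'^2 * (4 ^ Suc j * z^2 * p') = q'" unfolding T_def by (simp add: mult_ac)
    then have "P (Suc j) \<alpha>' \<beta>' \<delta>' p' q'" using K' p' q' unfolding P_def by blast
    then show ?case by blast
  qed
  then obtain \<alpha> \<beta> \<delta> p q where P: "\<And>j. P j (\<alpha> j) (\<beta> j) (\<delta> j) (p j) (q j)" by metis
  \<comment> \<open>The denominators differ by a power of 4 with positive exponent, so equality
    would make \<open>p i * q j\<close>, an element of \<open>Unt\<close>, a multiple of 2.\<close>
  have "\<alpha> i \<noteq> \<alpha> j" if "i < j" for i j
  proof
    assume e: "\<alpha> i = \<alpha> j"
    have pq: "p i \<in> Z.Unt" "q i \<in> Z.Unt" "p j \<in> Z.Unt" "q j \<in> Z.Unt"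
      "\<alpha> j ^ 2 * (4^i * z^2 * p i) = q i" "\<alpha> j ^ 2 * (4^j * z^2 * p j) = q j"
      using P[of i] P[of j] unfolding P_def e by auto
    obtain l where l: "j = Suc (i + l)" using \<open>i < j\<close> less_imp_Suc_add by blast
    have four: "(4 :: complex) ^ j = of_int (2 * 4^l) * 2 * 4^i" unfolding l by (simp add: power_add)
    have "p i * q j = p i * (\<alpha> j ^ 2 * (of_int (2 * 4^l) * 2 * 4^i * z^2 * p j))"
      unfolding pq(6)[symmetric] four by (rule refl)
    also have "\<dots> = (of_int (2 * 4^l) * (\<alpha> j ^ 2 * (4^i * z^2 * p i)) * p j) * 2" by (simp only: mult_ac)
    finally have "p i * q j = (of_int (2 * 4^l) * q i * p j) * 2" unfolding pq(5) .
    moreover have "(of_int (2 * 4^l) * q i * p j) * 2 \<in> Z.Idl"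
      by (intro Z.Idl_mult Z.Rng_mult Z.Rng_int Z.Unt_subset pq Z.Idl_2)
    moreover have "p i * q j \<in> Z.Unt" by (intro Z.Unt_mult pq)
    ultimately show False using Z.Unt_disjoint by metis
  qed
  then have inj: "inj \<alpha>" by (metis injI linorder_neqE_nat)
  \<comment> \<open>Its squares have common difference
    \<open>- 2 * \<beta> * (\<alpha> * \<delta> - 3 * \<beta>)\<close>, which vanishes only if
    \<open>\<alpha>^2\<close> is 1 or 3.\<close>
  define v where "v j = (\<alpha> j ^ 2 - 3, \<alpha> j * \<beta> j - \<delta> j, \<beta> j * \<delta> j - 2 * \<alpha> j, \<alpha> j * \<delta> j - 3 * \<beta> j)" for j
  have v: "ap4sq K (v j)" for j
  proof -
    have K: "\<alpha> j \<in> K" "\<beta> j \<in> K" "\<delta> j \<in> K" and e: "\<alpha> j ^ 2 - 1 = \<beta> j ^ 2" "\<alpha> j ^ 2 + 3 = \<delta> j ^ 2"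
      using P[of j] unfolding P_def by auto
    have int: "of_int m \<in> K" for m using X.span_rat[of "of_int m"] unfolding K_def by simp
    have ne: "\<alpha> j ^ 2 \<noteq> 1" "\<alpha> j ^ 2 \<noteq> 3" using neqs[OF P] by auto
    have "\<beta> j \<noteq> 0" using e(1) ne(1) by auto
    moreover have "\<alpha> j * \<delta> j - 3 * \<beta> j \<noteq> 0"
    proof
      assume "\<alpha> j * \<delta> j - 3 * \<beta> j = 0"
      then have "(\<alpha> j ^ 2 - 3)^2 = 0" using e by algebra
      then show False using ne(2) by simp
    qed
    moreover have "(\<alpha> j * \<beta> j - \<delta> j)^2 - (\<alpha> j ^ 2 - 3)^2 = - 2 * \<beta> j * (\<alpha> j * \<delta> j - 3 * \<beta> j)"
      using e by algebra
    ultimately have "(\<alpha> j * \<beta> j - \<delta> j)^2 - (\<alpha> j ^ 2 - 3)^2 \<noteq> 0" by simp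
    moreover have "(\<alpha> j * \<beta> j - \<delta> j)^2 - (\<alpha> j ^ 2 - 3)^2 = (\<beta> j * \<delta> j - 2 * \<alpha> j)^2 - (\<alpha> j * \<beta> j - \<delta> j)^2"
      "(\<beta> j * \<delta> j - 2 * \<alpha> j)^2 - (\<alpha> j * \<beta> j - \<delta> j)^2 = (\<alpha> j * \<delta> j - 3 * \<beta> j)^2 - (\<beta> j * \<delta> j - 2 * \<alpha> j)^2"
      using e by algebra+
    moreover have "\<alpha> j ^ 2 - 3 \<in> K" "\<alpha> j * \<beta> j - \<delta> j \<in> K" "\<beta> j * \<delta> j - 2 * \<alpha> j \<in> K" "\<alpha> j * \<delta> j - 3 * \<beta> j \<in> K"
      using K int[of 3] int[of 2] unfolding K_def by (auto intro!: X.span_diff X.span_mult X.span_power)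
    ultimately show ?thesis unfolding ap4sq_def v_def prod.case by blast
  qed
  assume "finite (ap4sq_points (cubic_span x))"
  moreover have "(\<lambda>j. proj_point K (v j)) ` UNIV \<subseteq> ap4sq_points (cubic_span x)"
    using v unfolding ap4sq_points_def K_def by auto
  ultimately have "finite ((\<lambda>j. proj_point K (v j)) ` UNIV)" by (rule rev_finite_subset)
  then obtain j0 where "infinite {j. proj_point K (v j) = proj_point K (v j0)}"
    using pigeonhole_infinite[of UNIV "\<lambda>j. proj_point K (v j)"] by auto
  moreover have "finite {j. proj_point K (v j) = proj_point K (v j0)}"
  proof -
    \<comment> \<open>\<open>\<rho>\<close> is the ratio of the third coordinate to the first.
      Squaring \<open>\<beta> * \<delta> = 2 * \<alpha> + \<rho> * (\<alpha>^2 - 3)\<close>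
      eliminates \<open>\<beta>\<close> and \<open>\<delta>\<close> and leaves the quartic
      \<open>R\<close> for \<open>\<alpha>\<close>, so a projective point arises from finitely many
      indices only. \<open>R\<close> is nonzero because its cubic coefficient forces
      \<open>\<rho> = 0\<close>, and then the leading one is 1.\<close>
    define \<rho> where "\<rho> = (\<beta> j0 * \<delta> j0 - 2 * \<alpha> j0) / (\<alpha> j0 ^ 2 - 3)"
    define R where "R = [: - 3 - 9 * \<rho>^2, 12 * \<rho>, 6 * \<rho>^2 - 2, - 4 * \<rho>, 1 - \<rho>^2 :]"
    have "R \<noteq> 0"
    proof
      assume "R = 0"
      then show False unfolding R_def by (simp, elim conjE, simp)
    qed
    then have fin: "finite {a. poly R a = 0}" by (rule poly_roots_finite)
    have "\<alpha> j \<in> {a. poly R a = 0}" if j: "proj_point K (v j) = proj_point K (v j0)" for j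
    proof -
      have "v j \<in> proj_point K (v j)"
        unfolding proj_point_def using X.span_rat[of 1] by (cases "v j") (force simp: K_def)
      then obtain l where l: "\<beta> j * \<delta> j - 2 * \<alpha> j = l * (\<beta> j0 * \<delta> j0 - 2 * \<alpha> j0)"
        "\<alpha> j ^ 2 - 3 = l * (\<alpha> j0 ^ 2 - 3)"
        unfolding j by (auto simp: proj_point_def v_def)
      have "\<alpha> j0 ^ 2 - 3 \<noteq> 0" using neqs(3)[OF P] by simp
      then have "\<beta> j * \<delta> j - 2 * \<alpha> j = \<rho> * (\<alpha> j ^ 2 - 3)" unfolding \<rho>_def l by simp
      moreover have e: "\<alpha> j ^ 2 - 1 = \<beta> j ^ 2" "\<alpha> j ^ 2 + 3 = \<delta> j ^ 2" using P[of j] unfolding P_def by auto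
      ultimately have "- 3 - 9 * \<rho>^2 + 12 * \<rho> * \<alpha> j + (6 * \<rho>^2 - 2) * \<alpha> j ^ 2 - 4 * \<rho> * \<alpha> j ^ 3 + (1 - \<rho>^2) * \<alpha> j ^ 4 = 0"
        by algebra
      then show ?thesis unfolding R_def
        by (simp add: algebra_simps power2_eq_square power3_eq_cube power4_eq_xxxx)
    qed
    then have "\<alpha> ` {j. proj_point K (v j) = proj_point K (v j0)} \<subseteq> {a. poly R a = 0}" by blast
    then show ?thesis using fin inj by (meson finite_imageD finite_subset inj_on_subset subset_UNIV)
  qed
  ultimately show False by blast
qed

section \<open>Rational points close to the origin\<close>

definition curve_eq :: "int \<Rightarrow> int \<Rightarrow> int \<Rightarrow> bool" where
  "curve_eq A B C \<longleftrightarrow> C^2 = A^3 - 10 * A^2 * B^2 + 88 * A * B^4 - 108 * B^6"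

text \<open>The curve has bad reduction at 2, 3 and 19.  The divisibility conditions keep the point away from
  the singular points of the reductions, so that doubling produces no cancellation.\<close>
definition good_point :: "int \<Rightarrow> int \<Rightarrow> int \<Rightarrow> bool" where
  "good_point A B C \<longleftrightarrow> curve_eq A B C \<and> coprime A B \<and> 6 dvd B \<and> \<not> 19 dvd A + 12 * B^2 \<and> B \<noteq> 0"

text \<open>The duplication formula in the coordinates \<open>X = A / B\<^sup>2\<close>, \<open>Y = C / B\<^sup>3\<close>.\<close>
definition dblA :: "int \<Rightarrow> int \<Rightarrow> int" where
  "dblA A B = A^4 - 176 * A^2 * B^4 + 864 * A * B^6 + 3424 * B^8"

definition dblC :: "int \<Rightarrow> int \<Rightarrow> int" where
  "dblC A B = A^6 - 20 * A^5 * B^2 + 440 * A^4 * B^4 - 2160 * A^3 * B^6 - 17120 * A^2 * B^8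
     + 106496 * A * B^10 - 394624 * B^12"

text \<open>The curve equation is a polynomial identity; the substance is coprimality. A prime
  common to \<open>dblA A B\<close> and \<open>2 * B * C\<close> divides the cubic \<open>G\<close>
  and its derivative \<open>G'\<close>, so the point reduces to a singular one and only 2, 3, 19
  remain. The first two divide \<open>B\<close>; 19 is excluded by the condition on
  \<open>A + 12 * B^2\<close>, which doubling preserves.\<close>

lemma good_point_double:
  assumes P: "good_point A B C"
  shows "good_point (dblA A B) (2 * B * C) (dblC A B)"
proof -
  have eq: "C^2 = A^3 - 10 * A^2 * B^2 + 88 * A * B^4 - 108 * B^6" and cop: "coprime A B"
    and B6: "6 dvd B" and n19: "\<not> 19 dvd A + 12 * B^2" and B0: "B \<noteq> 0"
    using P unfolding good_point_def curve_eq_def by auto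
  define b where "b = B^2"
  define G where "G = A^3 - 10 * A^2 * b + 88 * A * b^2 - 108 * b^3"
  define G' where "G' = 3 * A^2 - 20 * A * b + 88 * b^2"
  have G: "C^2 = G" unfolding eq G_def b_def by algebra
  have F: "dblA A B = A^4 - 176 * A^2 * b^2 + 864 * A * b^3 + 3424 * b^4" unfolding dblA_def b_def by algebra
  have F': "dblA A B = G'^2 + (40 * b - 8 * A) * G" unfolding F G_def G'_def by algebra
  have even: "even B" using B6 dvd_trans[of 2 6 B] by simp
  have oA: "odd A" using cop even by (metis coprime_common_divisor odd_one)
  have "odd (C^2)" unfolding eq using oA even by simp
  then have C0: "C \<noteq> 0" by auto
  have common: "r dvd A \<Longrightarrow> r dvd B \<Longrightarrow> prime r \<Longrightarrow> False" for r
    using cop by (meson coprime_common_divisor not_prime_unit)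
  have "curve_eq (dblA A B) (2 * B * C) (dblC A B)"
  proof -
    have "(2 * B * C)^2 = 4 * b * G" unfolding G[symmetric] b_def by algebra
    moreover have "(2 * B * C)^4 = (4 * b * G)^2" "(2 * B * C)^6 = (4 * b * G)^3"
      unfolding calculation[symmetric] by (simp_all flip: power_mult)
    moreover have "dblC A B = A^6 - 20 * A^5 * b + 440 * A^4 * b^2 - 2160 * A^3 * b^3 - 17120 * A^2 * b^4
     + 106496 * A * b^5 - 394624 * b^6" unfolding dblC_def b_def by algebra
    ultimately show ?thesis unfolding curve_eq_def F G_def by algebra
  qed
  moreover have "coprime (dblA A B) (2 * B * C)"
  proof (rule coprimeI_prime_int)
    show "dblA A B \<noteq> 0 \<or> 2 * B * C \<noteq> 0" using B0 C0 by simp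
    fix r assume r: "prime r" "r dvd dblA A B" "r dvd 2 * B * C"
    have rB: "\<not> r dvd B"
    proof
      assume rB: "r dvd B"
      then have "r dvd b" unfolding b_def by (simp add: power2_eq_square)
      then have "r dvd A^4"
      proof -
        have "A^4 = dblA A B + b * (176 * A^2 * b - 864 * A * b^2 - 3424 * b^3)" unfolding F by algebra
        then show ?thesis using r(2) \<open>r dvd b\<close> by simp
      qed
      then show False using common rB r(1) by (metis prime_dvd_power)
    qed
    have "r \<noteq> 2" using rB even by auto
    then have "\<not> r dvd 2" using r(1) primes_dvd_imp_eq[of r 2] by auto
    then have "r dvd C" using r rB by (simp add: prime_dvd_mult_iff)
    then have rG: "r dvd G" unfolding G[symmetric] by (simp add: power2_eq_square)
    then have "r dvd G'^2" using r(2) unfolding F' by (simp add: dvd_add_left_iff)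
    then have rG': "r dvd G'" using r(1) by (metis prime_dvd_power)
    \<comment> \<open>A Bezout relation between \<open>G\<close> and \<open>G'\<close>; the constant
      is, up to sign, a quarter of the discriminant of the cubic of \<open>D\<close>.\<close>
    have "(1571 * b - 246 * A) * G + (4734 * b^2 - 797 * A * b + 82 * A^2) * G' = 2^2 * 3^2 * 19^3 * b^4"
      unfolding G_def G'_def by algebra
    then have "r dvd 2^2 * 3^2 * 19^3 * b^4" using rG rG' by (metis dvd_add dvd_mult)
    moreover have rb: "\<not> r dvd b" using rB r(1) unfolding b_def by (metis prime_dvd_power)
    moreover have "\<not> r dvd 3"
    proof
      assume "r dvd 3"
      also have "(3 :: int) dvd B" using B6 dvd_trans[of 3 6 B] by simp
      finally show False using rB by simp
    qed
    ultimately have "r dvd 19" using r(1) \<open>\<not> r dvd 2\<close> by (metis prime_dvd_mult_iff prime_dvd_power)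
    then have r19: "r = 19" using r(1) primes_dvd_imp_eq[of r 19] by simp
    \<comment> \<open>Modulo 19 the cubic has the double root 7, which is -12 and thus excluded, and
      the simple root -4, at which the derivative is 216.\<close>
    have "G = (A - 7 * b)^2 * (A + 4 * b) + 19 * (5 * A * b^2 - 16 * b^3)" unfolding G_def by algebra
    then have "r dvd (A - 7 * b)^2 * (A + 4 * b)" using rG unfolding r19 by (metis dvd_add_left_iff dvd_triv_left)
    then have "r dvd A - 7 * b \<or> r dvd A + 4 * b" using r(1) by (metis prime_dvd_mult_iff prime_dvd_power)
    then show False
    proof
      assume "r dvd A - 7 * b"
      then have "19 dvd (A - 7 * b) + 19 * b" unfolding r19 by (rule dvd_add) simp
      then show False using n19 unfolding b_def by (simp add: add.commute)
    next
      assume h: "r dvd A + 4 * b"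
      have "G' = (A + 4 * b) * (3 * A - 32 * b) + 216 * b^2" unfolding G'_def by algebra
      then have "r dvd 216 * b^2" using rG' h by (metis dvd_add_right_iff dvd_mult2)
      then have "r dvd 216" using rb r(1) by (metis prime_dvd_mult_iff prime_dvd_power)
      then show False unfolding r19 by simp
    qed
  qed
  moreover have "\<not> 19 dvd dblA A B + 12 * (2 * B * C)^2"
  proof
    assume h: "19 dvd dblA A B + 12 * (2 * B * C)^2"
    have "dblA A B + 12 * (2 * B * C)^2 = dblA A B + 48 * b * G" unfolding G[symmetric] b_def by algebra
    also have "\<dots> = (A - 7 * b)^4 + 19 * (4 * A^3 * b - 50 * A^2 * b^2 + 340 * A * b^3 - 219 * b^4)"
      unfolding F G_def by algebra
    finally have "19 dvd (A - 7 * b)^4" using h by (metis dvd_add_left_iff dvd_triv_left)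
    moreover have "prime (19 :: int)" by simp
    ultimately have "19 dvd A - 7 * b" by (metis prime_dvd_power)
    then have "19 dvd (A - 7 * b) + 19 * b" by (rule dvd_add) simp
    then show False using n19 unfolding b_def by (simp add: add.commute)
  qed
  ultimately show ?thesis unfolding good_point_def using B0 C0 B6 by simp
qed

text \<open>The starting point is \<open>8 (2, 6)\<close>.\<close>
primrec pts :: "nat \<Rightarrow> int \<times> int \<times> int" where
  "pts 0 = (228922952657705814132289, 388598966892, 142618188222728011007246389581192943)"
| "pts (Suc k) = (case pts k of (A, B, C) \<Rightarrow> (dblA A B, 2 * B * C, dblC A B))"

lemma coprime_bezout_int: "a * x + b * y = (1 :: int) \<Longrightarrow> coprime x y"
  by (metis coprime_iff_gcd_eq_1 dvd_add dvd_mult gcd_dvd1 gcd_dvd2 is_unit_gcd)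

lemma pts_good: "case pts k of (A, B, C) \<Rightarrow> good_point A B C"
proof (induction k)
  case 0
  show ?case unfolding good_point_def curve_eq_def pts.simps prod.case
    using coprime_bezout_int[of "98902438093" 228922952657705814132289 "-58263248444476564791353" 388598966892] by simp
next
  case (Suc k)
  then show ?case by (auto split: prod.splits intro: good_point_double)
qed

definition ptA :: "nat \<Rightarrow> int" where "ptA k = fst (pts k)"
definition ptB :: "nat \<Rightarrow> int" where "ptB k = fst (snd (pts k))"
definition ptC :: "nat \<Rightarrow> int" where "ptC k = snd (snd (pts k))"

lemma pt_good: "good_point (ptA k) (ptB k) (ptC k)"
  using pts_good[of k] unfolding ptA_def ptB_def ptC_def by (cases "pts k") simp

lemma ptB_Suc: "ptB (Suc k) = 2 * ptB k * ptC k"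
  unfolding ptB_def ptC_def by (cases "pts k") simp

lemma odd_ptA: "odd (ptA k)" and odd_ptC: "odd (ptC k)"
proof -
  have P: "curve_eq (ptA k) (ptB k) (ptC k)" "coprime (ptA k) (ptB k)" "6 dvd ptB k"
    using pt_good[of k] unfolding good_point_def by auto
  have B: "even (ptB k)" using P(3) dvd_trans[of 2 6 "ptB k"] by simp
  show A: "odd (ptA k)" using P(2) B by (metis coprime_common_divisor odd_one)
  have "odd (ptC k ^ 2)" using P(1) A B unfolding curve_eq_def by simp
  then show "odd (ptC k)" by simp
qed

lemma ptB_nonzero: "ptB k \<noteq> 0" and coprime_ptA_ptB: "coprime (ptA k) (ptB k)"
  using pt_good[of k] unfolding good_point_def by auto

text \<open>\<open>ptC k\<close> is odd, so each doubling adds exactly one factor 2 to the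
  denominator. This separates the points of the sequence by their 2-adic valuations.\<close>

lemma multiplicity_ptB: "multiplicity 2 (ptB k) = multiplicity 2 (ptB 0) + k"
proof (induction k)
  case (Suc k)
  have "ptC k \<noteq> 0" using odd_ptC[of k] by auto
  then have "multiplicity 2 (ptB (Suc k)) = multiplicity (2::int) 2 + multiplicity 2 (ptB k) + multiplicity 2 (ptC k)"
    unfolding ptB_Suc using ptB_nonzero[of k] by (simp add: prime_elem_multiplicity_mult_distrib)
  moreover have "multiplicity 2 (ptC k) = 0" by (rule not_dvd_imp_multiplicity_0) (rule odd_ptC)
  ultimately show ?case using Suc by simp
qed simp

lemma pt_distinct:
  assumes "i \<noteq> j"
  shows "ptA i * ptB j ^ 2 \<noteq> ptA j * ptB i ^ 2"
proof
  assume e: "ptA i * ptB j ^ 2 = ptA j * ptB i ^ 2"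
  have m: "multiplicity 2 (ptA k * ptB l ^ 2) = 2 * multiplicity 2 (ptB l)" for k l
  proof -
    have "ptA k \<noteq> 0" using odd_ptA[of k] by auto
    moreover have "multiplicity 2 (ptA k) = 0" by (rule not_dvd_imp_multiplicity_0) (rule odd_ptA)
    ultimately show ?thesis using ptB_nonzero[of l]
      by (simp add: prime_elem_multiplicity_mult_distrib prime_elem_multiplicity_power_distrib)
  qed
  have "2 * multiplicity 2 (ptB j) = 2 * multiplicity 2 (ptB i)" using m[of i j] m[of j i] e by simp
  then show False using multiplicity_ptB[of i] multiplicity_ptB[of j] assms by simp
qed

text \<open>If \<open>p\<close> divides \<open>ptC k\<close>, it divides \<open>ptB\<close> at all
  later indices, so at most one such index exists. There the difference formula for congruent points
  would read 0/0 modulo \<open>p\<close>.\<close>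

lemma finite_bad_indices:
  assumes "prime p"
  shows "finite {k. p dvd ptC k \<and> \<not> p dvd ptB k}"
proof -
  have later: "p dvd ptB j" if "p dvd ptC k" "k < j" for k j
    using that(2)
  proof (induction j)
    case (Suc j)
    then show ?case using that(1) unfolding ptB_Suc by (cases "k = j") auto
  qed simp
  have "k = j" if "p dvd ptC k \<and> \<not> p dvd ptB k" "p dvd ptC j \<and> \<not> p dvd ptB j" for k j
    using that later by (meson linorder_neqE_nat)
  then have "\<exists>j. {k. p dvd ptC k \<and> \<not> p dvd ptB k} \<subseteq> {j}" by blast
  then show ?thesis by (meson finite.simps finite_subset)
qed

text \<open>Pigeonhole for the residues modulo the product of \<open>S\<close>, applied to the
  infinitely many indices left by \<open>finite_bad_indices\<close>.\<close>

lemma ex_congruent_points: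
  assumes S: "finite S" "\<And>p. p \<in> S \<Longrightarrow> prime (p :: int)"
  obtains i j where "i \<noteq> j"
    "\<And>p. p \<in> S \<Longrightarrow> p dvd ptA i - ptA j \<and> p dvd ptB i - ptB j \<and> p dvd ptC i - ptC j"
    "\<And>p. p \<in> S \<Longrightarrow> p dvd ptB i \<or> \<not> p dvd ptC i"
proof -
  define M where "M = \<Prod>S"
  have M: "M > 0" unfolding M_def using S(2) by (intro prod_pos) (auto intro: prime_gt_0_int)
  define G where "G = - (\<Union>p\<in>S. {k. p dvd ptC k \<and> \<not> p dvd ptB k})"
  have "finite (\<Union>p\<in>S. {k. p dvd ptC k \<and> \<not> p dvd ptB k})" using S finite_bad_indices by blast
  then have "infinite G" unfolding G_def Compl_eq_Diff_UNIV
    by (rule Diff_infinite_finite) simp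
  moreover define f where "f k = (ptA k mod M, ptB k mod M, ptC k mod M)" for k
  have "f ` G \<subseteq> {0..<M} \<times> {0..<M} \<times> {0..<M}" unfolding f_def using M by auto
  then have "finite (f ` G)" by (rule finite_subset) simp
  ultimately obtain i where i: "i \<in> G" "infinite {j \<in> G. f j = f i}" using pigeonhole_infinite by blast
  have "infinite ({j \<in> G. f j = f i} - {i})" using i(2) by simp
  then obtain j where j: "j \<in> G" "f j = f i" "j \<noteq> i" by (metis (mono_tags, lifting) DiffE finite.emptyI insertCI mem_Collect_eq ex_in_conv)
  have dvd: "p dvd a - b" if "p \<in> S" "a mod M = b mod M" for p a b
  proof -
    have "p dvd M" unfolding M_def using that(1) S(1) by (rule dvd_prodI[rotated])
    moreover have "M dvd a - b" using that(2) by (rule mod_eq_dvd_iff[THEN iffD1])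
    ultimately show ?thesis by (rule dvd_trans)
  qed
  show ?thesis
  proof (rule that[of i j])
    show "i \<noteq> j" using j by simp
    show "p dvd ptA i - ptA j \<and> p dvd ptB i - ptB j \<and> p dvd ptC i - ptC j" if "p \<in> S" for p
      using j(2) unfolding f_def by (auto intro!: dvd that)
    show "p dvd ptB i \<or> \<not> p dvd ptC i" if "p \<in> S" for p using i(1) that unfolding G_def by auto
  qed
qed

section \<open>Differences of rational points on \<open>D\<close>\<close>

definition curve_rat :: "rat \<Rightarrow> rat \<Rightarrow> bool" where
  "curve_rat X Y \<longleftrightarrow> Y^2 = X^3 - 10 * X^2 + 88 * X - 108"

lemma curve_rat_of_curve_eq:
  assumes "curve_eq A B C" "B \<noteq> 0"
  shows "curve_rat (of_int A / of_int B ^ 2) (of_int C / of_int B ^ 3)"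
proof -
  have "(of_int C :: rat)^2 = of_int A ^ 3 - 10 * of_int A ^ 2 * of_int B ^ 2 + 88 * of_int A * of_int B ^ 4
      - 108 * of_int B ^ 6"
    using arg_cong[OF assms(1)[unfolded curve_eq_def], of "of_int :: int \<Rightarrow> rat"] by simp
  moreover define b X Y where "b = (of_int B :: rat)" and "X = of_int A / b^2" and "Y = of_int C / b^3"
  moreover have b: "b \<noteq> 0" unfolding b_def using assms(2) by simp
  moreover have "of_int A = X * b^2" "of_int C = Y * b^3" unfolding X_def Y_def using b by simp_all
  ultimately have "(Y^2 - (X^3 - 10 * X^2 + 88 * X - 108)) * b^6 = 0" by algebra
  then show ?thesis using b unfolding curve_rat_def X_def Y_def b_def by simp
qed

text \<open>\<open>l\<close> is the slope of the chord through the first point and the negative of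
  the second, so \<open>X3\<close> is the abscissa of their difference. The second claim is the form
  of \<open>X3\<close> that can be read modulo primes.\<close>

lemma curve_rat_difference:
  assumes P: "curve_rat X1 Y1" and Q: "curve_rat X2 Y2" and ne: "X1 \<noteq> X2"
  defines "l \<equiv> (Y1 + Y2) / (X1 - X2)"
  defines "X3 \<equiv> l^2 + 10 - X1 - X2"
  shows "curve_rat X3 (- (Y1 + l * (X3 - X1)))"
    and "X3 * (X1 - X2)^2 = (X1 + X2) * (X1 * X2 + 88) - 20 * X1 * X2 - 216 + 2 * Y1 * Y2"
proof -
  have l: "l * (X1 - X2) = Y1 + Y2" unfolding l_def using ne by simp
  \<comment> \<open>\<open>s * X + t\<close> is what remains after subtracting the product over the
    three abscissas; vanishing at \<open>X1\<close> and \<open>X2\<close>, it is zero.\<close>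
  define s where "s = 88 - 2 * l * Y1 + 2 * l^2 * X1 - (X1 * X2 + X1 * X3 + X2 * X3)"
  define t where "t = - 108 - (Y1 - l * X1)^2 + X1 * X2 * X3"
  have e: "(X^3 - 10 * X^2 + 88 * X - 108) - (Y1 + l * (X - X1))^2 = (X - X1) * (X - X2) * (X - X3) + (s * X + t)" for X
    unfolding s_def t_def X3_def by algebra
  have 1: "s * X1 + t = 0" using e[of X1] P unfolding curve_rat_def by simp
  have "Y1 + l * (X2 - X1) = - Y2" using l by (simp add: algebra_simps)
  then have 2: "s * X2 + t = 0" using e[of X2] Q unfolding curve_rat_def by simp
  have "s * (X1 - X2) = 0" using 1 2 by algebra
  then have "s = 0" using ne by simp
  then have "t = 0" using 1 by simp
  then show "curve_rat X3 (- (Y1 + l * (X3 - X1)))" using e[of X3] \<open>s = 0\<close> unfolding curve_rat_def by algebra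
  have "X3 * (X1 - X2)^2 = (l * (X1 - X2))^2 + (10 - X1 - X2) * (X1 - X2)^2" unfolding X3_def by algebra
  also have "\<dots> = Y1^2 + Y2^2 + 2 * Y1 * Y2 + (10 - X1 - X2) * (X1 - X2)^2" unfolding l by algebra
  also have "\<dots> = (X1 + X2) * (X1 * X2 + 88) - 20 * X1 * X2 - 216 + 2 * Y1 * Y2"
    using P Q unfolding curve_rat_def by algebra
  finally show "X3 * (X1 - X2)^2 = (X1 + X2) * (X1 * X2 + 88) - 20 * X1 * X2 - 216 + 2 * Y1 * Y2" .
qed

text \<open>For \<open>X = a / d\<close> in lowest terms, \<open>d * g\<close> is a square with
  \<open>g\<close> congruent to \<open>a^3\<close> modulo \<open>d\<close>; the coprime factors
  \<open>d\<close> and \<open>g\<close> are therefore squares.\<close>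

lemma curve_rat_square_denominator:
  assumes "curve_rat X Y"
  obtains A B C where "curve_eq A B C" "coprime A B" "B \<noteq> 0" "B^2 = snd (quotient_of X)"
proof -
  obtain a d where ad: "quotient_of X = (a, d)" by (cases "quotient_of X")
  have d: "d > 0" and cop: "coprime a d" and X: "X = of_int a / of_int d"
    using quotient_of_denom_pos[OF ad] quotient_of_coprime[OF ad] quotient_of_div[OF ad] by auto
  define g where "g = a^3 - 10 * a^2 * d + 88 * a * d^2 - 108 * d^3"
  have "(Y * of_int d ^ 2)^2 = of_int (d * g)"
  proof -
    have "(Y * of_int d ^ 2)^2 = (X^3 - 10 * X^2 + 88 * X - 108) * of_int d ^ 4"
      using assms unfolding curve_rat_def by (simp add: power_mult_distrib flip: power_mult)
    also have "\<dots> = ((X * of_int d)^3 - 10 * (X * of_int d)^2 * of_int d + 88 * (X * of_int d) * of_int d ^ 2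
        - 108 * of_int d ^ 3) * of_int d" by algebra
    also have "X * of_int d = of_int a" unfolding X using d by simp
    finally show ?thesis unfolding g_def by (simp add: mult.commute)
  qed
  then obtain c where c: "Y * of_int d ^ 2 = of_int c" by (rule rat_square_int)
  have "(of_int (d * g) :: rat) = of_int (c^2)"
    using \<open>(Y * of_int d ^ 2)^2 = of_int (d * g)\<close> unfolding c by simp
  then have dg: "d * g = c^2" by (simp only: of_int_eq_iff)
  have copg: "coprime d g"
  proof (rule coprimeI_prime_int)
    fix q assume q: "prime q" "q dvd d" "q dvd g"
    have "a^3 = g + d * (10 * a^2 - 88 * a * d + 108 * d^2)" unfolding g_def by algebra
    then have "q dvd a^3" using q by simp
    then have "q dvd a" using q(1) by (metis prime_dvd_power)
    then show False using cop q by (meson coprime_common_divisor not_prime_unit)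
  qed (use d in simp)
  have "g \<ge> 0" using dg d by (metis zero_le_mult_iff zero_le_power2 less_le_not_le)
  then obtain B C where BC: "d = B^2" "g = C^2" using coprime_mult_square_int[OF dg copg] d by auto
  show ?thesis
  proof (rule that)
    show "curve_eq a B C" unfolding curve_eq_def BC(2)[symmetric] g_def BC(1) by algebra
    show "coprime a B" using cop unfolding BC by simp
    show "B \<noteq> 0" using d BC by auto
    show "B^2 = snd (quotient_of X)" using ad BC by simp
  qed
qed

lemma dvd_denominator:
  fixes X :: rat and u w p :: int
  assumes "prime p" "X * of_int w = of_int u" "\<not> p dvd u" "p dvd w"
  shows "p dvd snd (quotient_of X)"
proof -
  obtain a d where ad: "quotient_of X = (a, d)" by (cases "quotient_of X")
  have "d > 0" "X = of_int a / of_int d" using quotient_of_denom_pos[OF ad] quotient_of_div[OF ad] by auto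
  then have "of_int a = X * of_int d" by simp
  then have "(of_int (a * w) :: rat) = (X * of_int w) * of_int d" by simp
  then have "(of_int (a * w) :: rat) = of_int (u * d)" unfolding assms(2) by simp
  then have "a * w = u * d" by (simp only: of_int_eq_iff)
  then have "p dvd u * d" using assms(4) by (metis dvd_mult)
  then show ?thesis using assms(1,3) ad by (simp add: prime_dvd_mult_iff)
qed

text \<open>The difference of two points that agree modulo \<open>p\<close> reduces to the origin,
  so \<open>p\<close> divides its denominator. The primes 2, 3, 19 are added to \<open>S\<close> for
  the later 2-adic and cube arguments.\<close>

lemma ex_point_near_origin:
  assumes S: "finite S" "\<And>p. p \<in> S \<Longrightarrow> prime (p :: int)"
  obtains A B C where "curve_eq A B C" "coprime A B" "B \<noteq> 0" "\<And>p. p \<in> S \<Longrightarrow> p dvd B"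
    "2 dvd B" "3 dvd B" "19 dvd B"
proof -
  define S' where "S' = {2, 3, 19} \<union> S"
  have S': "finite S'" "\<And>p. p \<in> S' \<Longrightarrow> prime p" using S unfolding S'_def by auto
  obtain i j where ij: "i \<noteq> j"
    "\<And>p. p \<in> S' \<Longrightarrow> p dvd ptA i - ptA j \<and> p dvd ptB i - ptB j \<and> p dvd ptC i - ptC j"
    "\<And>p. p \<in> S' \<Longrightarrow> p dvd ptB i \<or> \<not> p dvd ptC i"
    using ex_congruent_points[OF S'] by blast
  define A1 B1 C1 A2 B2 C2 where P: "A1 = ptA i" "B1 = ptB i" "C1 = ptC i" "A2 = ptA j" "B2 = ptB j" "C2 = ptC j"
  have c1: "curve_eq A1 B1 C1" and c2: "curve_eq A2 B2 C2" using pt_good unfolding P good_point_def by auto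
  have cop: "coprime A1 B1" "coprime A2 B2" unfolding P by (rule coprime_ptA_ptB)+
  have nz: "B1 \<noteq> 0" "B2 \<noteq> 0" unfolding P by (rule ptB_nonzero)+
  have ne: "A1 * B2^2 - A2 * B1^2 \<noteq> 0" using pt_distinct[OF ij(1)] unfolding P by simp
  have B6: "6 dvd B1" using pt_good[of i] unfolding P good_point_def by auto
  define X1 Y1 X2 Y2 where XY: "X1 = (of_int A1 / of_int B1 ^ 2 :: rat)" "Y1 = (of_int C1 / of_int B1 ^ 3 :: rat)"
    "X2 = (of_int A2 / of_int B2 ^ 2 :: rat)" "Y2 = (of_int C2 / of_int B2 ^ 3 :: rat)"
  have r1: "curve_rat X1 Y1" and r2: "curve_rat X2 Y2"
    unfolding XY by (rule curve_rat_of_curve_eq c1 c2 nz)+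
  have nz': "(of_int B1 :: rat) \<noteq> 0" "(of_int B2 :: rat) \<noteq> 0" using nz by simp_all
  have A_eq: "of_int A1 = X1 * of_int B1 ^ 2" "of_int C1 = Y1 * of_int B1 ^ 3"
    "of_int A2 = X2 * of_int B2 ^ 2" "of_int C2 = Y2 * of_int B2 ^ 3" unfolding XY using nz' by simp_all
  have X12: "X1 \<noteq> X2"
  proof
    assume "X1 = X2"
    then have "of_int (A1 * B2^2 - A2 * B1^2) = (0 :: rat)" by (simp add: A_eq)
    then show False using ne by (simp only: of_int_eq_0_iff)
  qed
  define X3 where "X3 = ((Y1 + Y2) / (X1 - X2))^2 + 10 - X1 - X2"
  obtain Y3 where c3: "curve_rat X3 Y3" using curve_rat_difference(1)[OF r1 r2 X12] unfolding X3_def by blast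
  have X3: "X3 * (X1 - X2)^2 = (X1 + X2) * (X1 * X2 + 88) - 20 * X1 * X2 - 216 + 2 * Y1 * Y2"
    unfolding X3_def by (rule curve_rat_difference(2)[OF r1 r2 X12])
  define den where "den = (A1 * B2^2 - A2 * B1^2)^2"
  \<comment> \<open>\<open>N 1 / den\<close> and \<open>N (-1) / den\<close> are the abscissas of
    the difference and of the sum of the two points.\<close>
  define N where "N e = (A1 * B2^2 + A2 * B1^2) * (A1 * A2 + 88 * B1^2 * B2^2) - 20 * A1 * A2 * B1^2 * B2^2
      - 216 * B1^4 * B2^4 + 2 * e * C1 * C2 * B1 * B2" for e
  \<comment> \<open>\<open>E / den\<close> is the product of these two abscissas. Hence
    \<open>X3 = E / N (-1)\<close>, a second representation for the case where \<open>p\<close>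
    divides both \<open>N 1\<close> and \<open>den\<close>.\<close>
  define E where "E = (A1 * A2 - 88 * B1^2 * B2^2)^2
      + 432 * (A1 * B2^2 + A2 * B1^2 - 10 * B1^2 * B2^2) * B1^2 * B2^2"
  have den: "of_int den = (X1 - X2)^2 * (of_int B1 ^ 4 * of_int B2 ^ 4)"
    unfolding den_def of_int_diff of_int_mult of_int_power A_eq by algebra
  have N1: "X3 * of_int den = of_int (N 1)"
  proof -
    have "X3 * of_int den = (X3 * (X1 - X2)^2) * (of_int B1 ^ 4 * of_int B2 ^ 4)" unfolding den by algebra
    also have "\<dots> = of_int (N 1)" unfolding X3 N_def of_int_diff of_int_add of_int_mult of_int_power
      of_int_numeral of_int_1 A_eq by algebra
    finally show ?thesis .
  qed
  have NN: "N 1 * N (-1) = den * E"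
  proof -
    define M where "M = (A1 * B2^2 + A2 * B1^2) * (A1 * A2 + 88 * B1^2 * B2^2) - 20 * A1 * A2 * B1^2 * B2^2
      - 216 * B1^4 * B2^4"
    have "N 1 * N (-1) = M^2 - 4 * C1^2 * C2^2 * B1^2 * B2^2" unfolding N_def M_def by algebra
    also have "\<dots> = den * E"
      using c1 c2 unfolding curve_eq_def M_def den_def E_def by algebra
    finally show ?thesis .
  qed
  obtain A B C where ABC: "curve_eq A B C" "coprime A B" "B \<noteq> 0" "B^2 = snd (quotient_of X3)"
    using curve_rat_square_denominator[OF c3] by blast
  have "p dvd B" if p: "p \<in> S'" for p
  proof -
    have pr: "prime p" using S'(2) p by blast
    have pd: "p dvd A1 - A2" "p dvd B1 - B2" "p dvd C1 - C2" and pC: "p dvd B1 \<or> \<not> p dvd C1"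
      using ij(2,3)[OF p] unfolding P by auto
    have "p dvd snd (quotient_of X3)"
    proof (cases "p dvd B1")
      \<comment> \<open>Both points already reduce to the origin, so \<open>N 1 / den\<close> is 0/0
        modulo \<open>p\<close>; in \<open>E / N (-1)\<close> only the denominator vanishes.\<close>
      case True
      then have B2: "p dvd B2" using pd(2) by (metis dvd_diff_right_iff)
      have "\<not> p dvd A1" "\<not> p dvd A2" using cop True B2 pr by (meson coprime_common_divisor not_prime_unit)+
      then have "\<not> p dvd (A1 * A2)^2" using pr by (metis prime_dvd_mult_iff prime_dvd_power)
      moreover have "E = (A1 * A2)^2 + B1 * (B1 * B2^2 * (- 176 * A1 * A2 + 88^2 * B1^2 * B2^2
          + 432 * (A1 * B2^2 + A2 * B1^2 - 10 * B1^2 * B2^2)))" unfolding E_def by algebra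
      ultimately have pE: "\<not> p dvd E" using True by (metis dvd_add_left_iff dvd_mult2)
      have "N (-1) = B1 * (A2 * B1 * (A1 * A2 + 88 * B1^2 * B2^2) + 88 * A1 * B2^4 * B1 - 20 * A1 * A2 * B1 * B2^2
          - 216 * B1^3 * B2^4 - 2 * C1 * C2 * B2) + B2 * (A1 * B2 * A1 * A2)" unfolding N_def by algebra
      then have pN: "p dvd N (-1)" using True B2 by simp
      have "den \<noteq> 0" unfolding den_def using ne by simp
      have "of_int den * (X3 * of_int (N (-1))) = (X3 * of_int den) * of_int (N (-1))" by simp
      also have "\<dots> = of_int (N 1 * N (-1))" unfolding N1 by simp
      also have "\<dots> = of_int den * of_int E" unfolding NN by simp
      finally have "X3 * of_int (N (-1)) = of_int E" using \<open>den \<noteq> 0\<close> by simp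
      then show ?thesis using dvd_denominator[OF pr _ pE pN] by blast
    next
      \<comment> \<open>For equal points the numerator degenerates to
        \<open>(2 * B1 * C1)^2\<close>, a unit modulo \<open>p\<close> by the choice of indices,
        while \<open>den\<close> vanishes.\<close>
      case False
      then have C1: "\<not> p dvd C1" using pC by simp
      have "\<not> p dvd 2" using False B6 pr dvd_trans[of p 2 B1] dvd_trans[of 2 6 B1] by auto
      obtain u v w where uvw: "A2 = A1 + p * u" "B2 = B1 + p * v" "C2 = C1 + p * w"
        using pd by (metis dvd_def diff_add_cancel add.commute dvd_diff_commute)
      have cA: "[A2 = A1] (mod p)" "[B2 = B1] (mod p)" "[C2 = C1] (mod p)"
        unfolding uvw cong_def by simp_all
      have "[N 1 = (A1 * B1^2 + A1 * B1^2) * (A1 * A1 + 88 * B1^2 * B1^2) - 20 * A1 * A1 * B1^2 * B1^2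
          - 216 * B1^4 * B1^4 + 2 * 1 * C1 * C1 * B1 * B1] (mod p)"
        unfolding N_def by (intro cong_add cong_diff cong_mult cong_pow cong_refl cA)
      also have "(A1 * B1^2 + A1 * B1^2) * (A1 * A1 + 88 * B1^2 * B1^2) - 20 * A1 * A1 * B1^2 * B1^2
          - 216 * B1^4 * B1^4 + 2 * 1 * C1 * C1 * B1 * B1 = (2 * B1 * C1)^2"
        using c1 unfolding curve_eq_def by algebra
      finally have "[N 1 = (2 * B1 * C1)^2] (mod p)" .
      moreover have "\<not> p dvd (2 * B1 * C1)^2" using pr False C1 \<open>\<not> p dvd 2\<close>
        by (metis prime_dvd_mult_iff prime_dvd_power)
      ultimately have "\<not> p dvd N 1" by (simp add: cong_dvd_iff)
      moreover have "[den = (A1 * B1^2 - A1 * B1^2)^2] (mod p)"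
        unfolding den_def by (intro cong_diff cong_mult cong_pow cong_refl cA)
      then have "p dvd den" by (simp add: cong_0_iff)
      ultimately show ?thesis using dvd_denominator[OF pr N1] by blast
    qed
    then have "p dvd B^2" unfolding ABC(4) .
    then show ?thesis using pr by (metis prime_dvd_power)
  qed
  then show ?thesis using that ABC unfolding S'_def by blast
qed

section \<open>Cubes in the Eisenstein integers\<close>

definition omega :: complex where "omega = Complex (-1/2) (sqrt 3 / 2)"

definition Eis :: "complex set" where "Eis = {of_int a + of_int b * omega | a b. True}"

definition sqrt_m3 :: complex where "sqrt_m3 = 1 + 2 * omega"

lemma omega_sq: "omega^2 = - 1 - omega"
  by (simp add: omega_def complex_eq_iff power2_eq_square)

lemma sqrt_m3_sq: "sqrt_m3^2 = - 3"
  using omega_sq unfolding sqrt_m3_def by algebra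

lemma EisI: "of_int a + of_int b * omega \<in> Eis"
  unfolding Eis_def by blast

lemma Eis_int: "of_int a \<in> Eis"
  using EisI[of a 0] by simp

lemma Eis_sqrt_m3: "sqrt_m3 \<in> Eis"
  using EisI[of 1 2] by (simp add: sqrt_m3_def)

lemma Eis_add: "u \<in> Eis \<Longrightarrow> v \<in> Eis \<Longrightarrow> u + v \<in> Eis"
proof -
  assume "u \<in> Eis" "v \<in> Eis"
  then obtain a b c d where "u = of_int a + of_int b * omega" "v = of_int c + of_int d * omega"
    unfolding Eis_def by blast
  then have "u + v = of_int (a + c) + of_int (b + d) * omega" by (simp add: algebra_simps)
  then show ?thesis by (simp only: EisI)
qed

lemma Eis_mult: "u \<in> Eis \<Longrightarrow> v \<in> Eis \<Longrightarrow> u * v \<in> Eis"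
proof -
  assume "u \<in> Eis" "v \<in> Eis"
  then obtain a b c d where uv: "u = of_int a + of_int b * omega" "v = of_int c + of_int d * omega"
    unfolding Eis_def by blast
  have "u * v = of_int a * of_int c + (of_int a * of_int d + of_int b * of_int c) * omega
      + of_int b * of_int d * omega^2"
    unfolding uv by algebra
  also have "\<dots> = of_int (a * c - b * d) + of_int (a * d + b * c - b * d) * omega"
    unfolding omega_sq by (simp add: algebra_simps)
  finally show ?thesis by (simp only: EisI)
qed

lemma Eis_diff: "u \<in> Eis \<Longrightarrow> v \<in> Eis \<Longrightarrow> u - v \<in> Eis"
  using Eis_add[of u "of_int (-1) * v"] Eis_mult[OF Eis_int[of "-1"]] by simp

lemma Eis_power: "u \<in> Eis \<Longrightarrow> u ^ k \<in> Eis"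
  by (induction k) (use Eis_int[of 1] in \<open>auto intro: Eis_mult\<close>)

lemma cmod_Eis: "(cmod (of_real a + of_real b * omega))^2 = a^2 - a * b + b^2"
proof -
  have "(cmod (of_real a + of_real b * omega))^2 = (a - b / 2)^2 + (b * (sqrt 3 / 2))^2"
    unfolding cmod_power2 by (simp add: omega_def)
  also have "\<dots> = (a - b / 2)^2 + b^2 * (3 / 4)" by (simp add: power_mult_distrib power_divide)
  also have "\<dots> = a^2 - a * b + b^2" by (simp add: power2_eq_square field_simps)
  finally show ?thesis .
qed

lemma cmod_Eis_int: "(cmod (of_int a + of_int b * omega))^2 = of_int (a^2 - a * b + b^2)"
  using cmod_Eis[of "of_int a" "of_int b"] by simp

lemma Eis_components:
  assumes "of_int a + of_int b * omega = of_int c + of_int d * omega"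
  shows "a = c \<and> b = d"
proof -
  have "(of_int b :: real) * (sqrt 3 / 2) = of_int d * (sqrt 3 / 2)"
    using arg_cong[OF assms, of Im] by (simp add: omega_def)
  then have "b = d" by simp
  with assms show ?thesis by simp
qed

text \<open>The norm-Euclidean property: \<open>t\<^sup>2 - t s + s\<^sup>2 \<le> 3/4\<close> when \<open>\<bar>t\<bar>, \<bar>s\<bar> \<le> 1/2\<close>.\<close>
lemma Eis_round:
  fixes z :: complex
  obtains w where "w \<in> Eis" "cmod (z - w) < 1"
proof -
  define b where "b = Im z / (sqrt 3 / 2)"
  define a where "a = Re z + b / 2"
  have z: "z = of_real a + of_real b * omega"
    by (simp add: complex_eq_iff omega_def a_def b_def)
  define t s where "t = a - of_int (round a)" and "s = b - of_int (round b)"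
  have ts: "\<bar>t\<bar> \<le> 1/2" "\<bar>s\<bar> \<le> 1/2"
    unfolding t_def s_def using of_int_round_abs_le[of a] of_int_round_abs_le[of b] by (simp_all add: abs_minus_commute)
  define w where "w = of_int (round a) + of_int (round b) * omega"
  have "z - w = of_real t + of_real s * omega"
    unfolding z w_def t_def s_def by (simp add: algebra_simps)
  then have "(cmod (z - w))^2 = t^2 - t * s + s^2" using cmod_Eis by simp
  also have "\<dots> \<le> 1/4 + 1/4 + 1/4"
  proof -
    have "t^2 \<le> (1/2)^2" "s^2 \<le> (1/2)^2" using ts by (simp_all add: abs_le_square_iff[symmetric])
    moreover have "- (t * s) \<le> \<bar>t\<bar> * \<bar>s\<bar>" by (metis abs_ge_minus_self abs_mult)
    moreover have "\<bar>t\<bar> * \<bar>s\<bar> \<le> 1/2 * (1/2)" using ts by (intro mult_mono) auto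
    ultimately show ?thesis by (simp add: power2_eq_square)
  qed
  also have "\<dots> < 1^2" by simp
  finally have "cmod (z - w) < 1" by (rule power2_less_imp_less) simp
  moreover have "w \<in> Eis" unfolding w_def by (rule EisI)
  ultimately show ?thesis using that by blast
qed

text \<open>The combination is a nonzero element of least norm in the ideal generated by
  \<open>\<alpha>\<close> and \<open>\<beta>\<close>; \<open>Eis_round\<close> makes every remainder
  vanish.\<close>

lemma Eis_gcd:
  assumes \<alpha>: "\<alpha> \<in> Eis" "\<alpha> \<noteq> 0" and \<beta>: "\<beta> \<in> Eis"
  obtains x y \<alpha>' \<beta>' where "x \<in> Eis" "y \<in> Eis" "\<alpha>' \<in> Eis" "\<beta>' \<in> Eis"
    "\<alpha> = (\<alpha> * x + \<beta> * y) * \<alpha>'" "\<beta> = (\<alpha> * x + \<beta> * y) * \<beta>'"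
proof -
  define I where "I = {\<alpha> * x + \<beta> * y | x y. x \<in> Eis \<and> y \<in> Eis}"
  have I_Eis: "I \<subseteq> Eis" unfolding I_def using \<alpha> \<beta> by (auto intro: Eis_add Eis_mult)
  have \<alpha>I: "\<alpha> \<in> I" unfolding I_def using Eis_int[of 1] Eis_int[of 0] by force
  have \<beta>I: "\<beta> \<in> I" unfolding I_def using Eis_int[of 1] Eis_int[of 0] by force
  have sub: "u - v * q \<in> I" if u: "u \<in> I" and v: "v \<in> I" and q: "q \<in> Eis" for u v q
  proof -
    obtain x y x' y' where E: "x \<in> Eis" "y \<in> Eis" "x' \<in> Eis" "y' \<in> Eis"
      and uv: "u = \<alpha> * x + \<beta> * y" "v = \<alpha> * x' + \<beta> * y'"
      using u v unfolding I_def by blast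
    have "u - v * q = \<alpha> * (x - x' * q) + \<beta> * (y - y' * q)" unfolding uv by algebra
    moreover have "x - x' * q \<in> Eis" "y - y' * q \<in> Eis" using E q by (auto intro: Eis_diff Eis_mult)
    ultimately show ?thesis unfolding I_def by blast
  qed
  have nat_norm: "\<exists>n :: nat. (cmod u)^2 = of_nat n" if u: "u \<in> Eis" for u
  proof -
    obtain a b where "u = of_int a + of_int b * omega" using u unfolding Eis_def by blast
    then have e: "(cmod u)^2 = of_int (a^2 - a * b + b^2)" using cmod_Eis_int by simp
    then have "0 \<le> (of_int (a^2 - a * b + b^2) :: real)" by (metis zero_le_power2)
    then have "0 \<le> a^2 - a * b + b^2" by linarith
    then have "(cmod u)^2 = of_nat (nat (a^2 - a * b + b^2))" using e by simp
    then show ?thesis ..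
  qed
  define P where "P n \<longleftrightarrow> (\<exists>u\<in>I. u \<noteq> 0 \<and> (cmod u)^2 = of_nat n)" for n :: nat
  have "\<exists>n. P n" unfolding P_def using \<alpha>I \<alpha>(2) nat_norm[OF \<alpha>(1)] by blast
  then obtain n where n: "P n" and least: "\<And>m. m < n \<Longrightarrow> \<not> P m"
    by (metis exists_least_iff)
  obtain \<delta> where \<delta>: "\<delta> \<in> I" "\<delta> \<noteq> 0" "(cmod \<delta>)^2 = of_nat n" using n unfolding P_def by blast
  have dvd: "\<exists>q\<in>Eis. u = \<delta> * q" if u: "u \<in> I" for u
  proof -
    obtain q where q: "q \<in> Eis" "cmod (u / \<delta> - q) < 1" by (rule Eis_round)
    define r where "r = u - \<delta> * q"
    have r: "r \<in> I" unfolding r_def by (rule sub[OF u \<delta>(1) q(1)])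
    have "r = \<delta> * (u / \<delta> - q)" unfolding r_def using \<delta>(2) by (simp add: algebra_simps)
    then have "cmod r < cmod \<delta>" using q(2) \<delta>(2) by (simp add: norm_mult)
    then have less: "(cmod r)^2 < of_nat n" unfolding \<delta>(3)[symmetric] by (intro power_strict_mono) auto
    obtain m where m: "(cmod r)^2 = of_nat m" using nat_norm r I_Eis by blast
    have "m < n" using less m by simp
    then have "r = 0" using least r m unfolding P_def by blast
    then show ?thesis using q(1) unfolding r_def by auto
  qed
  obtain x y where "x \<in> Eis" "y \<in> Eis" "\<delta> = \<alpha> * x + \<beta> * y" using \<delta>(1) unfolding I_def by blast
  then show ?thesis using that dvd[OF \<alpha>I] dvd[OF \<beta>I] by metis
qed

lemma Eis_unit:
  assumes "u \<in> Eis" "v \<in> Eis" "u * v = 1"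
  shows "u \<in> {1, -1, omega, - omega, omega^2, - (omega^2)}"
proof -
  obtain a b c d where u: "u = of_int a + of_int b * omega" and v: "v = of_int c + of_int d * omega"
    using assms unfolding Eis_def by blast
  have "(cmod u)^2 * (cmod v)^2 = 1" using assms(3) by (metis norm_mult norm_one power_mult_distrib power_one)
  then have "(of_int ((a^2 - a * b + b^2) * (c^2 - c * d + d^2)) :: real) = of_int 1"
    unfolding u v cmod_Eis_int by simp
  then have "(a^2 - a * b + b^2) * (c^2 - c * d + d^2) = 1" by (simp only: of_int_eq_iff)
  moreover have pos: "4 * (a^2 - a * b + b^2) = (2 * a - b)^2 + 3 * b^2" by algebra
  ultimately have "a^2 - a * b + b^2 = 1 \<or> a^2 - a * b + b^2 = - 1" by (auto simp: zmult_eq_1_iff)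
  then have one: "a^2 - a * b + b^2 = 1" using pos by (smt (verit) zero_le_power2)
  have small: "\<bar>k\<bar> \<le> 1" if "3 * k^2 \<le> 4" for k :: int
  proof (rule ccontr)
    assume "\<not> \<bar>k\<bar> \<le> 1"
    then have "2^2 \<le> \<bar>k\<bar>^2" by (intro power_mono) auto
    with that show False by simp
  qed
  have "\<bar>b\<bar> \<le> 1" using pos one by (intro small) (smt (verit) zero_le_power2)
  moreover have "4 * (a^2 - a * b + b^2) = (2 * b - a)^2 + 3 * a^2" by algebra
  then have "\<bar>a\<bar> \<le> 1" using one by (intro small) (smt (verit) zero_le_power2)
  ultimately have "a \<in> {-1, 0, 1}" "b \<in> {-1, 0, 1}" by auto
  then show ?thesis using one unfolding u omega_sq by auto
qed

lemma sqrt_m3_Eis_form: "of_int a + of_int b * sqrt_m3 = of_int (a + b) + of_int (2 * b) * omega"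
  unfolding sqrt_m3_def by (simp add: algebra_simps)

lemma sqrt_m3_components:
  assumes "of_int a + of_int b * sqrt_m3 = of_int c + of_int d * sqrt_m3"
  shows "a = c \<and> b = d"
  using Eis_components[of "a + b" "2 * b" "c + d" "2 * d"] assms unfolding sqrt_m3_Eis_form by simp

lemma omega_cube: "omega^3 = 1"
  using omega_sq by algebra

text \<open>Every element of \<open>\<int>[\<omega>]\<close> has an associate in \<open>\<int>[\<surd>-3]\<close>, and multiplying by \<open>\<omega>\<close> does not change the cube.\<close>
lemma Eis_cube:
  assumes "\<delta> \<in> Eis"
  obtains u v :: int where "\<delta>^3 = (of_int u + of_int v * sqrt_m3)^3"
proof -
  obtain a b where \<delta>: "\<delta> = of_int a + of_int b * omega" using assms unfolding Eis_def by blast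
  have form: "of_int (k + l) + of_int (2 * l) * omega = of_int k + of_int l * sqrt_m3" for k l
    by (rule sqrt_m3_Eis_form[symmetric])
  consider "even b" | "even (a - b)" | "even a" by auto
  then show ?thesis
  proof cases
    case 1
    then obtain l where "b = 2 * l" ..
    then have "\<delta> = of_int (a - l) + of_int l * sqrt_m3" using form[of "a - l" l] unfolding \<delta> by simp
    then show ?thesis using that by blast
  next
    case 2
    then obtain l where l: "a - b = 2 * l" ..
    have "\<delta> * omega = of_int (- b) + of_int (a - b) * omega"
      unfolding \<delta> of_int_diff of_int_minus using omega_sq by algebra
    then have "\<delta> * omega = of_int (- b - l) + of_int l * sqrt_m3" using form[of "- b - l" l] l by simp
    moreover have "\<delta>^3 = (\<delta> * omega)^3" by (simp add: power_mult_distrib omega_cube)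
    ultimately show ?thesis using that by metis
  next
    case 3
    then obtain l where l: "a = 2 * l" ..
    have "\<delta> * omega^2 = of_int (b - a) + of_int (- a) * omega"
      unfolding \<delta> of_int_diff of_int_minus using omega_sq by algebra
    then have "\<delta> * omega^2 = of_int (b - l) + of_int (- l) * sqrt_m3" using form[of "b - a + l" "- l"] l by simp
    moreover have "\<delta>^3 = (\<delta> * omega^2)^3" using omega_cube by algebra
    ultimately show ?thesis using that by metis
  qed
qed

text \<open>In the Eisenstein integers \<open>U + V * sqrt_m3\<close> is coprime to its conjugate,
  and their product is \<open>s^3\<close>; so it is a unit times a cube. The oddness of
  \<open>s\<close> reduces the unit to a sign.\<close>

lemma sum_square_3_cube:
  fixes U V s :: int
  assumes eq: "U^2 + 3 * V^2 = s^3" and cop: "coprime U V" and odd: "odd s" and s3: "\<not> 3 dvd s"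
  obtains u v :: int where "U = u^3 - 9 * u * v^2" and "V = 3 * u^2 * v - 3 * v^3"
proof -
  define \<alpha> where "\<alpha> = of_int U + of_int V * sqrt_m3"
  define \<beta> where "\<beta> = of_int U - of_int V * sqrt_m3"
  have E: "\<alpha> \<in> Eis" "\<beta> \<in> Eis" unfolding \<alpha>_def \<beta>_def
    by (intro Eis_add Eis_diff Eis_mult Eis_int Eis_sqrt_m3)+
  have s0: "s \<noteq> 0" using odd by auto
  have \<alpha>\<beta>: "\<alpha> * \<beta> = of_int s ^ 3"
  proof -
    have "\<alpha> * \<beta> = of_int (U^2 + 3 * V^2)"
      unfolding \<alpha>_def \<beta>_def of_int_add of_int_mult of_int_power of_int_numeral using sqrt_m3_sq by algebra
    then show ?thesis unfolding eq by simp
  qed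
  have \<alpha>0: "\<alpha> \<noteq> 0" using \<alpha>\<beta> s0 by auto
  \<comment> \<open>These integers are \<open>\<alpha> + \<beta>\<close>,
    \<open>- sqrt_m3 * (\<alpha> - \<beta>)\<close> and \<open>\<alpha> * \<beta>\<close>, so a
    Bezout relation among them gives one between \<open>\<alpha>\<close> and
    \<open>\<beta>\<close>.\<close>
  have "coprime (gcd (2 * U) (6 * V)) (s^3)"
  proof (rule coprimeI_prime_int)
    fix q :: int
    assume q: "prime q" "q dvd gcd (2 * U) (6 * V)" "q dvd s^3"
    have qs: "q dvd s" using q by (metis prime_dvd_power)
    have "q \<noteq> 2" using qs odd by auto
    then have q2: "\<not> q dvd 2" using q(1) primes_dvd_imp_eq[of q 2] by auto
    have "q \<noteq> 3" using qs s3 by auto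
    then have q3: "\<not> q dvd 3" using q(1) primes_dvd_imp_eq[of q 3] by auto
    have "q dvd 2 * U" "q dvd 2 * (3 * V)" using q(2) by simp_all
    then have "q dvd U" "q dvd V" using q(1) q2 q3 by (meson prime_dvd_multD)+
    then show False using cop q(1) by (meson coprime_common_divisor not_prime_unit)
  qed (use s0 in auto)
  then obtain x k where "x * gcd (2 * U) (6 * V) + k * s^3 = 1"
    by (metis bezout_int coprime_iff_gcd_eq_1)
  moreover obtain i j where "i * (2 * U) + j * (6 * V) = gcd (2 * U) (6 * V)" by (metis bezout_int)
  ultimately have bez_int: "x * i * (2 * U) + x * j * (6 * V) + k * s^3 = 1" by algebra
  have bez: "of_int (x * i) * (2 * of_int U) + of_int (x * j) * (6 * of_int V) + of_int k * of_int s ^ 3 = (1 :: complex)"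
    using arg_cong[OF bez_int, of "of_int :: int \<Rightarrow> complex"] by simp
  define P where "P = of_int (x * i) - of_int (x * j) * sqrt_m3 + of_int k * \<beta>"
  define Q where "Q = of_int (x * i) + of_int (x * j) * sqrt_m3"
  have PQ_E: "P \<in> Eis" "Q \<in> Eis" unfolding P_def Q_def
    using E by (intro Eis_add Eis_diff Eis_mult Eis_int Eis_sqrt_m3; simp)+
  have PQ: "\<alpha> * P + \<beta> * Q = 1"
  proof -
    have "\<alpha> * P + \<beta> * Q = of_int (x * i) * (\<alpha> + \<beta>) - of_int (x * j) * sqrt_m3 * (\<alpha> - \<beta>) + of_int k * (\<alpha> * \<beta>)"
      unfolding P_def Q_def by algebra
    also have "of_int (x * j) * sqrt_m3 * (\<alpha> - \<beta>) = - of_int (x * j) * (6 * of_int V)"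
      unfolding \<alpha>_def \<beta>_def using sqrt_m3_sq by algebra
    also have "\<alpha> + \<beta> = 2 * of_int U" unfolding \<alpha>_def \<beta>_def by simp
    finally show ?thesis using bez unfolding \<alpha>\<beta> by simp
  qed
  obtain a b \<alpha>' s' where ab: "a \<in> Eis" "b \<in> Eis" "\<alpha>' \<in> Eis" "s' \<in> Eis"
    and \<alpha>': "\<alpha> = (\<alpha> * a + of_int s * b) * \<alpha>'" and s': "of_int s = (\<alpha> * a + of_int s * b) * s'"
    using Eis_gcd[OF E(1) \<alpha>0 Eis_int[of s]] by blast
  define \<delta> where "\<delta> = \<alpha> * a + of_int s * b"
  have \<delta>E: "\<delta> \<in> Eis" unfolding \<delta>_def using ab E by (intro Eis_add Eis_mult Eis_int)
  \<comment> \<open>With \<open>\<delta>\<close> the gcd of \<open>\<alpha>\<close> and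
    \<open>s\<close>, each term of \<open>\<delta>^3\<close> contains \<open>\<alpha>\<close>, as
    \<open>s^3 = \<alpha> * \<beta>\<close>. Conversely \<open>\<mu>\<close> witnesses that
    \<open>\<delta>^3\<close> divides \<open>\<alpha>\<close>; so the two are associates.\<close>
  define \<kappa> where "\<kappa> = \<alpha>^2 * a^3 + 3 * \<alpha> * a^2 * of_int s * b + 3 * a * of_int s ^ 2 * b^2 + \<beta> * b^3"
  have \<kappa>E: "\<kappa> \<in> Eis" unfolding \<kappa>_def using ab E Eis_int[of 3]
    by (intro Eis_add Eis_mult Eis_power Eis_int; simp)
  have \<delta>\<kappa>: "\<delta>^3 = \<alpha> * \<kappa>" unfolding \<delta>_def \<kappa>_def using \<alpha>\<beta> by algebra
  define \<mu> where "\<mu> = \<alpha>'^3 * P^2 + s'^3 * (2 * \<alpha> * P * Q + \<beta> * Q^2)"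
  have \<mu>E: "\<mu> \<in> Eis" unfolding \<mu>_def using ab E PQ_E Eis_int[of 2]
    by (intro Eis_add Eis_mult Eis_power; simp)
  have \<alpha>_eq: "\<alpha> = \<delta>^3 * \<mu>"
  proof -
    have "\<alpha> = \<alpha> * (\<alpha> * P + \<beta> * Q)^2" unfolding PQ by simp
    also have "\<dots> = \<alpha>^3 * P^2 + (\<alpha> * \<beta>) * (2 * \<alpha> * P * Q + \<beta> * Q^2)" by algebra
    also have "\<dots> = (\<delta> * \<alpha>')^3 * P^2 + (\<delta> * s')^3 * (2 * \<alpha> * P * Q + \<beta> * Q^2)"
      unfolding \<alpha>\<beta> using \<alpha>' s' unfolding \<delta>_def by metis
    also have "\<dots> = \<delta>^3 * \<mu>" unfolding \<mu>_def by algebra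
    finally show ?thesis .
  qed
  have "\<alpha> * (\<kappa> * \<mu>) = \<alpha> * 1" using \<delta>\<kappa> \<alpha>_eq by (metis mult.assoc mult.right_neutral)
  then have "\<mu> * \<kappa> = 1" using \<alpha>0 by (simp add: mult.commute)
  then have unit: "\<mu> \<in> {1, -1, omega, - omega, omega^2, - (omega^2)}"
    using Eis_unit \<mu>E \<kappa>E by blast
  obtain u v where uv: "\<delta>^3 = (of_int u + of_int v * sqrt_m3)^3" using Eis_cube \<delta>E by blast
  define c d where "c = u^3 - 9 * u * v^2" and "d = 3 * u^2 * v - 3 * v^3"
  have cd: "\<delta>^3 = of_int c + of_int d * sqrt_m3"
    unfolding uv c_def d_def of_int_diff of_int_mult of_int_power of_int_numeral using sqrt_m3_sq by algebra
  have doubles: "2 * omega = sqrt_m3 - 1" "2 * omega^2 = - sqrt_m3 - 1"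
    unfolding omega_sq sqrt_m3_def by simp_all
  \<comment> \<open>For the other four units, \<open>2 * \<mu>\<close> has both components odd.
    Comparing components forces \<open>c + d\<close> to be even, hence
    \<open>c^2 + 3 * d^2 = s^3\<close> to be even.\<close>
  have sgn: "\<mu> = 1 \<or> \<mu> = -1"
  proof (rule ccontr)
    assume "\<not> ?thesis"
    then have "\<mu> = omega \<or> \<mu> = - omega \<or> \<mu> = omega^2 \<or> \<mu> = - (omega^2)" using unit by blast
    then have "\<exists>e1 e2 :: int. e1 \<in> {1, -1} \<and> e2 \<in> {1, -1} \<and> 2 * \<mu> = of_int e1 + of_int e2 * sqrt_m3"
    proof (elim disjE)
      assume "\<mu> = omega" then have "2 * \<mu> = of_int (-1) + of_int (1) * sqrt_m3" using doubles by simp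
      then show ?thesis by blast
    next
      assume "\<mu> = - omega" then have "2 * \<mu> = of_int (1) + of_int (-1) * sqrt_m3" using doubles by simp
      then show ?thesis by blast
    next
      assume "\<mu> = omega^2" then have "2 * \<mu> = of_int (-1) + of_int (-1) * sqrt_m3" using doubles by simp
      then show ?thesis by blast
    next
      assume "\<mu> = - (omega^2)" then have "2 * \<mu> = of_int (1) + of_int (1) * sqrt_m3" using doubles by simp
      then show ?thesis by blast
    qed
    then obtain e1 e2 :: int where e: "e1 \<in> {1, -1}" "e2 \<in> {1, -1}" "2 * \<mu> = of_int e1 + of_int e2 * sqrt_m3"
      by blast
    have "of_int (2 * U) + of_int (2 * V) * sqrt_m3 = \<delta>^3 * (2 * \<mu>)"
      using \<alpha>_eq unfolding \<alpha>_def of_int_mult of_int_numeral by algebra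
    also have "\<dots> = of_int (e1 * c - 3 * e2 * d) + of_int (e1 * d + e2 * c) * sqrt_m3"
      unfolding e(3) cd of_int_diff of_int_add of_int_mult of_int_numeral using sqrt_m3_sq by algebra
    finally have comp: "2 * U = e1 * c - 3 * e2 * d \<and> 2 * V = e1 * d + e2 * c" by (rule sqrt_m3_components)
    then have "even (e1 * d + e2 * c)" by (metis dvd_triv_left)
    then have ev: "even (c + d)" using e(1,2) by auto
    have "e1^2 = 1" "e2^2 = 1" using e(1,2) by auto
    moreover have "4 * (U^2 + 3 * V^2) = (2 * U)^2 + 3 * (2 * V)^2" by algebra
    ultimately have "4 * (U^2 + 3 * V^2) = 4 * (c^2 + 3 * d^2)" using comp by algebra
    then have "c^2 + 3 * d^2 = s^3" using eq by simp
    moreover have "even (c^2 + 3 * d^2)" using ev by auto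
    ultimately show False using odd by simp
  qed
  then show ?thesis
  proof
    assume "\<mu> = 1"
    then have "of_int U + of_int V * sqrt_m3 = of_int c + of_int d * sqrt_m3"
      using \<alpha>_eq unfolding \<alpha>_def cd by simp
    then have "U = c \<and> V = d" by (rule sqrt_m3_components)
    then show ?thesis using that[of u v] unfolding c_def d_def by simp
  next
    assume "\<mu> = -1"
    then have "of_int U + of_int V * sqrt_m3 = of_int (- c) + of_int (- d) * sqrt_m3"
      using \<alpha>_eq unfolding \<alpha>_def cd by simp
    then have "U = - c \<and> V = - d" by (rule sqrt_m3_components)
    then show ?thesis using that[of "- u" "- v"] unfolding c_def d_def by (simp add: power3_eq_cube)
  qed
qed

section \<open>Rational points on the elliptic curve\<close>

lemma difference_of_squares_square:
  fixes u v y :: int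
  assumes eq: "v^2 - u^2 = 4 * y^2" and par: "even (v - u)" and v: "v \<ge> 0"
    and cop: "coprime ((v - u) div 2) ((v + u) div 2)"
  obtains P Q where "v = P^2 + Q^2" "u = P^2 - Q^2" "y = P * Q"
proof -
  obtain k where k: "v - u = 2 * k" using par ..
  define l where "l = k + u"
  have kl: "v = l + k" "u = l - k" using k unfolding l_def by auto
  have lk: "l * k = y^2" using eq unfolding kl by algebra
  have "l \<ge> 0 \<and> k \<ge> 0"
  proof -
    have "0 \<le> l * k" using lk by simp
    then have "(0 \<le> l \<and> 0 \<le> k) \<or> (l \<le> 0 \<and> k \<le> 0)" by (simp add: zero_le_mult_iff)
    then show ?thesis using v unfolding kl by auto
  qed
  moreover have "coprime l k" using cop unfolding kl by (simp add: coprime_commute)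
  ultimately obtain P Q where PQ: "l = P^2" "k = Q^2" using coprime_mult_square_int lk by blast
  have "y^2 = (P * Q)^2" using lk unfolding PQ by (simp add: power_mult_distrib)
  then have "y = P * Q \<or> y = P * (- Q)" by (simp add: power2_eq_iff)
  moreover have "v = P^2 + (- Q)^2" "u = P^2 - (- Q)^2" "v = P^2 + Q^2" "u = P^2 - Q^2"
    unfolding kl PQ by simp_all
  ultimately show ?thesis using that by blast
qed

lemma coprime_halves:
  fixes u v y :: int
  assumes eq: "v^2 - u^2 = 4 * y^2" and par: "even (v - u)"
    and "\<And>q. prime q \<Longrightarrow> q dvd u \<Longrightarrow> q dvd v \<Longrightarrow> q dvd y \<Longrightarrow> False" and "y \<noteq> 0"
  shows "coprime ((v - u) div 2) ((v + u) div 2)"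
proof -
  obtain k where k: "v - u = 2 * k" using par ..
  define l where "l = k + u"
  have kl: "v = l + k" "u = l - k" using k unfolding l_def by auto
  have lk: "l * k = y^2" using eq unfolding kl by algebra
  have "coprime k l"
  proof (rule coprimeI_prime_int)
    show "k \<noteq> 0 \<or> l \<noteq> 0" using lk \<open>y \<noteq> 0\<close> by auto
    fix q :: int assume q: "prime q" "q dvd k" "q dvd l"
    then have "q dvd y^2" using lk by (metis dvd_mult2)
    then have "q dvd y" using q(1) by (metis prime_dvd_power)
    then show False using assms(3) q unfolding kl by (metis dvd_add dvd_diff)
  qed
  then show ?thesis unfolding kl by simp
qed

lemma sum_squares_mod_3:
  fixes a d :: int
  assumes "3 dvd a^2 + d^2"
  shows "3 dvd a \<and> 3 dvd d"
proof -
  have "a mod 3 \<in> {0,1,2}" "d mod 3 \<in> {0,1,2}" by auto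
  moreover have "((a mod 3)^2 + (d mod 3)^2) mod 3 = 0"
    using assms by (simp add: dvd_eq_mod_eq_0 power_mod flip: mod_add_eq[of "a^2"] mod_add_eq[of "(a mod 3)^2"])
  ultimately have "a mod 3 = 0 \<and> d mod 3 = 0" by auto
  then show ?thesis by (simp add: dvd_eq_mod_eq_0)
qed

text \<open>The two sums are \<open>b^2 * t\<close> and \<open>c^2 * t\<close> with a common
  \<open>t > 0\<close>. Eliminating shows that \<open>t\<close> divides \<open>3 * a^2\<close> and
  \<open>3 * d^2\<close>, hence 3; \<open>t = 3\<close> would force 3 to divide both
  \<open>a\<close> and \<open>d\<close>.\<close>

lemma coprime_square_ratio:
  fixes a b c d :: int
  assumes eq: "b^2 * (4 * a^2 + d^2) = c^2 * (a^2 + d^2)" and bc: "coprime b c" and ad: "coprime a d"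
    and b: "b \<noteq> 0"
  shows "a^2 + d^2 = b^2" "4 * a^2 + d^2 = c^2"
proof -
  have "b^2 dvd c^2 * (a^2 + d^2)" using eq by (metis dvd_triv_left)
  then have "b^2 dvd a^2 + d^2" using bc by (simp add: coprime_dvd_mult_right_iff)
  then obtain t where t: "a^2 + d^2 = b^2 * t" ..
  have t': "4 * a^2 + d^2 = c^2 * t"
  proof -
    have "b^2 * (4 * a^2 + d^2) = b^2 * (c^2 * t)" unfolding eq t by algebra
    then show ?thesis using b by simp
  qed
  have "3 * a^2 = (c^2 - b^2) * t" "3 * d^2 = (4 * b^2 - c^2) * t" using t t' by algebra+
  then have "t dvd 3 * a^2" "t dvd 3 * d^2" by simp_all
  then have "t dvd gcd (3 * a^2) (3 * d^2)" by simp
  also have "gcd (3 * a^2) (3 * d^2) = 3 * gcd (a^2) (d^2)" by (simp add: gcd_mult_distrib_int[symmetric])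
  also have "gcd (a^2) (d^2) = 1" using ad by (simp add: coprime_iff_gcd_eq_1[symmetric])
  finally have "t dvd 3" by simp
  moreover have "t > 0"
  proof -
    have "a \<noteq> 0 \<or> d \<noteq> 0" using ad by auto
    then have "a^2 + d^2 > 0" by (auto simp: sum_power2_gt_zero_iff)
    then show ?thesis unfolding t using b by (simp add: zero_less_mult_iff)
  qed
  moreover have "t \<noteq> 3"
  proof
    assume "t = 3"
    then have "3 dvd a \<and> 3 dvd d" using sum_squares_mod_3 t by (metis dvd_triv_right)
    then show False using ad by (metis coprime_common_divisor_int abs_numeral numeral_eq_one_iff semiring_norm(86))
  qed
  ultimately have "t = 1"
  proof -
    assume h: "t dvd 3" "t > 0" "t \<noteq> 3"
    have "t \<le> 3" using h by (simp add: zdvd_imp_le)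
    moreover have "t \<noteq> 2" using h(1) by auto
    ultimately show ?thesis using h by linarith
  qed
  then show "a^2 + d^2 = b^2" "4 * a^2 + d^2 = c^2" using t t' by simp_all
qed

lemma four_number:
  fixes p q m n :: int
  assumes eq: "p * q = m * n" and p: "p \<noteq> 0"
  obtains a b c d where "p = a * b" "m = a * c" "q = c * d" "n = b * d" "coprime b c"
proof -
  define a where "a = gcd p m"
  have a0: "a \<noteq> 0" using p unfolding a_def by simp
  obtain b c where bc: "p = a * b" "m = a * c" "coprime b c"
    using gcd_coprime_exists[of p m] p unfolding a_def by (metis gcd_eq_0_iff mult.commute)
  have "a * (b * q) = a * (c * n)" using eq unfolding bc by (simp add: mult_ac)
  then have e: "b * q = c * n" using a0 by simp
  then have "c dvd b * q" by simp
  then have "c dvd q" using bc(3) by (simp add: coprime_dvd_mult_right_iff coprime_commute)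
  then obtain d where d: "q = c * d" ..
  show ?thesis
  proof (cases "c = 0")
    \<comment> \<open>Here \<open>q = 0\<close> leaves \<open>d\<close> undetermined; as
      \<open>b\<close> is 1 or -1, \<open>d = b * n\<close> satisfies
      \<open>n = b * d\<close>.\<close>
    case True
    then have "\<bar>b\<bar> = 1" using bc(3) by simp
    moreover have "q = 0" using d True by simp
    ultimately have "n = b * (b * n)" by (metis abs_mult_self_eq mult.assoc mult_1)
    then show ?thesis using that[of a b c "b * n"] bc d True by simp
  next
    case False
    have "c * n = c * (b * d)" using e unfolding d by algebra
    then have "n = b * d" using False by simp
    then show ?thesis using that bc d by blast
  qed
qed

text \<open>Descent on \<open>\<bar>x\<bar>\<close> with \<open>p = 2 * p1\<close>. From
  \<open>x^2 - (p^2 - q^2)^2 = 4 * (p1 * q)^2\<close> come \<open>m\<close>, \<open>n\<close> with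
  \<open>p1 * q = m * n\<close>. Refining both factorizations gives \<open>a^2 + d^2 = b^2\<close>
  and \<open>c^2 - d^2 = 4 * a^2\<close>; the latter yields \<open>a = P * Q\<close> and
  \<open>\<bar>d\<bar> = P^2 - Q^2\<close>, so \<open>P\<close>, \<open>Q\<close> solve the quartic
  with the smaller root \<open>b\<close>.\<close>

lemma quartic_even_no_solution:
  fixes p q x :: int
  assumes "p^4 - p^2 * q^2 + q^4 = x^2" and "coprime p q" and "even (p * q)"
  shows "p * q = 0"
proof -
  have "p * q = 0" if "nat \<bar>x\<bar> = k" "p^4 - p^2 * q^2 + q^4 = x^2" "coprime p q" "even p" for k and p q x :: int
    using that
  proof (induction k arbitrary: p q x rule: less_induct)
    case (less k p q x)
    show ?case
    proof (rule ccontr)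
      assume "p * q \<noteq> 0"
      then have p0: "p \<noteq> 0" and q0: "q \<noteq> 0" by auto
      have oq: "odd q" using less.prems(3,4) by (metis coprime_common_divisor odd_one)
      obtain p1 where p1: "p = 2 * p1" using less.prems(4) ..
      define v where "v = \<bar>x\<bar>"
      have v: "v^2 = p^4 - p^2 * q^2 + q^4" "v \<ge> 0" unfolding v_def using less.prems(2) by simp_all
      define u where "u = p^2 - q^2"
      have eq: "v^2 - u^2 = 4 * (p1 * q)^2" unfolding v(1) u_def p1 by algebra
      have odd_u: "odd u" unfolding u_def p1 using oq by simp
      have "odd (v^2)" unfolding v(1) p1 using oq by simp
      then have par: "even (v - u)" using odd_u by simp
      have cop: "coprime ((v - u) div 2) ((v + u) div 2)"
      proof (rule coprime_halves[OF eq par])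
        fix r :: int assume r: "prime r" "r dvd u" "r dvd p1 * q"
        have "r dvd p \<or> r dvd q" using r(1,3) unfolding p1 by (metis dvd_mult prime_dvd_mult_iff)
        then have "r dvd p^2 \<and> r dvd q^2"
        proof
          assume "r dvd p"
          then have "r dvd p^2" by (simp add: power2_eq_square)
          moreover have "q^2 = p^2 - u" unfolding u_def by simp
          ultimately show ?thesis using r(2) by (metis dvd_diff)
        next
          assume "r dvd q"
          then have "r dvd q^2" by (simp add: power2_eq_square)
          moreover have "p^2 = u + q^2" unfolding u_def by simp
          ultimately show ?thesis using r(2) by (metis dvd_add)
        qed
        then have "r dvd p" "r dvd q" using r(1) by (metis prime_dvd_power)+
        then show False using less.prems(3) r(1) by (meson coprime_common_divisor not_prime_unit)
      qed (use p0 q0 p1 in auto)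
      obtain m n where mn: "v = m^2 + n^2" "u = m^2 - n^2" "p1 * q = m * n"
        using difference_of_squares_square[OF eq par v(2) cop] by blast
      obtain a b c d where abcd: "p1 = a * b" "m = a * c" "q = c * d" "n = b * d" and bc: "coprime b c"
        using four_number[OF mn(3)] p0 p1 by (metis mult_zero_right)
      have nz: "a \<noteq> 0" "b \<noteq> 0" "c \<noteq> 0" "d \<noteq> 0" using p0 q0 unfolding p1 abcd by auto
      have ad: "coprime a d" using less.prems(3) unfolding p1 abcd by simp
      have "b^2 * (4 * a^2 + d^2) = c^2 * (a^2 + d^2)"
        using mn(2) unfolding u_def p1 abcd by algebra
      note sq = coprime_square_ratio[OF this bc ad nz(2)]
      have odd: "odd c" "odd d" using oq unfolding abcd by simp_all
      define c' d' where "c' = \<bar>c\<bar>" and "d' = \<bar>d\<bar>"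
      have eq': "c'^2 - d'^2 = 4 * a^2" unfolding c'_def d'_def using sq(2) by simp
      have par': "even (c' - d')" unfolding c'_def d'_def using odd by simp
      have cop': "coprime ((c' - d') div 2) ((c' + d') div 2)"
      proof (rule coprime_halves[OF eq' par'])
        fix r :: int assume "prime r" "r dvd d'" "r dvd a"
        then show False using ad unfolding d'_def by (metis coprime_common_divisor dvd_abs_iff not_prime_unit)
      qed (use nz in auto)
      obtain P Q where PQ: "c' = P^2 + Q^2" "d' = P^2 - Q^2" "a = P * Q"
        using difference_of_squares_square[OF eq' par' _ cop'] unfolding c'_def by auto
      have new: "P^4 - P^2 * Q^2 + Q^4 = b^2"
      proof -
        have "b^2 = a^2 + d'^2" using sq(1) unfolding d'_def by simp
        then show ?thesis unfolding PQ(2,3) by algebra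
      qed
      have "odd d'" unfolding d'_def using odd by simp
      then have par_PQ: "even P \<or> even Q" unfolding PQ(2) by auto
      have copPQ: "coprime P Q"
      proof (rule coprimeI_prime_int)
        show "P \<noteq> 0 \<or> Q \<noteq> 0" using PQ(3) nz by auto
        fix r assume "prime r" "r dvd P" "r dvd Q"
        then have "r dvd a" "r dvd d'" unfolding PQ by (simp_all add: power2_eq_square)
        then show False using ad \<open>prime r\<close> unfolding d'_def by (metis coprime_common_divisor dvd_abs_iff not_prime_unit)
      qed
      have "\<bar>b\<bar> < v"
      proof -
        have "0 < (a * c)^2" "0 < d^2" using nz by simp_all
        then have pos: "0 < (a * c)^2" "1 \<le> d^2" by linarith+
        have "\<bar>b\<bar> * 1 \<le> \<bar>b\<bar> * \<bar>b\<bar>" using nz by (intro mult_left_mono) auto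
        also have "\<dots> = b^2 * 1" by (simp add: power2_eq_square)
        also have "\<dots> \<le> b^2 * d^2" using pos(2) by (intro mult_left_mono) auto
        finally show ?thesis using pos(1) unfolding mn(1) abcd power_mult_distrib by simp
      qed
      then have "nat \<bar>b\<bar> < k" using less.prems(1) unfolding v_def by linarith
      then have "P * Q = 0"
        using less.IH[of "nat \<bar>b\<bar>" b P Q] less.IH[of "nat \<bar>b\<bar>" b Q P] new copPQ par_PQ
        by (auto simp: coprime_commute algebra_simps)
      then show False using PQ(3) nz by simp
    qed
  qed
  from this[OF refl, of p q x] this[OF refl, of q p x] show ?thesis
    using assms by (auto simp: coprime_commute algebra_simps)
qed

lemma pythagorean_odd_leg:
  fixes X Y Z :: int
  assumes eq: "X^2 + (2 * Y)^2 = Z^2" and "odd X" and cop: "coprime X Y" and "Y \<noteq> 0" and "Z \<ge> 0"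
  obtains m n where "Z = m^2 + n^2" "X = m^2 - n^2" "Y = m * n"
proof -
  have eq': "Z^2 - X^2 = 4 * Y^2" using eq by algebra
  have "odd (Z^2)" unfolding eq[symmetric] using \<open>odd X\<close> by simp
  then have par: "even (Z - X)" using \<open>odd X\<close> by simp
  have "coprime ((Z - X) div 2) ((Z + X) div 2)"
    by (rule coprime_halves[OF eq' par])
       (use cop \<open>Y \<noteq> 0\<close> in \<open>meson coprime_common_divisor not_prime_unit\<close>)+
  from difference_of_squares_square[OF eq' par \<open>Z \<ge> 0\<close> this] show ?thesis using that by blast
qed

text \<open>Both parities of \<open>Y\<close> lead to the quartic. For even \<open>Y\<close>,
  factoring \<open>v^2 - u^2 = 4 * Y^2\<close> parametrizes \<open>X^2 = u^2 + Y^2\<close>; for odd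
  \<open>Y\<close>, \<open>u\<close> and \<open>v\<close> are even and the Pythagorean triple
  \<open>Y\<close>, \<open>u\<close>, \<open>\<bar>X\<bar>\<close> is parametrized instead.\<close>

lemma concordant_form:
  fixes X Y u v :: int
  assumes u: "X^2 - Y^2 = u^2" and v: "X^2 + 3 * Y^2 = v^2" and cop: "coprime X Y"
  shows "Y = 0 \<or> u = 0"
proof (rule ccontr)
  assume "\<not> ?thesis"
  then have Y0: "Y \<noteq> 0" and u0: "u \<noteq> 0" by auto
  have eq: "\<bar>v\<bar>^2 - u^2 = 4 * Y^2" using u v by simp
  \<comment> \<open>Otherwise \<open>Y\<close> and \<open>u\<close> are odd, and
    \<open>X^2 = u^2 + Y^2\<close> would be 2 modulo 4.\<close>
  have oX: "odd X"
  proof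
    assume "even X"
    then have "odd Y" using cop by (metis coprime_common_divisor odd_one)
    then have "odd (u^2)" unfolding u[symmetric] using \<open>even X\<close> by simp
    then have "odd u" by simp
    obtain x y w where "X = 2 * x" "Y = 2 * y + 1" "u = 2 * w + 1"
      using \<open>even X\<close> \<open>odd Y\<close> \<open>odd u\<close> by (auto elim!: evenE oddE)
    then have "4 * (x^2 - y^2 - y - w^2 - w) = 2" using u by (simp add: power2_eq_square algebra_simps)
    then show False by presburger
  qed
  have uv: "\<And>q. prime q \<Longrightarrow> q dvd u \<Longrightarrow> q dvd Y \<Longrightarrow> False"
  proof -
    fix q :: int assume q: "prime q" "q dvd u" "q dvd Y"
    have "X^2 = u^2 + Y^2" using u by simp
    then have "q dvd X^2" using q by (simp add: power2_eq_square)
    then have "q dvd X" using q(1) by (metis prime_dvd_power)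
    then show False using cop q by (meson coprime_common_divisor not_prime_unit)
  qed
  show False
  proof (cases "even Y")
    case True
    have "odd (u^2)" "odd (\<bar>v\<bar>^2)" unfolding u[symmetric] power2_abs v[symmetric] using oX True by simp_all
    then have par: "even (\<bar>v\<bar> - u)" by simp
    have "coprime ((\<bar>v\<bar> - u) div 2) ((\<bar>v\<bar> + u) div 2)"
      by (rule coprime_halves[OF eq par]) (use uv Y0 in auto)
    then obtain P Q where PQ: "\<bar>v\<bar> = P^2 + Q^2" "u = P^2 - Q^2" "Y = P * Q"
      using difference_of_squares_square[OF eq par abs_ge_zero] by blast
    have "coprime P Q"
    proof (rule coprimeI_prime_int)
      show "P \<noteq> 0 \<or> Q \<noteq> 0" using PQ(3) Y0 by auto
      fix r assume "prime r" "r dvd P" "r dvd Q"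
      then show False using uv[of r] unfolding PQ by (simp add: power2_eq_square)
    qed
    moreover have "P^4 - P^2 * Q^2 + Q^4 = X^2"
    proof -
      have "X^2 = u^2 + Y^2" using u by simp
      then show ?thesis unfolding PQ by algebra
    qed
    ultimately have "P * Q = 0" using quartic_even_no_solution True PQ(3) by blast
    then show False using PQ(3) Y0 by simp
  next
    case oY: False
    have "even (u^2)" "even (v^2)" unfolding u[symmetric] v[symmetric] using oX oY by simp_all
    then have "even u" "even v" by simp_all
    then obtain w where w: "u = 2 * w" by blast
    have w0: "w \<noteq> 0" using u0 w by simp
    have "Y^2 + (2 * w)^2 = \<bar>X\<bar>^2" using u unfolding w by simp
    moreover have "coprime Y w"
    proof (rule coprimeI_prime_int)
      fix q :: int assume "prime q" "q dvd Y" "q dvd w"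
      then show False using uv[of q] unfolding w by simp
    qed (use w0 in auto)
    ultimately obtain m n where mn: "\<bar>X\<bar> = m^2 + n^2" "Y = m^2 - n^2" "w = m * n"
      using pythagorean_odd_leg[of Y w "\<bar>X\<bar>"] oY w0 by auto
    obtain z where z: "v = 2 * z" using \<open>even v\<close> ..
    have "4 * (m^4 - m^2 * n^2 + n^4) = 4 * z^2"
    proof -
      have "4 * z^2 = \<bar>X\<bar>^2 + 3 * Y^2" using v z by simp
      then show ?thesis unfolding mn by algebra
    qed
    then have "m^4 - m^2 * n^2 + n^4 = z^2" by simp
    moreover have "coprime m n"
    proof (rule coprimeI_prime_int)
      show "m \<noteq> 0 \<or> n \<noteq> 0" using mn(3) w0 by auto
      fix r assume r: "prime r" "r dvd m" "r dvd n"
      then have "r dvd Y" "r dvd w" unfolding mn by (simp_all add: power2_eq_square)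
      then show False using uv[of r] r unfolding w by simp
    qed
    moreover have "even (m * n)" using oY unfolding mn(2) by auto
    ultimately have "m * n = 0" using quartic_even_no_solution by blast
    then show False using mn(3) w0 by simp
  qed
qed

text \<open>The double of a point with \<open>y\<close> nonzero has an abscissa
  \<open>\<alpha>^2\<close> for which \<open>\<alpha>^2 - 1\<close> and
  \<open>\<alpha>^2 + 3\<close> are squares too. Clearing denominators,
  \<open>concordant_form\<close> leaves only \<open>\<beta> = 0\<close>.\<close>

lemma elliptic_rational_points:
  fixes x y :: rat
  assumes eq: "y^2 = x * (x - 1) * (x + 3)"
  shows "x \<in> {0, 1, -3, 3, -1}"
proof (cases "y = 0")
  case True
  then show ?thesis using eq by auto
next
  case False
  define \<alpha> \<beta> \<delta> where "\<alpha> = (x^2 + 3) / (2 * y)" and "\<beta> = (x^2 - 2 * x - 3) / (2 * y)"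
    and "\<delta> = (x^2 + 6 * x - 3) / (2 * y)"
  have y2: "(2 * y)^2 = 4 * (x * (x - 1) * (x + 3))" using eq by (simp add: power_mult_distrib)
  have ne: "4 * (x * (x - 1) * (x + 3)) \<noteq> 0" using False eq by auto
  have \<beta>: "\<alpha>^2 - 1 = \<beta>^2" and \<delta>: "\<alpha>^2 + 3 = \<delta>^2"
    unfolding \<alpha>_def \<beta>_def \<delta>_def power_divide y2 using ne
    by (simp_all add: divide_simps) (algebra+)
  obtain X Y where XY: "quotient_of \<alpha> = (X, Y)" by (cases "quotient_of \<alpha>")
  have Y: "Y > 0" and cop: "coprime X Y" and \<alpha>: "\<alpha> = of_int X / of_int Y"
    using quotient_of_denom_pos[OF XY] quotient_of_coprime[OF XY] quotient_of_div[OF XY] by auto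
  have "(\<beta> * of_int Y)^2 = of_int (X^2 - Y^2)"
    unfolding power_mult_distrib \<beta>[symmetric] \<alpha> using Y by (simp add: power_divide field_simps)
  then obtain u where u: "\<beta> * of_int Y = of_int u" by (rule rat_square_int)
  have "(\<delta> * of_int Y)^2 = of_int (X^2 + 3 * Y^2)"
    unfolding power_mult_distrib \<delta>[symmetric] \<alpha> using Y by (simp add: power_divide field_simps)
  then obtain v where v: "\<delta> * of_int Y = of_int v" by (rule rat_square_int)
  have "of_int (X^2 - Y^2) = (of_int (u^2) :: rat)"
    using \<open>(\<beta> * of_int Y)^2 = of_int (X^2 - Y^2)\<close> unfolding u by simp
  then have "X^2 - Y^2 = u^2" by (simp only: of_int_eq_iff)
  moreover have "of_int (X^2 + 3 * Y^2) = (of_int (v^2) :: rat)"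
    using \<open>(\<delta> * of_int Y)^2 = of_int (X^2 + 3 * Y^2)\<close> unfolding v by simp
  then have "X^2 + 3 * Y^2 = v^2" by (simp only: of_int_eq_iff)
  ultimately have "u = 0" using concordant_form cop Y by fastforce
  then have "\<beta> = 0" using u Y by simp
  then have "(x - 3) * (x + 1) = 0" using False unfolding \<beta>_def by (simp add: algebra_simps power2_eq_square)
  then show ?thesis by (auto simp: eq_neg_iff_add_eq_0)
qed

section \<open>The cubic attached to a point\<close>

lemma cube_of_multiplicities:
  fixes A :: int
  assumes "\<And>p. prime p \<Longrightarrow> 3 dvd multiplicity p A"
  obtains t where "A = t^3"
proof -
  have "is_nth_power 3 (normalize A)" by (subst is_nth_power_conv_multiplicity) (use assms in auto)
  then obtain s where s: "\<bar>A\<bar> = s^3" by (auto elim!: is_nth_powerE)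
  have "A = s^3 \<or> A = (- s)^3" using s by (auto simp: abs_if split: if_splits)
  then show ?thesis using that by blast
qed

text \<open>The third power of the Lagrange resolvent is \<open>- 8 (U - V \<surd>-3) / A\<^sup>2\<close> up to conjugation; if it is
  a cube in \<open>\<rat>(\<omega>)\<close>, then the cubic has a rational root.\<close>
lemma root_of_cube:
  fixes A B C t :: int
  assumes P: "curve_eq A B C" and cop: "coprime A B" and dv: "2 dvd B" "3 dvd B" "19 dvd B" and B0: "B \<noteq> 0"
    and t: "A = t^3"
  obtains r :: rat where
    "of_int A ^ 2 * r^3 + of_int A ^ 2 * r^2
      - (3 * of_int A ^ 2 + 2 * of_int A * of_int (8 * B^2 - A)) * r - of_int (8 * B^2 - A) ^ 2 = 0"
proof -
  define U V s where "U = A^2 - 36 * A * B^2 + 108 * B^4" and "V = 6 * B * C" and "s = t * (A + 12 * B^2)"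
  have common: "r dvd A \<Longrightarrow> r dvd B \<Longrightarrow> prime r \<Longrightarrow> False" for r
    using cop by (meson coprime_common_divisor not_prime_unit)
  have nA: "\<not> 2 dvd A" "\<not> 3 dvd A" "\<not> 19 dvd A" using common[of 2] common[of 3] common[of 19] dv by auto
  have A0: "A \<noteq> 0" using nA by auto
  have UV: "U^2 + 3 * V^2 = A * (A + 12 * B^2)^3"
    using P unfolding curve_eq_def U_def V_def by algebra
  then have UVs: "U^2 + 3 * V^2 = s^3" unfolding s_def t by algebra
  have B2: "2 dvd B^2" "3 dvd B^2" "19 dvd B^2" using dv by (simp_all add: power2_eq_square)
  have sum: "\<not> q dvd A + 12 * B^2" if "q dvd B^2" "\<not> q dvd A" for q
    using that by (simp add: dvd_add_left_iff)
  have "odd s" "\<not> 3 dvd s"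
  proof -
    have "\<not> 2 dvd t" "\<not> 3 dvd t" using nA unfolding t by (auto simp: power3_eq_cube)
    moreover have "\<not> 2 dvd A + 12 * B^2" "\<not> 3 dvd A + 12 * B^2" using sum B2 nA by blast+
    ultimately show "odd s" "\<not> 3 dvd s" unfolding s_def by (simp_all add: prime_dvd_mult_iff)
  qed
  moreover have "coprime U V"
  proof (rule coprimeI_prime_int)
    have "s \<noteq> 0" using \<open>odd s\<close> by auto
    then show "U \<noteq> 0 \<or> V \<noteq> 0" using UVs by auto
    fix q assume q: "prime q" "q dvd U" "q dvd V"
    have qB: "\<not> q dvd B"
    proof
      assume "q dvd B"
      moreover have "A^2 = U + B * (36 * A * B - 108 * B^3)" unfolding U_def by algebra
      ultimately have "q dvd A^2" using q(2) by simp
      then show False using common \<open>q dvd B\<close> q(1) by (metis prime_dvd_power)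
    qed
    have "q dvd A * (A + 12 * B^2)^3" using q unfolding UV[symmetric] by (simp add: power2_eq_square)
    then have "q dvd A \<or> q dvd A + 12 * B^2" using q(1) by (metis prime_dvd_mult_iff prime_dvd_power)
    \<comment> \<open>\<open>U\<close> is \<open>108 * B^4\<close> modulo \<open>A\<close> and
      \<open>684 * B^4\<close> modulo \<open>A + 12 * B^2\<close>; the constant is the least common
      multiple of 108 and 684. This is why 19 has to divide \<open>B\<close>.\<close>
    then have "q dvd 2^2 * 3^3 * 19 * B^4"
    proof
      assume "q dvd A"
      moreover have "19 * U = A * (19 * A - 684 * B^2) + 2^2 * 3^3 * 19 * B^4" unfolding U_def by algebra
      ultimately show ?thesis using q(2) by (metis dvd_add_right_iff dvd_mult dvd_mult2)
    next
      assume "q dvd A + 12 * B^2"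
      moreover have "3 * U = (A + 12 * B^2) * (3 * A - 144 * B^2) + 2^2 * 3^3 * 19 * B^4" unfolding U_def by algebra
      ultimately show ?thesis using q(2) by (metis dvd_add_right_iff dvd_mult dvd_mult2)
    qed
    then have "q dvd 2 \<or> q dvd 3 \<or> q dvd 19" using qB q(1) by (metis prime_dvd_mult_iff prime_dvd_power)
    then show False using dv qB by (meson dvd_trans)
  qed
  ultimately obtain u v where uv: "U = u^3 - 9 * u * v^2" "V = 3 * u^2 * v - 3 * v^3"
    using sum_square_3_cube[OF UVs] by blast
  have s: "s = u^2 + 3 * v^2"
  proof (rule power_eq_imp_eq_base)
    show "s^3 = (u^2 + 3 * v^2)^3" unfolding UVs[symmetric] uv by algebra
    have "0 \<le> s^3" unfolding UVs[symmetric] by simp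
    then show "0 \<le> s" by (simp add: zero_le_power_eq)
  qed auto
  \<comment> \<open>From \<open>3 * v^2 = s - u^2\<close> follows the triple-angle form
    \<open>U = 4 * u^3 - 3 * u * s\<close>, here multiplied by 16.\<close>
  have key: "64 * u^3 - 48 * u * s - 16 * U = 0" unfolding s uv by algebra
  \<comment> \<open>The shift \<open>3 * r + 1 = \<zeta>\<close> removes the quadratic term of the
    cubic; after scaling by \<open>t^2\<close> the depressed cubic is exactly
    \<open>key\<close>.\<close>
  define \<zeta> where "\<zeta> = 4 * of_int u / (of_int t ^ 2 :: rat)"
  define r where "r = (\<zeta> - 1) / 3"
  have t0: "(of_int t :: rat) \<noteq> 0" using A0 t by auto
  have \<zeta>: "\<zeta> * of_int t ^ 2 = 4 * of_int u" unfolding \<zeta>_def using t0 by simp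
  define a b T where "a = (of_int A :: rat)" and "b = (of_int B :: rat)" and "T = (of_int t :: rat)"
  have aT: "a = T^3" unfolding a_def T_def t by simp
  have key': "64 * of_int u ^ 3 - 48 * of_int u * (T * (a + 12 * b^2)) - 16 * (a^2 - 36 * a * b^2 + 108 * b^4) = 0"
    using arg_cong[OF key, of "of_int :: int \<Rightarrow> rat"] unfolding s_def U_def a_def b_def T_def by simp
  have "27 * (a^2 * r^3 + a^2 * r^2 - (3 * a^2 + 2 * a * (8 * b^2 - a)) * r - (8 * b^2 - a)^2) =
      a^2 * \<zeta>^3 - (12 * a^2 + 144 * a * b^2) * \<zeta> - 16 * (a^2 - 36 * a * b^2 + 108 * b^4)"
  proof -
    have "3 * r = \<zeta> - 1" unfolding r_def by simp
    then show ?thesis by algebra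
  qed
  also have "\<dots> = (\<zeta> * T^2)^3 - 12 * (\<zeta> * T^2) * (T * (a + 12 * b^2)) - 16 * (a^2 - 36 * a * b^2 + 108 * b^4)"
    unfolding aT by algebra
  also have "\<dots> = 0" using key' unfolding \<zeta>[folded T_def] by (simp add: power_mult_distrib)
  finally have "a^2 * r^3 + a^2 * r^2 - (3 * a^2 + 2 * a * (8 * b^2 - a)) * r - (8 * b^2 - a)^2 = 0" by simp
  then show ?thesis using that[of r] unfolding a_def b_def by simp
qed

section \<open>The cubic field of a point of \<open>D\<close> near the origin\<close>

locale near_point =
  fixes A B C :: int
  assumes curve: "curve_eq A B C" and cop: "coprime A B" and B0: "B \<noteq> 0"
    and dvds: "2 dvd B" "3 dvd B" "19 dvd B"
begin

definition N :: int where "N = 8 * B^2 - A"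
definition n :: rat where "n = of_int N / of_int A"

lemma odd_A: "odd A"
  using cop dvds(1) by (metis coprime_common_divisor odd_one)

lemma A0: "A \<noteq> 0"
  using odd_A by auto

lemma nA: "n * of_int A = of_int N"
  unfolding n_def using A0 by simp

text \<open>These are the values of \<open>n\<close> for which \<open>y = x + n\<close> passes
  through an affine rational point of \<open>E\<close>. They would make
  \<open>n + 1 = 8 * B^2 / A\<close> one of 1, 0, 4, -8, whereas 32 divides \<open>8 * B^2\<close>
  and \<open>A\<close> is odd.\<close>

lemma n_not_special: "n \<notin> {0, -1, 3, -9}"
proof
  assume "n \<in> {0, -1, 3, -9}"
  then have "\<exists>m \<in> {1, 0, 4, -8}. n + 1 = of_int m" by auto
  then obtain m where m: "m \<in> {1, 0, 4, -8}" "n + 1 = of_int m" by blast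
  have "of_int (m * A) = (n * of_int A + of_int A)" using m(2) by (simp add: algebra_simps flip: m(2))
  then have "of_int (m * A) = (of_int (8 * B^2) :: rat)" unfolding nA N_def by simp
  then have mA: "m * A = 8 * B^2" by (simp only: of_int_eq_iff)
  have "8 * 2^2 dvd 8 * B^2" using dvds(1) by (intro mult_dvd_mono dvd_power_same) auto
  then have "32 dvd m * A" unfolding mA by simp
  moreover have "coprime 32 A" using odd_A coprime_power_left_iff[of 2 5 A] by simp
  ultimately have "32 dvd m" by (simp add: coprime_dvd_mult_left_iff)
  then have "m = 0" using m(1) by auto
  then show False using mA B0 by simp
qed

lemma no_rational_root: "r^3 + 1 * r^2 + (- (3 + 2 * n)) * r + (- (n^2)) \<noteq> 0"
proof
  assume h: "r^3 + 1 * r^2 + (- (3 + 2 * n)) * r + (- (n^2)) = 0"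
  then have "(r + n)^2 = r * (r - 1) * (r + 3)" by algebra
  then have r: "r \<in> {0, 1, -3, 3, -1}" by (rule elliptic_rational_points)
  have "n * (n + 1) * (n - 3) * (n + 9) = 0"
    using r h by (auto; algebra)
  then show False using n_not_special by (auto simp: eq_neg_iff_add_eq_0)
qed

lemma ex_prime: obtains p where "prime p" "p dvd A" "\<not> 3 dvd multiplicity p A"
proof -
  have "\<exists>p. prime p \<and> \<not> 3 dvd multiplicity p A"
  proof (rule ccontr)
    assume "\<not> ?thesis"
    then obtain t where t: "A = t^3" using cube_of_multiplicities by blast
    obtain r :: rat where r: "of_int A ^ 2 * r^3 + of_int A ^ 2 * r^2
      - (3 * of_int A ^ 2 + 2 * of_int A * of_int (8 * B^2 - A)) * r - of_int (8 * B^2 - A) ^ 2 = 0"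
      by (rule root_of_cube[OF curve cop dvds B0 t])
    have "of_int A ^ 2 * (r^3 + 1 * r^2 + (- (3 + 2 * n)) * r + (- (n^2))) = 0"
      using r nA unfolding N_def[symmetric] by algebra
    then show False using no_rational_root A0 by simp
  qed
  then obtain p where p: "prime p" "\<not> 3 dvd multiplicity p A" by blast
  have "p dvd A"
  proof (rule ccontr)
    assume "\<not> p dvd A"
    then have "multiplicity p A = 0" by (rule not_dvd_imp_multiplicity_0)
    then show False using p(2) by simp
  qed
  then show ?thesis using that p by blast
qed

lemma ex_root: obtains x where "cubic 1 (- (3 + 2 * n)) (- (n^2)) x"
proof -
  define q :: "complex poly" where "q = [: of_rat (- (n^2)), of_rat (- (3 + 2 * n)), 1, 1 :]"
  have "degree q > 0" unfolding q_def by simp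
  then obtain x where "poly q x = 0" using alg_closed_imp_poly_has_root by blast
  then have "x^3 + of_rat 1 * x^2 + of_rat (- (3 + 2 * n)) * x + of_rat (- (n^2)) = 0"
    unfolding q_def by (simp add: algebra_simps power2_eq_square power3_eq_cube)
  then show ?thesis using that no_rational_root by (metis cubic.intro cubic_axioms.intro cubic_root.intro)
qed

lemma cyclic_cubic:
  assumes x: "cubic 1 (- (3 + 2 * n)) (- (n^2)) x"
  shows "cyclic_cubic_field (cubic_span x)"
proof -
  interpret cubic 1 "- (3 + 2 * n)" "- (n^2)" x by (fact x)
  define a b c w where "a = (of_int A :: rat)" and "b = (of_int B :: rat)" and "c = (of_int C :: rat)"
    and "w = 32 * b * c / a^2"
  have a0: "a \<noteq> 0" unfolding a_def using A0 by simp
  have w: "w * a^2 = 32 * b * c" unfolding w_def using a0 by simp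
  have na: "n * a = 8 * b^2 - a" using nA unfolding N_def a_def b_def by simp
  have "c^2 = a^3 - 10 * a^2 * b^2 + 88 * a * b^4 - 108 * b^6"
    using arg_cong[OF curve[unfolded curve_eq_def], of "of_int :: int \<Rightarrow> rat"] unfolding a_def b_def c_def by simp
  moreover have "disc * a^4 = (8 * b^2) * (- 27 * (n * a)^3 + 95 * (n * a)^2 * a + 111 * (n * a) * a^2 + 117 * a^3)"
  proof -
    have "disc = (n + 1) * (- 27 * n^3 + 95 * n^2 + 111 * n + 117)"
      unfolding disc_def by (simp add: algebra_simps power2_eq_square power3_eq_cube)
    then show ?thesis using na by algebra
  qed
  ultimately have "disc * a^4 = (w * a^2)^2" unfolding w na by algebra
  then have "disc * a^4 = w^2 * a^4" by (simp add: power_mult_distrib flip: power_mult)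
  then have "disc = w^2" using a0 by simp
  then show ?thesis by (rule cyclic)
qed

lemma infinite_ap:
  assumes x: "cubic 1 (- (3 + 2 * n)) (- (n^2)) x"
  shows "infinite (ap4sq_points (cubic_span x))"
proof -
  obtain B' where B': "B = 2 * B'" using dvds(1) ..
  have "n = (8 * of_int B ^ 2 - of_int A) / of_int A" unfolding n_def N_def by simp
  also have "\<dots> = - 1 + 32 * (of_int (B'^2) / of_int A)"
    using A0 by (simp add: B' diff_divide_distrib power_mult_distrib)
  finally have "n = - 1 + 32 * (of_int (B'^2) / of_int A)" .
  then show ?thesis using infinite_ap4sq_points[OF x] odd_ratI odd_A by blast
qed

lemma scaled_root:
  assumes x: "cubic 1 (- (3 + 2 * n)) (- (n^2)) x"
  shows "of_int A ^ 2 * x^3 + of_int A ^ 2 * x^2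
      - (3 * of_int A ^ 2 + 2 * of_int A * of_int N) * x - of_int N ^ 2 = 0"
proof -
  interpret cubic 1 "- (3 + 2 * n)" "- (n^2)" x by (fact x)
  have nA': "of_rat n * of_int A = (of_int N :: complex)"
    using arg_cong[OF nA, of "of_rat :: rat \<Rightarrow> complex"] by (simp add: of_rat_mult)
  have "of_int A ^ 2 * (x^3 + of_rat 1 * x^2 + of_rat (- (3 + 2 * n)) * x + of_rat (- (n^2))) =
      of_int A ^ 2 * x^3 + of_int A ^ 2 * x^2
      - (3 * of_int A ^ 2 + 2 * of_int A * (of_rat n * of_int A)) * x - (of_rat n * of_int A) ^ 2"
    unfolding of_rat_minus of_rat_add of_rat_mult of_rat_power of_rat_numeral_eq of_rat_1
      mult_1_left by algebra
  then show ?thesis unfolding root nA' by simp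
qed

lemma ex_ramified:
  assumes x: "cubic 1 (- (3 + 2 * n)) (- (n^2)) x"
  shows "\<exists>p. prime p \<and> odd p \<and> ramified p (cubic_span x)"
proof -
  obtain p where p: "prime p" "p dvd A" "\<not> 3 dvd multiplicity p A" by (rule ex_prime)
  have "odd p" using p(2) odd_A by (meson dvd_trans)
  then have "\<not> p dvd 8" using p(1) primes_dvd_imp_eq[of p 2] prime_dvd_power[of p 2 3] by auto
  moreover have "\<not> p dvd B" using p cop by (meson coprime_common_divisor not_prime_unit)
  ultimately have "\<not> p dvd 8 * B^2" using p(1) by (metis prime_dvd_mult_iff prime_dvd_power)
  then have "\<not> p dvd N" unfolding N_def using p(2) by (simp add: dvd_diff_left_iff)
  then have "ramified p (cubic_span x)"
    using ramified_of_multiplicity[OF p(1) _ A0 p(3) scaled_root[OF x]] by blast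
  then show ?thesis using p(1) \<open>odd p\<close> by blast
qed

text \<open>Modulo a prime dividing \<open>B\<close>, \<open>N\<close> is \<open>- A\<close>, and
  the characteristic polynomial of the integral element \<open>A * x\<close> becomes
  \<open>(X - A) * (X + A)^2\<close>. By \<open>ramified_char_poly\<close> it would have to be a
  cube, which its values at \<open>A\<close> and \<open>- A\<close> refute.\<close>

lemma not_ramified:
  assumes x: "cubic 1 (- (3 + 2 * n)) (- (n^2)) x" and p: "prime p" "odd p" "p dvd B"
  shows "\<not> ramified p (cubic_span x)"
proof
  interpret cubic 1 "- (3 + 2 * n)" "- (n^2)" x by (fact x)
  assume ram: "ramified p (cubic_span x)"
  define h1 h0 where "h1 = - (3 * A^2 + 2 * A * N)" and "h0 = - (A * N^2)"
  have \<theta>: "of_int A * x \<in> cubic_span x" using span_scale[OF span_gen, of "of_int A"] by simp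
  have "(of_int A * x)^3 + of_int A * (of_int A * x)^2 + of_int h1 * (of_int A * x) + of_int h0 =
      of_int A * (of_int A ^ 2 * x^3 + of_int A ^ 2 * x^2
      - (3 * of_int A ^ 2 + 2 * of_int A * of_int N) * x - of_int N ^ 2)"
    unfolding h1_def h0_def of_int_minus of_int_add of_int_mult of_int_power of_int_numeral by algebra
  then have h: "(of_int A * x)^3 + of_int A * (of_int A * x)^2 + of_int h1 * (of_int A * x) + of_int h0 = 0"
    unfolding scaled_root[OF x] by simp
  have nr: "r^3 + of_int A * r^2 + of_int h1 * r + of_int h0 \<noteq> 0" for r :: rat
  proof
    assume e: "r^3 + of_int A * r^2 + of_int h1 * r + of_int h0 = 0"
    define s where "s = r / of_int A"
    have "s * of_int A = r" unfolding s_def using A0 by simp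
    moreover have "of_int A ^ 3 * (s^3 + 1 * s^2 + (- (3 + 2 * n)) * s + (- (n^2))) =
        (s * of_int A)^3 + of_int A * (s * of_int A)^2
        + - (3 * of_int A ^ 2 + 2 * of_int A * (n * of_int A)) * (s * of_int A) + - (of_int A * (n * of_int A)^2)"
      unfolding mult_1_left by algebra
    ultimately have "of_int A ^ 3 * (s^3 + 1 * s^2 + (- (3 + 2 * n)) * s + (- (n^2))) = 0"
      using e unfolding nA h1_def h0_def of_int_minus of_int_add of_int_mult of_int_power of_int_numeral by simp
    then show False using no_rational_root A0 by simp
  qed
  obtain a where a: "\<And>s. p dvd s^3 + A * s^2 + h1 * s + h0 - (s - a)^3"
    using ramified_char_poly[OF p(1) ram \<theta> h nr] by blast
  have "A^3 + A * A^2 + h1 * A + h0 = B * (- (64 * A * B^3))" unfolding h1_def h0_def N_def by algebra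
  then have "p dvd (A - a)^3" using a[of A] p(3) by (metis dvd_diff_right_iff dvd_mult2)
  then have 1: "p dvd A - a" using p(1) by (metis prime_dvd_power)
  have "(- A)^3 + A * (- A)^2 + h1 * (- A) + h0 = B * (8 * A * B * (4 * A - 8 * B^2))"
    unfolding h1_def h0_def N_def by algebra
  then have "p dvd (- A - a)^3" using a[of "- A"] p(3) by (metis dvd_diff_right_iff dvd_mult2)
  then have "p dvd - A - a" using p(1) by (metis prime_dvd_power)
  then have "p dvd (A - a) - (- A - a)" using 1 by (rule dvd_diff[rotated])
  then have "p dvd 2 * A" by simp
  then have "p dvd 2 \<or> p dvd A" using p(1) by (simp add: prime_dvd_mult_iff)
  moreover have "\<not> p dvd A" using p(1,3) cop by (meson coprime_common_divisor not_prime_unit)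
  ultimately have "p = 2" using primes_dvd_imp_eq[of p 2] p(1) by simp
  then show False using p(2) by simp
qed

end

theorem theorem2p5:
  shows "infinite {K. cyclic_cubic_field K \<and> infinite (ap4sq_points K)}"
proof
  define F where "F = {K. cyclic_cubic_field K \<and> infinite (ap4sq_points K)}"
  define R where "R K = (SOME p. prime p \<and> odd p \<and> ramified p K)" for K
  assume "finite {K. cyclic_cubic_field K \<and> infinite (ap4sq_points K)}"
  then have "finite F" unfolding F_def .
  \<comment> \<open>Members of \<open>F\<close> need not arise from this construction, so for some
    of them \<open>R K\<close> may be an arbitrary value of \<open>SOME\<close>; the filter retains
    only primes.\<close>
  then have "finite {p \<in> R ` F. prime p}" by simp
  then obtain A B C where ABC: "curve_eq A B C" "coprime A B" "B \<noteq> 0" "2 dvd B" "3 dvd B" "19 dvd B"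
    and S: "\<And>p. p \<in> {p \<in> R ` F. prime p} \<Longrightarrow> p dvd B"
    by (rule ex_point_near_origin) auto
  interpret near_point A B C by unfold_locales (use ABC in auto)
  obtain x where x: "cubic 1 (- (3 + 2 * n)) (- (n^2)) x" by (rule ex_root)
  define K where "K = cubic_span x"
  have "K \<in> F" unfolding F_def K_def using cyclic_cubic[OF x] infinite_ap[OF x] by simp
  have "prime (R K) \<and> odd (R K) \<and> ramified (R K) K"
    unfolding R_def K_def by (rule someI_ex[OF ex_ramified[OF x]])
  moreover from this have "R K dvd B" using S \<open>K \<in> F\<close> by blast
  ultimately show False using not_ramified[OF x] unfolding K_def by blast
qed

end
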